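(* Let $G$ be an amenable locally compact group and $\Gamma<G$ a lattice subgroup. If $\Gamma$ is not uniform (that is, $G/\Gamma$ is not compact), then the map $\iota:\mathrm{LIM}(\Gamma)\to\mathrm{TLIM}(G)$ is not onto.
   Context: All groups are Hausdorff. $G$ is amenable if $L_\infty(G)$ admits a left-invariant mean. A lattice in $G$ is a discrete subgroup $\Gamma$ such that $G/\Gamma$ carries a $G$-invariant Radon probability measure $\lambda$ (which is then unique); it is uniform if $G/\Gamma$ is compact. Write $(L_xf)(y)=f(xy)$. $\mathrm{LUC}(G)$ is the Banach algebra (sup norm) of bounded continuous functions $f$ on $G$ with $\lim_{x\to e}\|f-L_xf\|_\infty=0$. A mean on a space of bounded functions containing the constants is a positive linear functional $m$ with $m(1)=1$; it is left-invariant if $m(L_xf)=m(f)$ for all $f$ and $x$. $\mathrm{LIM}(\Gamma)$ is the set of left-invariant means on $\ell_\infty(\Gamma)$. $\mathrm{TLIM}(G)$ is the set of topological left-invariant means on $L_\infty(G)$, i.e. means $\mu$ with $\mu(f*\phi)=\mu(\phi)$ for all $\phi\in L_\infty(G)$ and $f\in L_1(G)$ with $f\ge0$, $\|f\|_1=1$; it is identified, via restriction (a bijection), with the set $\mathrm{LIM}(\mathrm{LUC}(G))$ of left-invariant means on $\mathrm{LUC}(G)$. For $m\in\mathrm{LIM}(\Gamma)$ and $f\in\mathrm{LUC}(G)$, let $P_mf(x\Gamma)=\langle m,(L_xf)|_\Gamma\rangle$, a well-defined bounded continuous function on $G/\Gamma$. The map $\iota$ is defined by $$\iota m(f)=\int_{G/\Gamma}P_mf\,d\lambda,\qquad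 f\in\mathrm{LUC}(G).$$ *)

theory Defs
  imports "HOL-Analysis.Analysis"
begin

text \<open>
  A topological group is a type of class \<open>topological_group_add\<close>. Despite the additive notation
  this class does not assume commutativity: \<open>x + y\<close> is the product $xy$, \<open>- x\<close> is $x^{-1}$ and
  \<open>0\<close> is the identity $e$. All function spaces are spaces of complex-valued functions.
\<close>

definition ltrans :: "'a::plus \<Rightarrow> ('a \<Rightarrow> 'b) \<Rightarrow> 'a \<Rightarrow> 'b" where
  "ltrans x f = (\<lambda>y. f (x + y))"

subsection \<open>Radon and Haar measures\<close>

text \<open>
  A Radon measure on a Hausdorff space is a Borel measure that is finite on compact sets, outer
  regular on Borel sets and inner regular on open sets.
\<close>

definition radon_measure :: "'a topology \<Rightarrow> 'a measure \<Rightarrow> bool" where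
  "radon_measure T M \<longleftrightarrow>
     space M = topspace T \<and>
     sets M = sigma_sets (topspace T) {U. openin T U} \<and>
     (\<forall>K. compactin T K \<longrightarrow> emeasure M K < \<infinity>) \<and>
     (\<forall>B\<in>sets M. emeasure M B = (INF U\<in>{U. openin T U \<and> B \<subseteq> U}. emeasure M U)) \<and>
     (\<forall>U. openin T U \<longrightarrow> emeasure M U = (SUP K\<in>{K. compactin T K \<and> K \<subseteq> U}. emeasure M K))"

definition left_haar_measure :: "'a::topological_group_add measure \<Rightarrow> bool" where
  "left_haar_measure \<mu> \<longleftrightarrow>
     radon_measure euclidean \<mu> \<and> emeasure \<mu> UNIV \<noteq> 0 \<and>
     (\<forall>x. \<forall>B\<in>sets \<mu>. emeasure \<mu> ((+) x ` B) = emeasure \<mu> B)"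

lemma left_haar_measure_sets: "left_haar_measure \<mu> \<Longrightarrow> sets \<mu> = sets borel"
  by (simp add: left_haar_measure_def radon_measure_def borel_def sets_measure_of)

subsection \<open>Means\<close>

text \<open>
  A function on a set \<open>S\<close>, and a functional on a set \<open>X\<close> of such functions, are represented by
  total functions that are \<^const>\<open>undefined\<close> outside \<open>S\<close> and outside \<open>X\<close>, respectively.
\<close>

definition means :: "'a set \<Rightarrow> ('a \<Rightarrow> complex) set \<Rightarrow> (('a \<Rightarrow> complex) \<Rightarrow> complex) set" where
  "means S X = {m \<in> extensional X.
     (\<forall>f\<in>X. \<forall>g\<in>X. m (\<lambda>x\<in>S. f x + g x) = m f + m g) \<and>
     (\<forall>c. \<forall>f\<in>X. m (\<lambda>x\<in>S. c * f x) = c * m f) \<and>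
     (\<forall>f\<in>X. (\<forall>x\<in>S. f x \<in> \<real>\<^sub>\<ge>\<^sub>0) \<longrightarrow> m f \<in> \<real>\<^sub>\<ge>\<^sub>0) \<and>
     m (\<lambda>x\<in>S. 1) = 1}"

definition linfty :: "'a set \<Rightarrow> ('a \<Rightarrow> complex) set" where
  "linfty S = {f \<in> extensional S. bounded (f ` S)}"

definition left_inv_means :: "'a::group_add set \<Rightarrow> (('a \<Rightarrow> complex) \<Rightarrow> complex) set" where
  "left_inv_means \<Gamma> = {m \<in> means \<Gamma> (linfty \<Gamma>).
     \<forall>x\<in>\<Gamma>. \<forall>f\<in>linfty \<Gamma>. m (restrict (ltrans x f) \<Gamma>) = m f}"

definition LUC :: "('a::topological_group_add \<Rightarrow> complex) set" where
  "LUC = {f \<in> bcontfun. ((\<lambda>x. SUP y. cmod (f y - ltrans x f y)) \<longlongrightarrow> 0) (nhds 0)}"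

subsection \<open>The space of essentially bounded functions\<close>

text \<open>
  For groups that are not $\sigma$-compact the space $L_\infty$ is formed with locally measurable
  functions modulo locally null sets, where ``locally'' refers to Borel sets of finite measure.
\<close>

definition loc_null :: "'a measure \<Rightarrow> 'a set \<Rightarrow> bool" where
  "loc_null \<mu> E \<longleftrightarrow> (\<forall>F\<in>sets \<mu>. emeasure \<mu> F < \<infinity> \<longrightarrow> E \<inter> F \<in> null_sets \<mu>)"

definition loc_measurable :: "'a measure \<Rightarrow> ('a \<Rightarrow> complex) \<Rightarrow> bool" where
  "loc_measurable \<mu> \<phi> \<longleftrightarrow>
     (\<forall>B\<in>sets borel. \<forall>F\<in>sets \<mu>. emeasure \<mu> F < \<infinity> \<longrightarrow> \<phi> -` B \<inter> F \<in> sets \<mu>)"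

text \<open>
  \<open>Linf \<mu>\<close> consists of the representatives of elements of $L_\infty$; a functional on the quotient
  is a functional on \<open>Linf \<mu>\<close> that identifies functions which agree locally almost everywhere.
\<close>

definition Linf :: "'a measure \<Rightarrow> ('a \<Rightarrow> complex) set" where
  "Linf \<mu> = {\<phi>. loc_measurable \<mu> \<phi> \<and> (\<exists>C. loc_null \<mu> {x. cmod (\<phi> x) > C})}"

definition Linf_means :: "'a measure \<Rightarrow> (('a \<Rightarrow> complex) \<Rightarrow> complex) set" where
  "Linf_means \<mu> = {m \<in> means UNIV (Linf \<mu>).
     \<forall>\<phi>\<in>Linf \<mu>. \<forall>\<psi>\<in>Linf \<mu>. loc_null \<mu> {x. \<phi> x \<noteq> \<psi> x} \<longrightarrow> m \<phi> = m \<psi>}"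

definition amenable :: "'a::group_add measure \<Rightarrow> bool" where
  "amenable \<mu> \<longleftrightarrow> (\<exists>m\<in>Linf_means \<mu>. \<forall>x. \<forall>\<phi>\<in>Linf \<mu>. m (ltrans x \<phi>) = m \<phi>)"

definition conv :: "'a::group_add measure \<Rightarrow> ('a \<Rightarrow> real) \<Rightarrow> ('a \<Rightarrow> complex) \<Rightarrow> 'a \<Rightarrow> complex" where
  "conv \<mu> f \<phi> = (\<lambda>x. \<integral>y. f y *\<^sub>R \<phi> (- y + x) \<partial>\<mu>)"

definition top_left_inv_means :: "'a::group_add measure \<Rightarrow> (('a \<Rightarrow> complex) \<Rightarrow> complex) set" where
  "top_left_inv_means \<mu> = {m \<in> Linf_means \<mu>.
     \<forall>f. integrable \<mu> f \<and> (\<forall>x. f x \<ge> 0) \<and> (\<integral>x. f x \<partial>\<mu>) = 1 \<longrightarrow>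
       (\<forall>\<phi>\<in>Linf \<mu>. m (conv \<mu> f \<phi>) = m \<phi>)}"

subsection \<open>Lattices\<close>

definition add_subgroup :: "'a::group_add set \<Rightarrow> bool" where
  "add_subgroup \<Gamma> \<longleftrightarrow> 0 \<in> \<Gamma> \<and> (\<forall>x\<in>\<Gamma>. \<forall>y\<in>\<Gamma>. x + y \<in> \<Gamma>) \<and> (\<forall>x\<in>\<Gamma>. - x \<in> \<Gamma>)"

definition lcoset :: "'a::group_add set \<Rightarrow> 'a \<Rightarrow> 'a set" where
  "lcoset \<Gamma> x = (+) x ` \<Gamma>"

definition coset_topology :: "'a::topological_group_add set \<Rightarrow> 'a set topology" where
  "coset_topology \<Gamma> = topology (\<lambda>U. U \<subseteq> range (lcoset \<Gamma>) \<and> open (lcoset \<Gamma> -` U))"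

lemma openin_coset_topology:
  "openin (coset_topology \<Gamma>) U \<longleftrightarrow> U \<subseteq> range (lcoset \<Gamma>) \<and> open (lcoset \<Gamma> -` U)"
proof -
  have "istopology (\<lambda>U. U \<subseteq> range (lcoset \<Gamma>) \<and> open (lcoset \<Gamma> -` U))"
    unfolding istopology_def by (auto simp: vimage_Union)
  then show ?thesis
    by (simp add: coset_topology_def)
qed

lemma topspace_coset_topology: "topspace (coset_topology \<Gamma>) = range (lcoset \<Gamma>)"
proof -
  have "lcoset \<Gamma> -` range (lcoset \<Gamma>) = UNIV"
    by auto
  then have "openin (coset_topology \<Gamma>) (range (lcoset \<Gamma>))"
    by (simp add: openin_coset_topology)
  then show ?thesis
    unfolding topspace_def by (auto simp: openin_coset_topology)
qed

lemma quotient_map_lcoset: "quotient_map euclidean (coset_topology \<Gamma>) (lcoset \<Gamma>)"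
  by (simp add: quotient_map_def topspace_coset_topology openin_coset_topology vimage_def)

text \<open>The group acts on the coset space by $x \cdot C = xC$.\<close>

definition invariant_radon_prob :: "'a::topological_group_add set \<Rightarrow> 'a set measure \<Rightarrow> bool" where
  "invariant_radon_prob \<Gamma> \<nu> \<longleftrightarrow>
     radon_measure (coset_topology \<Gamma>) \<nu> \<and> emeasure \<nu> (space \<nu>) = 1 \<and>
     (\<forall>x. \<forall>B\<in>sets \<nu>. emeasure \<nu> ((\<lambda>C. (+) x ` C) ` B) = emeasure \<nu> B)"

definition lattice_subgroup :: "'a::topological_group_add set \<Rightarrow> bool" where
  "lattice_subgroup \<Gamma> \<longleftrightarrow>
     add_subgroup \<Gamma> \<and> discrete \<Gamma> \<and> (\<exists>\<nu>. invariant_radon_prob \<Gamma> \<nu>)"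

definition uniform_lattice :: "'a::topological_group_add set \<Rightarrow> bool" where
  "uniform_lattice \<Gamma> \<longleftrightarrow> lattice_subgroup \<Gamma> \<and> compact_space (coset_topology \<Gamma>)"

subsection \<open>The map \<open>\<iota>\<close>\<close>

definition Pmap :: "'a::group_add set \<Rightarrow>
    (('a \<Rightarrow> complex) \<Rightarrow> complex) \<Rightarrow> ('a \<Rightarrow> complex) \<Rightarrow> 'a set \<Rightarrow> complex" where
  "Pmap \<Gamma> m f C = m (restrict (ltrans (SOME x. C = lcoset \<Gamma> x) f) \<Gamma>)"

text \<open>The value does not depend on the chosen representative of the coset.\<close>

lemma Pmap_lcoset:
  assumes "add_subgroup \<Gamma>" "m \<in> left_inv_means \<Gamma>" "bounded (range f)"
  shows "Pmap \<Gamma> m f (lcoset \<Gamma> x) = m (restrict (ltrans x f) \<Gamma>)"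
proof -
  define x' where "x' = (SOME y. lcoset \<Gamma> x = lcoset \<Gamma> y)"
  have eq: "lcoset \<Gamma> x = lcoset \<Gamma> x'"
    unfolding x'_def by (rule someI[where x = x]) simp
  have "x' + 0 \<in> lcoset \<Gamma> x'"
    using assms(1) unfolding lcoset_def add_subgroup_def by blast
  then obtain g where g: "g \<in> \<Gamma>" "x' = x + g"
    using eq unfolding lcoset_def by auto
  let ?h = "restrict (ltrans x f) \<Gamma>"
  have "?h ` \<Gamma> \<subseteq> range f"
    by (auto simp: ltrans_def)
  then have "?h \<in> linfty \<Gamma>"
    using assms(3) bounded_subset by (auto simp: linfty_def)
  then have "m (restrict (ltrans g ?h) \<Gamma>) = m ?h"
    using assms(2) g(1) by (auto simp: left_inv_means_def)
  moreover have "restrict (ltrans g ?h) \<Gamma> = restrict (ltrans x' f) \<Gamma>"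
    using assms(1) g by (auto simp: ltrans_def add_subgroup_def add.assoc restrict_def)
  ultimately show ?thesis
    by (simp add: Pmap_def x'_def)
qed

text \<open>
  \<open>iota \<Gamma> \<nu> m\<close> is a functional on \<^const>\<open>LUC\<close>; elements of
  \<^const>\<open>top_left_inv_means\<close> are compared with it via their restrictions to \<^const>\<open>LUC\<close>.
\<close>

definition iota :: "'a::topological_group_add set \<Rightarrow> 'a set measure \<Rightarrow>
    (('a \<Rightarrow> complex) \<Rightarrow> complex) \<Rightarrow> ('a \<Rightarrow> complex) \<Rightarrow> complex" where
  "iota \<Gamma> \<nu> m = (\<lambda>f\<in>LUC. \<integral>C. Pmap \<Gamma> m f C \<partial>\<nu>)"

end

theory Submission
  imports Defs
begin

text \<open>
  Write \<open>G\<close> for the group. The functional \<open>iota \<Gamma> \<nu> m\<close> sees a right \<open>\<Gamma>\<close>-invariant function \<open>H\<close> in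
  \<open>LUC\<close> only through the function that \<open>H\<close> induces on \<open>G/\<Gamma>\<close>: this induced function is \<open>Pmap \<Gamma> m H\<close>
  for every \<open>m\<close>, and \<open>iota \<Gamma> \<nu> m H\<close> is its integral. If \<open>H\<close> is nonnegative and \<open>H 0 > 0\<close>, the integral
  is positive, because nonempty open subsets of \<open>G/\<Gamma>\<close> have positive measure
  (\<open>iota_invariant_function_nonzero\<close>). Take for \<open>H\<close> the \<open>saturation\<close> of a bump function with compact
  support, which vanishes off \<open>K + \<Gamma>\<close> for a compact \<open>K\<close>. It suffices to exhibit a topological
  left-invariant mean \<open>M\<close> with \<open>M H = 0\<close>: a mean whose mass has escaped to infinity in the noncompact
  space \<open>G/\<Gamma>\<close>.

  Such a mean is first built on \<open>LUC\<close>. Let \<open>U\<close> be an ultrafilter on \<open>G\<close> along which the coset of \<open>x\<close>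
  leaves every compact set (\<open>escaping_filter\<close>), and let \<open>m\<^sub>0\<close> be a left-invariant mean. The function
  \<open>y \<mapsto> lim \<psi> (y + x)\<close>, the limit being taken over \<open>x\<close> along \<open>U\<close>, is again in \<open>LUC\<close>, and applying \<open>m\<^sub>0\<close> to
  it gives a left-invariant mean \<open>N\<close> on \<open>LUC\<close> (\<open>ultrafilter_mean\<close>). The order of the two operations
  is essential: for each fixed \<open>y\<close>, the point \<open>y + x\<close> eventually leaves \<open>K + \<Gamma>\<close>, so \<open>N H = 0\<close>.

  Then \<open>M \<phi> = N (e * \<phi>)\<close>, with \<open>e\<close> continuous of compact support and integral \<open>1\<close>, extends \<open>N\<close> to
  a topological left-invariant mean (\<open>top_left_inv_extension\<close>). This rests on \<open>N (e * \<psi>) = N \<psi>\<close> for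
  \<open>\<psi>\<close> in \<open>LUC\<close> (\<open>N_conv_Cc\<close>) and on \<open>N (f * \<phi>) = (\<integral> f) N (e * \<phi>)\<close> for \<open>f\<close> in \<open>L\<^sub>1\<close> (\<open>N_conv_eq\<close>). Both
  are consequences of left invariance, once convolutions are replaced by Riemann sums, which are
  finite combinations of left translates (\<open>riemann_sum\<close>, \<open>Cc_convolution_approx\<close>). Working with
  finite sums has the advantage that measurability on the product \<open>G \<times> G\<close>, which is problematic
  for groups that are not second countable, does not enter at this point.

  It remains to make sense of \<open>f * \<phi>\<close> when \<open>\<phi>\<close> is merely locally measurable and defined up to locally
  null sets. Two facts are used: an integrable function vanishes off a \<open>\<sigma>\<close>-compact set
  (\<open>integrable_sigma_compact\<close>), and inversion preserves null sets inside compact sets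
  (\<open>null_reflect\<close>).
\<close>

section \<open>Continuous functions of compact support\<close>

definition Cc :: "('a::topological_space \<Rightarrow> real) set" where
  "Cc = {f. continuous_on UNIV f \<and> (\<exists>K. compact K \<and> (\<forall>x. x \<notin> K \<longrightarrow> f x = 0))}"

lemma CcI: "continuous_on UNIV f \<Longrightarrow> compact K \<Longrightarrow> (\<And>x. x \<notin> K \<Longrightarrow> f x = 0) \<Longrightarrow> f \<in> Cc"
  by (auto simp: Cc_def)

lemma CcE:
  assumes "f \<in> Cc"
  obtains K where "continuous_on UNIV f" "compact K" "\<And>x. x \<notin> K \<Longrightarrow> f x = 0"
  using assms by (auto simp: Cc_def)

lemma Cc_bounded:
  assumes "f \<in> Cc" obtains B where "B > 0" "\<And>x. \<bar>f x\<bar> \<le> B"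
proof -
  obtain K where K: "continuous_on UNIV f" "compact K" "\<And>x. x \<notin> K \<Longrightarrow> f x = 0"
    using CcE[OF assms] by blast
  have "compact (f ` K)" using K by (meson compact_continuous_image continuous_on_subset subset_UNIV)
  then obtain B where B: "\<And>x. x \<in> K \<Longrightarrow> \<bar>f x\<bar> \<le> B"
    using compact_imp_bounded bounded_iff by (metis imageI real_norm_def)
  have "\<bar>f x\<bar> \<le> max B 1" for x using B[of x] K(3)[of x] by (cases "x \<in> K") auto
  then show thesis by (intro that[of "max B 1"]) auto
qed

lemma continuous_on_UNIV_compose:
  "continuous_on UNIV f \<Longrightarrow> continuous_on UNIV g \<Longrightarrow> continuous_on UNIV (\<lambda>x. f (g x))"
  by (rule continuous_on_compose2) auto

lemma open_vimage_UNIV: "open S \<Longrightarrow> continuous_on UNIV f \<Longrightarrow> open {x. f x \<in> S}"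
  using open_vimage[of S f] by (simp add: vimage_def)

lemma compact_sums_group:
  fixes K L :: "'a::topological_group_add set"
  assumes "compact K" "compact L"
  shows "compact ((\<lambda>(x, y). x + y) ` (K \<times> L))"
proof (rule compact_continuous_image)
  show "continuous_on (K \<times> L) (\<lambda>(x, y). x + y)"
    by (simp add: case_prod_unfold) (intro continuous_intros)
  show "compact (K \<times> L)" using assms by (rule compact_Times)
qed

lemma compact_uminus_image:
  fixes K :: "'a::topological_group_add set"
  assumes "compact K" shows "compact (uminus ` K)"
  by (rule compact_continuous_image[OF _ assms]) (intro continuous_intros)

lemma compact_translation_group:
  fixes K :: "'a::topological_group_add set"
  assumes "compact K" shows "compact ((+) a ` K)"
  by (rule compact_continuous_image[OF _ assms]) (intro continuous_intros)

lemma minus_add_self: "- v + (v + x) = (x::'a::group_add)" "v + (- v + x) = x"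
   "(x + v) + - v = x" "(x + - v) + v = x"
  by (simp_all add: add.assoc[symmetric])

lemma Cc_reflect:
  assumes "f \<in> Cc" shows "(\<lambda>x::'a::topological_group_add. f (- x)) \<in> Cc"
proof -
  obtain K where K: "continuous_on UNIV f" "compact K" "\<And>x. x \<notin> K \<Longrightarrow> f x = 0"
    using CcE[OF assms] by blast
  show ?thesis
  proof (rule CcI[OF _ compact_uminus_image[OF K(2)]])
    show "continuous_on UNIV (\<lambda>x. f (- x))"
      by (intro continuous_on_UNIV_compose[OF K(1)] continuous_intros)
    show "f (- x) = 0" if "x \<notin> uminus ` K" for x
      using that by (intro K(3)) (metis imageI minus_minus)
  qed
qed

lemma Cc_translate:
  assumes "f \<in> Cc" shows "(\<lambda>x::'a::topological_group_add. f (a + x)) \<in> Cc"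
proof -
  obtain K where K: "continuous_on UNIV f" "compact K" "\<And>x. x \<notin> K \<Longrightarrow> f x = 0"
    using CcE[OF assms] by blast
  show ?thesis
  proof (rule CcI[OF _ compact_translation_group[OF K(2), of "- a"]])
    show "continuous_on UNIV (\<lambda>x. f (a + x))"
      by (intro continuous_on_UNIV_compose[OF K(1)] continuous_intros)
    show "f (a + x) = 0" if "x \<notin> (+) (- a) ` K" for x
      using that by (intro K(3)) (metis imageI minus_add_self(1))
  qed
qed

lemma Cc_scale: "f \<in> Cc \<Longrightarrow> (\<lambda>x. c * f x) \<in> Cc"
  by (auto simp: Cc_def intro!: continuous_intros)

lemma Cc_add:
  assumes "f \<in> Cc" "g \<in> Cc" shows "(\<lambda>x. f x + g x) \<in> Cc"
proof -
  obtain K where K: "continuous_on UNIV f" "compact K" "\<And>x. x \<notin> K \<Longrightarrow> f x = 0"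
    using CcE[OF assms(1)] by blast
  obtain L where L: "continuous_on UNIV g" "compact L" "\<And>x. x \<notin> L \<Longrightarrow> g x = 0"
    using CcE[OF assms(2)] by blast
  show ?thesis
    by (rule CcI[of _ "K \<union> L"]) (use K L in \<open>auto intro!: continuous_intros\<close>)
qed

lemma Cc_diff: "f \<in> Cc \<Longrightarrow> g \<in> Cc \<Longrightarrow> (\<lambda>x. f x - g x) \<in> Cc"
  using Cc_add[of f "\<lambda>x. (-1) * g x"] Cc_scale[of g "-1"] by simp

lemma Cc_zero: "(\<lambda>x. 0) \<in> Cc"
  by (rule CcI[of _ "{}"]) auto

lemma Cc_sum: "finite Y \<Longrightarrow> (\<And>y. y \<in> Y \<Longrightarrow> f y \<in> Cc) \<Longrightarrow> (\<lambda>x. \<Sum>y\<in>Y. f y x) \<in> Cc"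
  by (induction Y rule: finite_induct) (auto intro: Cc_zero Cc_add)

lemma open_symmetric_nbhd:
  fixes V :: "'a::topological_group_add set"
  assumes "open V" "0 \<in> V"
  obtains W where "open W" "0 \<in> W" "W \<subseteq> V" "\<And>x. x \<in> W \<Longrightarrow> - x \<in> W"
proof (rule that[of "V \<inter> {x. - x \<in> V}"])
  show "open (V \<inter> {x. - x \<in> V})"
    by (intro open_Int assms open_vimage_UNIV continuous_intros)
qed (use assms in auto)

text \<open>
  Near a point of the support this is compactness. A point outside the support that \<open>v\<close> moves
  into it is covered by symmetry: \<open>- v\<close> moves its image back.
\<close>

lemma Cc_uniformly_continuous_left:
  fixes f :: "'a::topological_group_add \<Rightarrow> real"
  assumes f: "f \<in> Cc" and e: "e > 0"
  obtains V where "open V" "0 \<in> V" "\<And>v x. v \<in> V \<Longrightarrow> \<bar>f (v + x) - f x\<bar> < e"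
proof -
  obtain K where K: "continuous_on UNIV f" "compact K" "\<And>x. x \<notin> K \<Longrightarrow> f x = 0"
    using CcE[OF f] by blast
  let ?S = "{p. \<bar>f (fst p + snd p) - f (snd p)\<bar> < e}"
  have "continuous_on UNIV (\<lambda>p. f (fst p + snd p))" "continuous_on UNIV (\<lambda>p. f (snd p))"
    by (intro continuous_on_UNIV_compose[OF K(1)] continuous_intros)+
  then have "open ?S"
    by (intro open_Collect_less continuous_intros)
  moreover have "{0} \<times> K \<subseteq> ?S" using e by auto
  ultimately have "\<exists>V0. 0 \<in> V0 \<and> open V0 \<and> V0 \<times> K \<subseteq> ?S"
    by (rule Elementary_Topology.tube_lemma[OF K(2)])
  then obtain V0 where V0: "0 \<in> V0" "open V0" "V0 \<times> K \<subseteq> ?S"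
    by (elim exE conjE)
  obtain V where V: "open V" "0 \<in> V" "V \<subseteq> V0" "\<And>x. x \<in> V \<Longrightarrow> - x \<in> V"
    using open_symmetric_nbhd V0 by metis
  have in_K: "\<bar>f (v + x) - f x\<bar> < e" if "v \<in> V" "x \<in> K" for v x
  proof -
    have "(v, x) \<in> ?S" using V0(3) V(3) that by blast
    then show ?thesis by simp
  qed
  have "\<bar>f (v + x) - f x\<bar> < e" if "v \<in> V" for v x
  proof -
    consider "x \<in> K" | "v + x \<in> K" | "x \<notin> K" "v + x \<notin> K" by blast
    then show ?thesis
    proof cases
      case 2
      then show ?thesis using in_K[of "- v" "v + x"] V(4)[OF that] by (simp add: minus_add_self abs_minus_commute)
    qed (use in_K that K(3) e in auto)
  qed
  then show thesis using that V by blast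
qed

lemma Cc_uniformly_continuous_right:
  fixes f :: "'a::topological_group_add \<Rightarrow> real"
  assumes f: "f \<in> Cc" and e: "e > 0"
  obtains V where "open V" "0 \<in> V" "\<And>v x. v \<in> V \<Longrightarrow> \<bar>f (x + v) - f x\<bar> < e"
proof -
  obtain V0 where V0: "open V0" "0 \<in> V0" "\<And>v x. v \<in> V0 \<Longrightarrow> \<bar>f (- (v + x)) - f (- x)\<bar> < e"
    using Cc_uniformly_continuous_left[OF Cc_reflect[OF f] e] by blast
  obtain V where V: "open V" "0 \<in> V" "V \<subseteq> V0" "\<And>x. x \<in> V \<Longrightarrow> - x \<in> V"
    using open_symmetric_nbhd V0 by metis
  have "\<bar>f (x + v) - f x\<bar> < e" if "v \<in> V" for v x
  proof -
    have "- v \<in> V0" using V that by blast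
    from V0(3)[OF this, of "- x"] show ?thesis by (simp add: minus_add)
  qed
  then show thesis using that V by blast
qed

lemma Hausdorff_space_euclidean_t2: "Hausdorff_space (euclidean :: 'a::t2_space topology)"
  by (simp add: Hausdorff_space_def disjnt_def) (meson hausdorff)

lemma compact_subset_interior_compact:
  fixes K :: "'a::t2_space set"
  assumes "locally_compact_space (euclidean :: 'a topology)" "compact K"
  obtains U L where "open U" "compact L" "K \<subseteq> U" "U \<subseteq> L"
proof -
  have "\<forall>K. compactin euclidean K \<longrightarrow> (\<exists>U L. openin euclidean U \<and> compactin euclidean L \<and>
      closedin euclidean L \<and> K \<subseteq> U \<and> U \<subseteq> (L :: 'a set))"
    using locally_compact_space_compact_closed_compact[of "euclidean :: 'a topology"] assms(1)
      Hausdorff_space_euclidean_t2 by blast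
  from this[rule_format, of K] assms(2) show thesis
    using that by auto
qed

lemma Cc_Urysohn:
  fixes K :: "'a::t2_space set"
  assumes lc: "locally_compact_space (euclidean :: 'a topology)"
    and K: "compact K" and U: "open U" "K \<subseteq> U"
  obtains f :: "'a \<Rightarrow> real" where "f \<in> Cc" "\<And>x. 0 \<le> f x" "\<And>x. f x \<le> 1" "\<And>x. x \<in> K \<Longrightarrow> f x = 1"
    "\<And>x. x \<notin> U \<Longrightarrow> f x = 0"
proof -
  obtain W L where W: "open W" "compact L" "K \<subseteq> W" "W \<subseteq> L"
    using compact_subset_interior_compact[OF lc K] by blast
  have cr: "completely_regular_space (euclidean :: 'a topology)"
    by (intro locally_compact_regular_imp_completely_regular_space lc disjI1 Hausdorff_space_euclidean_t2)
  obtain f :: "'a \<Rightarrow> real" where f: "continuous_map euclidean (subtopology euclidean {0..1}) f"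
      "f ` (- (W \<inter> U)) \<subseteq> {0}" "f ` K \<subseteq> {1}"
    using Urysohn_completely_regular_compact_closed[OF _ cr, of 0 1 K "- (W \<inter> U)"] K U W
    by (auto simp: disjnt_def closed_Compl open_Int)
  have r: "f x \<in> {0..1}" for x using f(1) by (auto simp: continuous_map_in_subtopology)
  have "continuous_on UNIV f" using f(1) by (auto simp: continuous_map_in_subtopology)
  then have "f \<in> Cc" by (rule CcI[OF _ W(2)]) (use f W in \<open>auto simp: image_subset_iff\<close>)
  then show thesis using that[of f] r f by (auto simp: image_subset_iff)
qed

section \<open>Haar measure and Riemann sums\<close>

locale haar_group =
  fixes \<mu> :: "'a::{topological_group_add, t2_space} measure"
  assumes locally_compact: "locally_compact_space (euclidean :: 'a topology)"
    and haar: "left_haar_measure \<mu>"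
begin

lemma sets_mu [simp, measurable_cong]: "sets \<mu> = sets borel"
  using haar by (rule left_haar_measure_sets)

lemma space_mu [simp]: "space \<mu> = UNIV"
  using sets_eq_imp_space_eq[OF sets_mu] by simp

lemma radon: "radon_measure euclidean \<mu>"
  using haar by (simp add: left_haar_measure_def)

lemma emeasure_compact_finite: "compact K \<Longrightarrow> emeasure \<mu> K < \<infinity>"
  using radon by (simp add: radon_measure_def)

lemma borel_compact [measurable, intro, simp]: "compact K \<Longrightarrow> K \<in> sets borel" for K :: "'a set"
  by (rule borel_compact)

lemma outer_regular:
  assumes "A \<in> sets borel" "emeasure \<mu> A < x"
  obtains U where "open U" "A \<subseteq> U" "emeasure \<mu> U < x"
proof -
  have "\<forall>B\<in>sets \<mu>. emeasure \<mu> B = (INF U\<in>{U. openin euclidean U \<and> B \<subseteq> U}. emeasure \<mu> U)"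
    using radon unfolding radon_measure_def by blast
  from this[rule_format, of A] have "emeasure \<mu> A = (INF U\<in>{U. open U \<and> A \<subseteq> U}. emeasure \<mu> U)"
    using assms(1) by simp
  then show thesis using assms(2) that by (auto simp: INF_less_iff)
qed

lemma inner_regular:
  assumes "open U" "x < emeasure \<mu> U"
  obtains K where "compact K" "K \<subseteq> U" "x < emeasure \<mu> K"
proof -
  have "\<forall>U. openin euclidean U \<longrightarrow>
      emeasure \<mu> U = (SUP K\<in>{K. compactin euclidean K \<and> K \<subseteq> U}. emeasure \<mu> K)"
    using radon unfolding radon_measure_def by blast
  from this[rule_format, of U] have "emeasure \<mu> U = (SUP K\<in>{K. compact K \<and> K \<subseteq> U}. emeasure \<mu> K)"
    using assms(1) by simp
  then show thesis using assms(2) that by (auto simp: less_SUP_iff)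
qed

lemma emeasure_left_translate:
  "A \<in> sets borel \<Longrightarrow> emeasure \<mu> ((+) a ` A) = emeasure \<mu> A"
  using haar by (simp add: left_haar_measure_def)

lemma continuous_measurable [intro]:
  "continuous_on UNIV f \<Longrightarrow> f \<in> borel_measurable \<mu>"
  for f :: "'a \<Rightarrow> 'b::topological_space"
  using borel_measurable_continuous_onI measurable_cong_sets[OF sets_mu refl] by blast

lemma measurable_left [measurable]: "(+) a \<in> measurable \<mu> \<mu>"
proof -
  have "(+) a \<in> borel_measurable \<mu>"
    by (intro continuous_measurable continuous_intros)
  then show ?thesis using measurable_cong_sets[OF refl sets_mu] by blast
qed

lemma left_vimage: "(+) a -` A = (+) (- a) ` A" for a :: 'a
  by (auto simp: image_iff minus_add_self) (metis minus_add_self(1))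

lemma open_left_translate: "open U \<Longrightarrow> open ((+) a ` U)" for U :: "'a set"
  using open_vimage[of U "(+) (- a)"] left_vimage[of "- a" U]
  by (simp add: continuous_intros)

lemma distr_left: "distr \<mu> \<mu> ((+) a) = \<mu>"
proof (rule measure_eqI)
  fix A assume A: "A \<in> sets (distr \<mu> \<mu> ((+) a))"
  then show "emeasure (distr \<mu> \<mu> ((+) a)) A = emeasure \<mu> A"
    by (simp add: emeasure_distr left_vimage emeasure_left_translate)
qed simp

lemma integral_left:
  fixes f :: "'a \<Rightarrow> 'b::{banach, second_countable_topology}"
  assumes "f \<in> borel_measurable \<mu>"
  shows "(\<integral>x. f (a + x) \<partial>\<mu>) = (\<integral>x. f x \<partial>\<mu>)"
  using integral_distr[OF measurable_left assms, of a] by (simp add: distr_left)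

lemma integrable_left:
  fixes f :: "'a \<Rightarrow> 'b::{banach, second_countable_topology}"
  assumes "integrable \<mu> f"
  shows "integrable \<mu> (\<lambda>x. f (a + x))"
  using integrable_distr_eq[OF measurable_left, of f a] assms by (simp add: distr_left)

text \<open>
  Translation is invertible, so \<open>f\<close> and its translate are measurable together; if they are not,
  both integrals are \<open>0\<close> by convention.
\<close>

lemma integral_left_total:
  fixes f :: "'a \<Rightarrow> 'b::{banach, second_countable_topology}"
  shows "(\<integral>x. f (a + x) \<partial>\<mu>) = (\<integral>x. f x \<partial>\<mu>)"
proof (cases "f \<in> borel_measurable \<mu>")
  case False
  have "(\<lambda>x. f (a + x)) \<notin> borel_measurable \<mu>"
  proof
    assume "(\<lambda>x. f (a + x)) \<in> borel_measurable \<mu>"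
    then have "(\<lambda>x. f (a + (- a + x))) \<in> borel_measurable \<mu>"
      by (rule measurable_compose[OF measurable_left])
    then show False using False by (simp add: minus_add_self)
  qed
  with False show ?thesis
    by (metis borel_measurable_integrable not_integrable_integral_eq)
qed (rule integral_left)

lemma integrable_bounded_compact:
  fixes f :: "'a \<Rightarrow> 'b::{banach, second_countable_topology}"
  assumes "f \<in> borel_measurable \<mu>" "compact K" "\<And>x. x \<notin> K \<Longrightarrow> f x = 0" "\<And>x. norm (f x) \<le> B"
  shows "integrable \<mu> f" "(\<integral>x. norm (f x) \<partial>\<mu>) \<le> B * measure \<mu> K"
proof -
  show int: "integrable \<mu> f"
    by (rule integrableI_bounded_set[where A=K and B=B])
       (use assms emeasure_compact_finite in auto)
  have K: "integrable \<mu> (\<lambda>x. indicator K x * B)"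
    using emeasure_compact_finite[OF assms(2)] assms(2) by (intro integrable_mult_left) (auto simp: integrable_indicator_iff)
  have "(\<integral>x. norm (f x) \<partial>\<mu>) \<le> (\<integral>x. indicator K x * B \<partial>\<mu>)"
    by (rule integral_mono) (use int K assms in \<open>auto simp: indicator_def\<close>)
  then show "(\<integral>x. norm (f x) \<partial>\<mu>) \<le> B * measure \<mu> K"
    using assms(2) by (simp add: mult.commute)
qed

lemma Cc_measurable: "f \<in> Cc \<Longrightarrow> f \<in> borel_measurable \<mu>"
  by (auto simp: Cc_def)

lemma Cc_integrable: "f \<in> Cc \<Longrightarrow> integrable \<mu> f"
  by (metis CcE Cc_bounded Cc_measurable integrable_bounded_compact(1) real_norm_def)

text \<open>
  If an open set were null, so would be its translates; finitely many of them cover a given compact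
  set, hence all compact sets and then, by inner regularity, the whole group would be null.
\<close>

lemma emeasure_open_pos:
  assumes "open U" "U \<noteq> {}"
  shows "emeasure \<mu> U > 0"
proof (rule ccontr)
  assume "\<not> ?thesis"
  then have U0: "emeasure \<mu> U = 0" by (simp add: not_gr_zero)
  obtain u where u: "u \<in> U" using assms by blast
  note opn = open_left_translate[OF assms(1)]
  have "emeasure \<mu> K = 0" if K: "compact K" for K
  proof -
    have "k \<in> (+) (k + - u) ` U" for k
      using u by (intro image_eqI[of _ _ u]) (simp_all only: minus_add_self)
    then have "K \<subseteq> \<Union>((\<lambda>k. (+) (k + - u) ` U) ` K)" by blast
    moreover have "\<And>T. T \<in> (\<lambda>k. (+) (k + - u) ` U) ` K \<Longrightarrow> open T" using opn by blast
    ultimately obtain D where D: "D \<subseteq> (\<lambda>k. (+) (k + - u) ` U) ` K" "finite D" "K \<subseteq> \<Union>D"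
      by (rule compactE[OF K])
    have "C \<in> null_sets \<mu>" if C: "C \<in> D" for C
    proof -
      obtain k where k: "C = (+) (k + - u) ` U" using D(1) C by auto
      have "emeasure \<mu> C = 0" unfolding k by (subst emeasure_left_translate) (use assms U0 in auto)
      then show ?thesis using opn[of "k + - u"] k by (auto simp: null_sets_def)
    qed
    then have "\<Union>D \<in> null_sets \<mu>"
      using D(2) by (metis null_sets_UN' countable_finite image_ident)
    then show ?thesis using D(3) emeasure_mono[OF D(3), of \<mu>] by (auto simp: null_sets_def)
  qed
  moreover obtain K where "compact K" "0 < emeasure \<mu> K"
    using inner_regular[of UNIV 0] haar by (auto simp: left_haar_measure_def zero_less_iff_neq_zero)
  ultimately show False by auto
qed

lemma integral_Cc_pos:
  assumes "f \<in> Cc" "\<And>x. f x \<ge> 0" "f a > 0"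
  shows "(\<integral>x. f x \<partial>\<mu>) > 0"
proof -
  have int: "integrable \<mu> f" by (rule Cc_integrable[OF assms(1)])
  have "open {x. 0 < f x}"
    using assms(1) by (intro open_Collect_less continuous_intros) (auto simp: Cc_def)
  then have "emeasure \<mu> {x. 0 < f x} > 0" using assms(3) by (intro emeasure_open_pos) auto
  moreover have "emeasure \<mu> {x. 0 < f x} = 0" if "(\<integral>x. f x \<partial>\<mu>) = 0"
  proof -
    have "AE x in \<mu>. f x = 0" using that integral_nonneg_eq_0_iff_AE[OF int] assms(2) by simp
    then have "AE x in \<mu>. \<not> 0 < f x" by eventually_elim simp
    then show ?thesis using AE_iff_null[of \<mu> "\<lambda>x. \<not> 0 < f x"] Cc_measurable[OF assms(1)]
      by (simp add: null_sets_def)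
  qed
  moreover have "(\<integral>x. f x \<partial>\<mu>) \<ge> 0" using assms(2) by simp
  ultimately show ?thesis by fastforce
qed

lemma symmetric_bump:
  assumes "open V" "(0::'a) \<in> V"
  obtains g :: "'a \<Rightarrow> real" where "g \<in> Cc" "\<And>x. g x \<ge> 0" "\<And>x. g (- x) = g x"
    "\<And>x. x \<notin> V \<Longrightarrow> g x = 0" "(\<integral>x. g x \<partial>\<mu>) = 1"
proof -
  obtain W where W: "open W" "0 \<in> W" "W \<subseteq> V" "\<And>x. x \<in> W \<Longrightarrow> - x \<in> W"
    using open_symmetric_nbhd[OF assms] by blast
  have "compact {0::'a}" "{0} \<subseteq> W" using W by auto
  then obtain k :: "'a \<Rightarrow> real" where k: "k \<in> Cc" "\<And>x. 0 \<le> k x" "k 0 = 1" "\<And>x. x \<notin> W \<Longrightarrow> k x = 0"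
    using Cc_Urysohn[OF locally_compact _ W(1), of "{0}"] by (metis singletonI)
  define h where "h = (\<lambda>x. k x + k (- x))"
  have h: "h \<in> Cc" "\<And>x. h x \<ge> 0" "h 0 > 0" "\<And>x. h (- x) = h x"
    unfolding h_def using k(1-3) by (auto intro: Cc_add Cc_reflect)
  have h0: "h x = 0" if "x \<notin> V" for x
  proof -
    have "x \<notin> W" "- x \<notin> W" using that W(3) W(4)[of "- x"] by auto
    then show ?thesis using k(4) by (simp add: h_def)
  qed
  have pos: "(\<integral>x. h x \<partial>\<mu>) > 0" using integral_Cc_pos[OF h(1-3)] .
  define r where "r = 1 / (\<integral>x. h x \<partial>\<mu>)"
  have r: "r \<ge> 0" "r * (\<integral>x. h x \<partial>\<mu>) = 1" using pos by (auto simp: r_def)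
  show thesis
    by (rule that[of "\<lambda>x. r * h x"]) (use h h0 r in \<open>auto intro!: Cc_scale\<close>)
qed

text \<open>
  One finite partition of the support serves every function \<open>F\<close> that varies little on the cells
  of the cover \<open>W\<close>. The points and coefficients do not depend on \<open>F\<close>, which makes it possible to use
  the same Riemann sum for all \<open>F z = \<psi> (- z + x)\<close> simultaneously, uniformly in \<open>x\<close>.
\<close>

lemma riemann_sum:
  fixes f :: "'a \<Rightarrow> real"
  assumes f: "integrable \<mu> f" and K: "compact K" and f0': "\<forall>x. x \<notin> K \<longrightarrow> f x = 0"
    and W': "\<forall>y\<in>K. open (W y) \<and> y \<in> W y"
  shows "\<exists>(n :: nat) (y :: nat \<Rightarrow> 'a) (c :: nat \<Rightarrow> real). (\<forall>i<n. y i \<in> K) \<and>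
    (\<Sum>i<n. c i) = (\<integral>x. f x \<partial>\<mu>) \<and>
    (\<forall>(F :: 'a \<Rightarrow> 'b::{banach, second_countable_topology}) e. F \<in> borel_measurable \<mu> \<longrightarrow>
       (\<forall>y\<in>K. \<forall>z\<in>W y. norm (F z - F y) \<le> e) \<longrightarrow>
       norm ((\<integral>z. f z *\<^sub>R F z \<partial>\<mu>) - (\<Sum>i<n. c i *\<^sub>R F (y i))) \<le> e * (\<integral>z. \<bar>f z\<bar> \<partial>\<mu>))"
proof -
  have f0: "\<And>x. x \<notin> K \<Longrightarrow> f x = 0" and W: "\<And>y. y \<in> K \<Longrightarrow> open (W y) \<and> y \<in> W y"
    using f0' W' by auto
  have "\<And>T. T \<in> W ` K \<Longrightarrow> open T" "K \<subseteq> \<Union> (W ` K)" using W by auto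
  then obtain D where D: "D \<subseteq> W ` K" "finite D" "K \<subseteq> \<Union> D"
    using compactE[OF K] by metis
  then obtain Y where Y: "Y \<subseteq> K" "finite Y" "K \<subseteq> (\<Union>y\<in>Y. W y)"
    by (metis finite_subset_image)
  obtain y :: "nat \<Rightarrow> 'a" and n where y: "Y = y ` {..<n}"
    using finite_imp_nat_seg_image_inj_on[OF Y(2)] by (auto simp: lessThan_def)
  define A where "A = (\<lambda>i. if i < n then K \<inter> W (y i) else {})"
  define B where "B = disjointed A"
  define c where "c = (\<lambda>i. \<integral>x. indicator (B i) x * f x \<partial>\<mu>)"
  have yK: "y i \<in> K" if "i < n" for i using Y y that by auto
  have A: "A i \<in> sets \<mu>" for i
    unfolding A_def using yK W K by (auto intro!: sets.Int)
  then have B [measurable]: "B i \<in> sets \<mu>" for i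
    unfolding B_def using sets.range_disjointed_sets[of A \<mu>] by auto
  have BW: "B i \<subseteq> K \<inter> W (y i)" "i \<ge> n \<Longrightarrow> B i = {}" for i
    using disjointed_subset[of A i] by (auto simp: B_def A_def split: if_splits)
  have "(\<Union>i. B i) = K" unfolding B_def UN_disjointed_eq using Y y by (auto simp: A_def split: if_splits)
  have disj: "disjoint_family B" unfolding B_def by (rule disjoint_family_disjointed)
  have part: "(\<Sum>i<n. indicator (B i) z) = (1::real)" if z: "z \<in> K" for z
  proof -
    obtain j where j: "z \<in> B j" using z \<open>(\<Union>i. B i) = K\<close> by auto
    then have "j < n" using BW(2)[of j] by (metis empty_iff not_le)
    moreover have "indicator (B i) z = (if i = j then 1 else 0 :: real)" for i
      using disj j by (auto simp: disjoint_family_on_def indicator_def)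
    ultimately show ?thesis by simp
  qed
  have fs: "f z = (\<Sum>i<n. indicator (B i) z * f z)" for z
    using part[of z] f0[of z] by (cases "z \<in> K") (simp_all flip: sum_distrib_right)
  have intB: "integrable \<mu> (\<lambda>z. indicator (B i) z * f z)" for i
    using integrable_real_mult_indicator[OF B f, of i] by (simp add: mult.commute)
  have sc: "(\<Sum>i<n. c i) = (\<integral>x. f x \<partial>\<mu>)"
  proof -
    have "(\<integral>x. f x \<partial>\<mu>) = (\<integral>x. (\<Sum>i<n. indicator (B i) x * f x) \<partial>\<mu>)" using fs by presburger
    also have "\<dots> = (\<Sum>i<n. c i)" unfolding c_def using intB by (intro Bochner_Integration.integral_sum)
    finally show ?thesis by simp
  qed
  have "norm ((\<integral>z. f z *\<^sub>R F z \<partial>\<mu>) - (\<Sum>i<n. c i *\<^sub>R F (y i))) \<le> e * (\<integral>z. \<bar>f z\<bar> \<partial>\<mu>)"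
    if F: "F \<in> borel_measurable \<mu>" and e: "\<And>y z. y \<in> K \<Longrightarrow> z \<in> W y \<Longrightarrow> norm (F z - F y) \<le> e"
    for F :: "'a \<Rightarrow> 'b" and e
  proof -
    let ?S = "\<lambda>z. \<Sum>i<n. (indicator (B i) z * f z) *\<^sub>R F (y i)"
    have bound: "norm (f z *\<^sub>R F z - ?S z) \<le> e * \<bar>f z\<bar>" for z
    proof -
      have "f z *\<^sub>R F z - ?S z = (\<Sum>i<n. (indicator (B i) z * f z) *\<^sub>R (F z - F (y i)))"
      proof -
        have "f z *\<^sub>R F z = (\<Sum>i<n. indicator (B i) z * f z) *\<^sub>R F z" using fs[of z] by presburger
        also have "\<dots> = (\<Sum>i<n. (indicator (B i) z * f z) *\<^sub>R F z)" by (rule scaleR_sum_left)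
        finally show ?thesis by (simp only: scaleR_diff_right sum_subtractf)
      qed
      also have "norm \<dots> \<le> (\<Sum>i<n. indicator (B i) z * \<bar>f z\<bar> * e)"
      proof (rule sum_norm_le)
        fix i assume "i \<in> {..<n}"
        then show "norm ((indicator (B i) z * f z) *\<^sub>R (F z - F (y i))) \<le> indicator (B i) z * \<bar>f z\<bar> * e"
          using e[of "y i" z] BW(1)[of i] yK[of i]
          by (auto simp: indicator_def abs_mult intro!: mult_left_mono)
      qed
      also have "\<dots> = e * (\<Sum>i<n. indicator (B i) z * \<bar>f z\<bar>)" by (subst sum_distrib_left) (rule sum.cong[OF refl], rule mult.commute)
      also have "(\<Sum>i<n. indicator (B i) z * \<bar>f z\<bar>) = \<bar>f z\<bar>"
        using part[of z] f0[of z] by (cases "z \<in> K") (simp_all flip: sum_distrib_right)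
      finally show ?thesis .
    qed
    have intS: "integrable \<mu> ?S" using intB by (intro Bochner_Integration.integrable_sum integrable_scaleR_left)
    have intd: "integrable \<mu> (\<lambda>z. f z *\<^sub>R F z - ?S z)"
    proof (rule Bochner_Integration.integrable_bound)
      show "integrable \<mu> (\<lambda>z. e * \<bar>f z\<bar>)" using f by simp
      show "(\<lambda>z. f z *\<^sub>R F z - ?S z) \<in> borel_measurable \<mu>"
        using F f intS by (intro borel_measurable_diff borel_measurable_scaleR) auto
      show "AE z in \<mu>. norm (f z *\<^sub>R F z - ?S z) \<le> norm (e * \<bar>f z\<bar>)"
        using order_trans[OF bound abs_ge_self] by (intro AE_I2) (simp only: real_norm_def)
    qed
    have intF: "integrable \<mu> (\<lambda>z. f z *\<^sub>R F z)"
      using Bochner_Integration.integrable_add[OF intd intS] by simp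
    have "(\<integral>z. ?S z \<partial>\<mu>) = (\<Sum>i<n. c i *\<^sub>R F (y i))"
      unfolding c_def using intB by (subst Bochner_Integration.integral_sum) auto
    then have "(\<integral>z. f z *\<^sub>R F z \<partial>\<mu>) - (\<Sum>i<n. c i *\<^sub>R F (y i)) = (\<integral>z. f z *\<^sub>R F z - ?S z \<partial>\<mu>)"
      using intF intS by simp
    also have "norm \<dots> \<le> (\<integral>z. norm (f z *\<^sub>R F z - ?S z) \<partial>\<mu>)" by simp
    also have "\<dots> \<le> (\<integral>z. e * \<bar>f z\<bar> \<partial>\<mu>)"
      using bound intd f by (intro integral_mono integrable_norm) auto
    finally show ?thesis by simp
  qed
  with yK sc show ?thesis by (intro exI[of _ n] exI[of _ y] exI[of _ c]) blast
qed

section \<open>Iterated integrals, inversion and null sets\<close>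

lemma compact_vanishing_uniform:
  fixes F :: "'a \<Rightarrow> 'a \<Rightarrow> real"
  assumes F: "continuous_on UNIV (\<lambda>p. F (fst p) (snd p))"
    and Q: "compact Q" "\<And>x y. y \<notin> Q \<Longrightarrow> F x y = 0" and e: "e > 0"
  obtains W where "open W" "x \<in> W" "\<And>z y. z \<in> W \<Longrightarrow> \<bar>F z y - F x y\<bar> \<le> e"
proof -
  let ?S = "{p. \<bar>F (fst p) (snd p) - F x (snd p)\<bar> < e}"
  have "continuous_on UNIV (\<lambda>p::'a\<times>'a. F x (snd p))"
    using continuous_on_UNIV_compose[OF F, of "\<lambda>p. (x, snd p)"]
    by (simp add: continuous_intros)
  then have "open ?S"
    using F by (intro open_Collect_less continuous_intros)
  moreover have "{x} \<times> Q \<subseteq> ?S" using e by auto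
  ultimately have "\<exists>W. x \<in> W \<and> open W \<and> W \<times> Q \<subseteq> ?S"
    by (rule Elementary_Topology.tube_lemma[OF Q(1)])
  then obtain W where W: "x \<in> W" "open W" "W \<times> Q \<subseteq> ?S"
    by (elim exE conjE)
  have "\<bar>F z y - F x y\<bar> \<le> e" if "z \<in> W" for z y
  proof (cases "y \<in> Q")
    case True
    then have "(z, y) \<in> ?S" using that W by blast
    then show ?thesis by simp
  next
    case False
    then show ?thesis using Q(2) e by simp
  qed
  then show thesis using W that by blast
qed

lemma slice_continuous:
  fixes F :: "'a \<Rightarrow> 'a \<Rightarrow> real"
  assumes F: "continuous_on UNIV (\<lambda>p. F (fst p) (snd p))"
  shows "continuous_on UNIV (F x)" "continuous_on UNIV (\<lambda>x. F x y)"
  using continuous_on_UNIV_compose[OF F, of "\<lambda>y. (x, y)"]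
    continuous_on_UNIV_compose[OF F, of "\<lambda>x. (x, y)"]
  by (simp_all add: continuous_intros)

lemma slice_integral_close:
  fixes F :: "'a \<Rightarrow> 'a \<Rightarrow> real"
  assumes F: "continuous_on UNIV (\<lambda>p. F (fst p) (snd p))"
    and Q: "compact Q" "\<And>x y. y \<notin> Q \<Longrightarrow> F x y = 0"
    and close: "\<And>y. \<bar>F z y - F x y\<bar> \<le> e"
  shows "\<bar>(\<integral>y. F z y \<partial>\<mu>) - (\<integral>y. F x y \<partial>\<mu>)\<bar> \<le> e * measure \<mu> Q"
proof -
  have Cc: "F u \<in> Cc" for u
    using slice_continuous(1)[OF F] Q by (intro CcI) auto
  have "(\<integral>y. F z y \<partial>\<mu>) - (\<integral>y. F x y \<partial>\<mu>) = (\<integral>y. F z y - F x y \<partial>\<mu>)"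
    using Cc_integrable[OF Cc] by simp
  also have "\<bar>\<dots>\<bar> \<le> (\<integral>y. \<bar>F z y - F x y\<bar> \<partial>\<mu>)"
    using integral_norm_bound[of \<mu> "\<lambda>y. F z y - F x y"] by simp
  also have "\<dots> \<le> e * measure \<mu> Q"
    using integrable_bounded_compact(2)[of "\<lambda>y. F z y - F x y" Q e] Q close
      Cc_measurable[OF Cc_diff[OF Cc Cc]] by simp
  finally show ?thesis .
qed

lemma slice_integral_continuous:
  fixes F :: "'a \<Rightarrow> 'a \<Rightarrow> real"
  assumes F: "continuous_on UNIV (\<lambda>p. F (fst p) (snd p))"
    and Q: "compact Q" "\<And>x y. y \<notin> Q \<Longrightarrow> F x y = 0"
  shows "continuous_on UNIV (\<lambda>x. \<integral>y. F x y \<partial>\<mu>)"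
  unfolding continuous_on_def
proof
  fix x :: 'a
  have "((\<lambda>x. \<integral>y. F x y \<partial>\<mu>) \<longlongrightarrow> (\<integral>y. F x y \<partial>\<mu>)) (nhds x)"
    unfolding tendsto_iff
  proof (intro allI impI)
    fix e :: real assume e: "e > 0"
    define d where "d = e / (measure \<mu> Q + 1)"
    have m: "measure \<mu> Q + 1 > 0" using measure_nonneg[of \<mu> Q] by linarith
    have d: "d > 0" "d * measure \<mu> Q < e"
      unfolding d_def using e m by (simp_all add: pos_divide_less_eq)
    obtain W where W: "open W" "x \<in> W" "\<And>z y. z \<in> W \<Longrightarrow> \<bar>F z y - F x y\<bar> \<le> d"
      using compact_vanishing_uniform[OF F Q d(1), of x] by blast
    have "dist (\<integral>y. F z y \<partial>\<mu>) (\<integral>y. F x y \<partial>\<mu>) < e" if "z \<in> W" for z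
      using slice_integral_close[OF F Q W(3)[OF that]] d(2) by (simp add: dist_real_def)
    then show "\<forall>\<^sub>F z in nhds x. dist (\<integral>y. F z y \<partial>\<mu>) (\<integral>y. F x y \<partial>\<mu>) < e"
      using W by (auto simp: eventually_nhds)
  qed
  then show "((\<lambda>x. \<integral>y. F x y \<partial>\<mu>) \<longlongrightarrow> (\<integral>y. F x y \<partial>\<mu>)) (at x within UNIV)"
    by (rule filterlim_mono[OF _ order_refl]) (simp add: at_within_def)
qed

text \<open>
  The Borel \<open>\<sigma>\<close>-algebra of the product may be strictly larger than the product of the Borel
  \<open>\<sigma>\<close>-algebras, so the general theorem of Fubini does not cover continuous functions on the
  product. With compact supports, both iterated integrals are uniformly close to the same Riemann
  sums in the first variable.
\<close>

lemma Fubini_continuous: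
  fixes F :: "'a \<Rightarrow> 'a \<Rightarrow> real"
  assumes F: "continuous_on UNIV (\<lambda>p. F (fst p) (snd p))"
    and P: "compact P" "\<And>x y. x \<notin> P \<Longrightarrow> F x y = 0"
    and Q: "compact Q" "\<And>x y. y \<notin> Q \<Longrightarrow> F x y = 0"
  shows "(\<integral>x. (\<integral>y. F x y \<partial>\<mu>) \<partial>\<mu>) = (\<integral>y. (\<integral>x. F x y \<partial>\<mu>) \<partial>\<mu>)" (is "?L = ?R")
proof -
  let ?p = "measure \<mu> P" and ?q = "measure \<mu> Q"
  have F': "continuous_on UNIV (\<lambda>p. F (snd p) (fst p))"
    using continuous_on_UNIV_compose[OF F, of "\<lambda>p. (snd p, fst p)"] by (simp add: continuous_intros)
  have CcF: "F x \<in> Cc" for x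
    using slice_continuous(1)[OF F] Q by (intro CcI) auto
  have CcR: "(\<lambda>y. \<integral>x. F x y \<partial>\<mu>) \<in> Cc"
    using slice_integral_continuous[OF F' P] Q by (intro CcI) auto
  have close: "\<bar>?L - ?R\<bar> \<le> 2 * (e * ?p * ?q)" if e: "e > 0" for e
  proof -
    have "\<exists>W. open W \<and> x \<in> W \<and> (\<forall>z\<in>W. \<forall>y. \<bar>F z y - F x y\<bar> \<le> e)" for x
    proof -
      obtain W where "open W" "x \<in> W" "\<And>z y. z \<in> W \<Longrightarrow> \<bar>F z y - F x y\<bar> \<le> e"
        using compact_vanishing_uniform[OF F Q e, of x] by blast
      then show ?thesis by auto
    qed
    then have "\<exists>W. \<forall>x. open (W x) \<and> x \<in> W x \<and> (\<forall>z\<in>W x. \<forall>y. \<bar>F z y - F x y\<bar> \<le> e)"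
      by (intro choice allI)
    then obtain W where W: "\<And>x. open (W x)" "\<And>x. x \<in> W x"
        "\<And>x z y. z \<in> W x \<Longrightarrow> \<bar>F z y - F x y\<bar> \<le> e" by blast
    define f where "f = (indicator P :: 'a \<Rightarrow> real)"
    have f: "integrable \<mu> f" "\<And>x. x \<notin> P \<Longrightarrow> f x = 0" "(\<integral>z. \<bar>f z\<bar> \<partial>\<mu>) = ?p"
      using P(1) emeasure_compact_finite[OF P(1)]
      by (auto simp: f_def integrable_indicator_iff)
    have "\<forall>x\<in>P. open (W x) \<and> x \<in> W x" "\<forall>x. x \<notin> P \<longrightarrow> f x = 0" using W f(2) by auto
    from riemann_sum[where 'b=real, OF f(1) P(1) this(2,1)]
    obtain n :: nat and y c where "\<forall>i<n. y i \<in> P" "(\<Sum>i<n. c i) = (\<integral>x. f x \<partial>\<mu>)"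
      and est: "\<forall>(G :: 'a \<Rightarrow> real) e. G \<in> borel_measurable \<mu> \<longrightarrow>
       (\<forall>y\<in>P. \<forall>z\<in>W y. norm (G z - G y) \<le> e) \<longrightarrow>
       norm ((\<integral>z. f z *\<^sub>R G z \<partial>\<mu>) - (\<Sum>i<n. c i *\<^sub>R G (y i))) \<le> e * (\<integral>z. \<bar>f z\<bar> \<partial>\<mu>)"
      by blast
    let ?G = "\<lambda>x. \<integral>y. F x y \<partial>\<mu>"
    have "(\<lambda>z. f z *\<^sub>R ?G z) = ?G" "\<And>v. (\<lambda>z. f z *\<^sub>R F z v) = (\<lambda>z. F z v)"
    proof -
      have "?G x = 0" if "x \<notin> P" for x
      proof -
        have "F x = (\<lambda>_. 0)" using P(2)[OF that] by (intro ext)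
        then show ?thesis by (simp only: Bochner_Integration.integral_zero)
      qed
      then show "(\<lambda>z. f z *\<^sub>R ?G z) = ?G" by (auto simp: f_def indicator_def fun_eq_iff)
      show "\<And>v. (\<lambda>z. f z *\<^sub>R F z v) = (\<lambda>z. F z v)"
        using P(2) by (auto simp: f_def indicator_def fun_eq_iff)
    qed
    note fG = this
    have 1: "\<bar>?L - (\<Sum>i<n. c i * ?G (y i))\<bar> \<le> e * ?q * ?p"
      using est[rule_format, of ?G "e * ?q"] slice_integral_close[OF F Q W(3)]
        continuous_measurable[OF slice_integral_continuous[OF F Q]] f(3) fG(1) by simp
    have 2: "\<bar>(\<integral>x. F x v \<partial>\<mu>) - (\<Sum>i<n. c i * F (y i) v)\<bar> \<le> e * ?p" for v
      using est[rule_format, of "\<lambda>x. F x v" e] W(3) continuous_measurable[OF slice_continuous(2)[OF F]] f(3) fG(2)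
      by simp
    let ?D = "\<lambda>v. (\<integral>x. F x v \<partial>\<mu>) - (\<Sum>i<n. c i * F (y i) v)"
    have CcS: "(\<lambda>v. \<Sum>i<n. c i * F (y i) v) \<in> Cc"
      by (intro Cc_sum Cc_scale CcF) auto
    have "?R - (\<Sum>i<n. c i * ?G (y i)) = (\<integral>v. ?D v \<partial>\<mu>)"
      using Cc_integrable[OF CcR] Cc_integrable[OF CcS] Cc_integrable[OF CcF]
      by (simp add: Bochner_Integration.integral_sum)
    also have "\<bar>\<dots>\<bar> \<le> (\<integral>v. \<bar>?D v\<bar> \<partial>\<mu>)"
      using integral_norm_bound[of \<mu> ?D] by simp
    also have "\<dots> \<le> e * ?p * ?q"
      using integrable_bounded_compact(2)[OF Cc_measurable[OF Cc_diff[OF CcR CcS]] Q(1), of "e * ?p"] 2 Q(2)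
      by simp
    finally show ?thesis using 1 by (simp add: mult_ac)
  qed
  have "\<bar>?L - ?R\<bar> \<le> 0 + d" if "d > 0" for d
  proof -
    define e where "e = d / (2 * (?p * ?q + 1))"
    have m: "?p * ?q + 1 > 0" by (smt (verit) measure_nonneg mult_nonneg_nonneg)
    have "e > 0" "2 * (e * ?p * ?q) \<le> d"
      unfolding e_def using that m by (auto simp: field_simps)
    then show ?thesis using close[of e] by linarith
  qed
  then have "\<bar>?L - ?R\<bar> \<le> 0" by (rule field_le_epsilon)
  then show ?thesis by simp
qed

text \<open>
  Inversion changes Haar measure by the modular function, which is bounded on compact sets. The
  bound is obtained without introducing that function: for a fixed \<open>g\<close> of integral \<open>1\<close>, left
  invariance and two exchanges of integrals turn \<open>\<integral> f (- x)\<close> into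
  \<open>\<integral> f x * (\<integral> g (y + x) dy) dx\<close>, and the inner integral is bounded for \<open>x\<close> in the support of \<open>f\<close>.
\<close>

lemma integral_reflect_bound:
  assumes L: "compact L"
  obtains C where "\<And>f. f \<in> Cc \<Longrightarrow> (\<And>x. f x \<ge> 0) \<Longrightarrow> (\<And>x. x \<notin> L \<Longrightarrow> f x = 0) \<Longrightarrow>
     (\<integral>x. f (- x) \<partial>\<mu>) \<le> C * (\<integral>x. f x \<partial>\<mu>)"
proof -
  obtain g :: "'a \<Rightarrow> real" where g: "g \<in> Cc" "\<And>x. g x \<ge> 0" "(\<integral>x. g x \<partial>\<mu>) = 1"
    by (rule symmetric_bump[of UNIV]) auto
  obtain K where K: "continuous_on UNIV g" "compact K" "\<And>x. x \<notin> K \<Longrightarrow> g x = 0"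
    using CcE[OF g(1)] by blast
  obtain B where B: "B > 0" "\<And>x. \<bar>g x\<bar> \<le> B" using Cc_bounded[OF g(1)] by blast
  define Q where "Q = (\<lambda>(x, y). x + y) ` (K \<times> uminus ` L)"
  have Q: "compact Q" unfolding Q_def by (intro compact_sums_group K(2) compact_uminus_image L)
  have inQ: "y \<in> Q" if "y + x \<in> K" "x \<in> L" for x y
    unfolding Q_def by (rule image_eqI[of _ _ "(y + x, - x)"]) (use that in \<open>auto simp: minus_add_self\<close>)
  have "(\<integral>x. f (- x) \<partial>\<mu>) \<le> (B * measure \<mu> Q) * (\<integral>x. f x \<partial>\<mu>)"
    if f: "f \<in> Cc" "\<And>x. f x \<ge> 0" "\<And>x. x \<notin> L \<Longrightarrow> f x = 0" for f
  proof -
    have fc: "continuous_on UNIV f" using f(1) by (auto simp: Cc_def)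
    note Cf = Cc_integrable[OF f(1)] Cc_measurable[OF f(1)]
    let ?F1 = "\<lambda>x y. g x * f (- y + x)"
    let ?F2 = "\<lambda>y x. g (y + x) * f x"
    have c1: "continuous_on UNIV (\<lambda>p. ?F1 (fst p) (snd p))"
      by (intro continuous_intros continuous_on_UNIV_compose[OF K(1)] continuous_on_UNIV_compose[OF fc])
    have c2: "continuous_on UNIV (\<lambda>p. ?F2 (fst p) (snd p))"
      by (intro continuous_intros continuous_on_UNIV_compose[OF K(1)] continuous_on_UNIV_compose[OF fc])
    have "(\<integral>x. f (- x) \<partial>\<mu>) = (\<integral>x. g x * (\<integral>y. f (- y) \<partial>\<mu>) \<partial>\<mu>)"
      using g(3) by simp
    also have "\<dots> = (\<integral>x. (\<integral>y. ?F1 x y \<partial>\<mu>) \<partial>\<mu>)"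
    proof (rule Bochner_Integration.integral_cong[OF refl])
      fix x
      have "(\<integral>y. f (- y) \<partial>\<mu>) = (\<integral>y. f (- (- x + y)) \<partial>\<mu>)"
        by (rule integral_left_total[symmetric])
      then show "g x * (\<integral>y. f (- y) \<partial>\<mu>) = (\<integral>y. ?F1 x y \<partial>\<mu>)"
        by (simp add: minus_add)
    qed
    also have "\<dots> = (\<integral>y. (\<integral>x. ?F1 x y \<partial>\<mu>) \<partial>\<mu>)"
    proof (rule Fubini_continuous[OF c1 K(2) _ Q])
      show "?F1 x y = 0" if "x \<notin> K" for x y using K(3)[OF that] by simp
      show "?F1 x y = 0" if y: "y \<notin> Q" for x y
      proof (rule ccontr)
        assume "?F1 x y \<noteq> 0"
        then have "x \<in> K" "- y + x \<in> L" using K(3) f(3) by auto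
        then have "y \<in> Q" using inQ[of y "- y + x"] by (simp add: minus_add_self)
        then show False using y by simp
      qed
    qed
    also have "\<dots> = (\<integral>y. (\<integral>x. ?F2 y x \<partial>\<mu>) \<partial>\<mu>)"
    proof (rule Bochner_Integration.integral_cong[OF refl])
      fix y
      have "(\<integral>x. ?F1 x y \<partial>\<mu>) = (\<integral>x. ?F1 (y + x) y \<partial>\<mu>)"
        by (rule integral_left_total[symmetric])
      then show "(\<integral>x. ?F1 x y \<partial>\<mu>) = (\<integral>x. ?F2 y x \<partial>\<mu>)"
        by (simp add: minus_add_self)
    qed
    also have "\<dots> = (\<integral>x. (\<integral>y. ?F2 y x \<partial>\<mu>) \<partial>\<mu>)"
    proof (rule Fubini_continuous[OF c2 Q _ L])
      show "?F2 y x = 0" if y: "y \<notin> Q" for x y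
        using inQ[of y x] y K(3)[of "y + x"] f(3)[of x] by auto
      show "?F2 y x = 0" if "x \<notin> L" for x y using f(3)[OF that] by simp
    qed
    also have "\<dots> = (\<integral>x. f x * (\<integral>y. g (y + x) \<partial>\<mu>) \<partial>\<mu>)"
      by (simp add: mult.commute)
    also have "\<dots> \<le> (\<integral>x. f x * (B * measure \<mu> Q) \<partial>\<mu>)"
    proof (rule integral_mono')
      show "integrable \<mu> (\<lambda>x. f x * (B * measure \<mu> Q))" using Cf by simp
      show "f x * (\<integral>y. g (y + x) \<partial>\<mu>) \<le> f x * (B * measure \<mu> Q)" for x
      proof (cases "x \<in> L")
        case True
        have "(\<integral>y. g (y + x) \<partial>\<mu>) = (\<integral>y. norm (g (y + x)) \<partial>\<mu>)" using g(2) by simp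
        also have "\<dots> \<le> B * measure \<mu> Q"
        proof (rule integrable_bounded_compact(2)[OF _ Q])
          show "(\<lambda>y. g (y + x)) \<in> borel_measurable \<mu>"
            by (intro continuous_measurable continuous_on_UNIV_compose[OF K(1)] continuous_intros)
          show "g (y + x) = 0" if "y \<notin> Q" for y using inQ[of y x] True that K(3) by blast
        qed (use B in auto)
        finally show ?thesis using f(2) by (intro mult_left_mono)
      qed (use f in auto)
    qed (use f B in auto)
    finally show ?thesis by (simp add: mult_ac)
  qed
  then show thesis by (rule that)
qed

text \<open>
  The bound for continuous functions passes to null sets: an open set of small measure around \<open>A\<close>
  has an inverse of small measure, because compact subsets of the inverse are dominated by
  Urysohn functions.
\<close>

lemma null_reflect:
  assumes A: "A \<in> sets borel" "emeasure \<mu> A = 0" and L: "compact L" "A \<subseteq> L"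
  shows "uminus ` A \<in> null_sets \<mu>"
proof -
  obtain O' L' where O': "open O'" "compact L'" "L \<subseteq> O'" "O' \<subseteq> L'"
    using compact_subset_interior_compact[OF locally_compact L(1)] by blast
  obtain C where C: "\<And>f. f \<in> Cc \<Longrightarrow> (\<And>x. f x \<ge> 0) \<Longrightarrow> (\<And>x. x \<notin> L' \<Longrightarrow> f x = 0) \<Longrightarrow>
     (\<integral>x. f (- x) \<partial>\<mu>) \<le> C * (\<integral>x. f x \<partial>\<mu>)"
    using integral_reflect_bound[OF O'(2)] by blast
  have um: "uminus ` X = {x. - x \<in> X}" for X :: "'a set" by (auto simp: image_iff) (metis minus_minus)
  have meas: "uminus ` A \<in> sets borel"
  proof -
    have "uminus -` A \<in> sets (borel :: 'a measure)"
      by (rule measurable_sets_borel[OF borel_measurable_continuous_onI A(1)]) (intro continuous_intros)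
    then show ?thesis by (simp only: um vimage_def)
  qed
  have "emeasure \<mu> (uminus ` A) \<le> 0 + ennreal e" if e: "e > 0" for e
  proof -
    define d where "d = e / (\<bar>C\<bar> + 1)"
    have d: "d > 0" "\<bar>C\<bar> * d \<le> e" 
    proof -
      have "\<bar>C\<bar> + 1 > 0" by simp
      then show "d > 0" "\<bar>C\<bar> * d \<le> e" unfolding d_def using e by (simp_all add: pos_divide_le_eq)
    qed
    have "emeasure \<mu> A < ennreal d" using A(2) d(1) by simp
    then obtain U0 where U0: "open U0" "A \<subseteq> U0" "emeasure \<mu> U0 < ennreal d"
      by (rule outer_regular[OF A(1)])
    define U where "U = U0 \<inter> O'"
    have U: "open U" "A \<subseteq> U" "U \<subseteq> L'" "emeasure \<mu> U \<le> ennreal d"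
      unfolding U_def using U0 O' L emeasure_mono[of "U0 \<inter> O'" U0 \<mu>] by (auto intro: order_trans)
    have oU: "open (uminus ` U)"
      unfolding um by (intro open_vimage_UNIV U(1) continuous_intros)
    have "emeasure \<mu> (uminus ` U) \<le> ennreal e"
    proof (rule ccontr)
      assume "\<not> ?thesis"
      then have "ennreal e < emeasure \<mu> (uminus ` U)" by (simp only: not_le)
      then obtain K where K: "compact K" "K \<subseteq> uminus ` U" "ennreal e < emeasure \<mu> K"
        by (rule inner_regular[OF oU])
      have "uminus ` K \<subseteq> U" using K(2) by auto
      from Cc_Urysohn[OF locally_compact compact_uminus_image[OF K(1)] U(1) this]
      obtain f :: "'a \<Rightarrow> real" where f: "f \<in> Cc" "\<And>x. 0 \<le> f x" "\<And>x. f x \<le> 1"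
          "\<And>x. x \<in> uminus ` K \<Longrightarrow> f x = 1" "\<And>x. x \<notin> U \<Longrightarrow> f x = 0"
        by metis
      have "measure \<mu> K = (\<integral>x. indicator K x \<partial>\<mu>)" using K(1) by simp
      also have "\<dots> \<le> (\<integral>x. f (- x) \<partial>\<mu>)"
        by (rule integral_mono')
          (use f Cc_integrable[OF Cc_reflect[OF f(1)]] in \<open>auto simp: indicator_def\<close>)
      also have "\<dots> \<le> C * (\<integral>x. f x \<partial>\<mu>)"
        using U(3) f(1,2,5) by (intro C) blast+
      also have "\<dots> \<le> \<bar>C\<bar> * (\<integral>x. f x \<partial>\<mu>)"
        using f(2) by (intro mult_right_mono) auto
      also have "\<dots> \<le> \<bar>C\<bar> * d"
      proof (rule mult_left_mono)
        have "emeasure \<mu> U < \<infinity>"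
          using U(4) by (metis ennreal_less_top infinity_ennreal_def order_le_less_trans)
        then have "integrable \<mu> (indicator U :: 'a \<Rightarrow> real)"
          using U(1) by (simp add: integrable_indicator_iff)
        then have "(\<integral>x. f x \<partial>\<mu>) \<le> (\<integral>x. indicator U x \<partial>\<mu>)"
          by (rule integral_mono') (use f in \<open>auto simp: indicator_def\<close>)
        also have "\<dots> = measure \<mu> U" using U(1) by simp
        also have "\<dots> \<le> d"
          using U(4) d(1) by (simp add: measure_def enn2real_leI)
        finally show "(\<integral>x. f x \<partial>\<mu>) \<le> d" .
      qed simp
      finally have "measure \<mu> K \<le> e" using d(2) by linarith
      then show False using K(3) emeasure_compact_finite[OF K(1)]
        by (simp add: emeasure_eq_ennreal_measure leD ennreal_leI)
    qed
    moreover have "emeasure \<mu> (uminus ` A) \<le> emeasure \<mu> (uminus ` U)"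
      using U(2) oU by (intro emeasure_mono) auto
    ultimately show ?thesis by simp
  qed
  then have "emeasure \<mu> (uminus ` A) \<le> 0" by (rule ennreal_le_epsilon)
  then show ?thesis using meas by (auto simp: null_sets_def)
qed

section \<open>Convolution with essentially bounded functions\<close>

lemma borel_left_translate:
  fixes U :: "'a set"
  assumes "U \<in> sets borel" shows "(+) a ` U \<in> sets borel"
proof -
  have "(+) (- a) -` U \<in> sets borel"
    by (rule measurable_sets_borel[OF borel_measurable_continuous_onI assms]) (intro continuous_intros)
  then show ?thesis by (simp only: left_vimage minus_minus)
qed

text \<open>
  By inner regularity a \<open>\<sigma>\<close>-compact set \<open>\<Union>n. K n\<close> exhausts \<open>S\<close> up to a null set. Adding to it the
  open \<open>\<sigma>\<close>-compact subgroup generated by a compact neighbourhood \<open>W\<close> of \<open>0\<close> gives a union of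
  cosets, which is closed and still \<open>\<sigma>\<close>-compact. What is left of \<open>S\<close> is open and null, hence empty.
\<close>

lemma open_finite_sigma_compact:
  assumes S: "open S" "emeasure \<mu> S < \<infinity>"
  shows "\<exists>K::nat \<Rightarrow> 'a set. (\<forall>n. compact (K n)) \<and> S \<subseteq> (\<Union>n. K n)"
proof -
  define m where "m = measure \<mu> S"
  have em: "emeasure \<mu> S = ennreal m"
    unfolding m_def using S(2) by (simp add: emeasure_eq_ennreal_measure)
  have "\<exists>K. compact K \<and> K \<subseteq> S \<and> ennreal m \<le> emeasure \<mu> K + ennreal (1 / Suc n)" for n
  proof (cases "m = 0")
    case True then show ?thesis by (intro exI[of _ "{}"]) auto
  next
    case False
    then have "m > 0" unfolding m_def by (simp add: zero_less_measure_iff measure_eq_0_null_sets)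
    then have "ennreal (m - 1 / Suc n) < emeasure \<mu> S" unfolding em by (simp add: ennreal_less_iff ennreal_lessI)
    then obtain K where K: "compact K" "K \<subseteq> S" "ennreal (m - 1 / Suc n) < emeasure \<mu> K"
      by (rule inner_regular[OF S(1)])
    have "ennreal m \<le> ennreal (m - 1 / Suc n) + ennreal (1 / Suc n)"
      by (cases "m - 1 / Suc n \<ge> 0") (simp_all flip: ennreal_plus add: ennreal_neg ennreal_leI)
    also have "\<dots> \<le> emeasure \<mu> K + ennreal (1 / Suc n)" using K(3) by (intro add_mono) auto
    finally show ?thesis using K by blast
  qed
  then obtain K where K: "\<And>n. compact (K n)" "\<And>n. K n \<subseteq> S"
      "\<And>n. ennreal m \<le> emeasure \<mu> (K n) + ennreal (1 / Suc n)" by metis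
  obtain U L where U: "open U" "compact L" "{0::'a} \<subseteq> U" "U \<subseteq> L"
    using compact_subset_interior_compact[OF locally_compact, of "{0}"] by auto
  \<comment> \<open>\<open>H m\<close> is the \<open>m\<close>-fold sum of the compact symmetric neighbourhood \<open>W\<close>.\<close>
  define W where "W = L \<union> uminus ` L"
  have W: "compact W" "\<And>w. w \<in> W \<Longrightarrow> - w \<in> W"
    unfolding W_def using U(2) compact_uminus_image by auto
  define H where "H = rec_nat {0} (\<lambda>_ A. (\<lambda>(x, y). x + y) ` (A \<times> W))"
  have HS: "H (Suc k) = (\<lambda>(x, y). x + y) ` (H k \<times> W)" and H0: "H 0 = {0}" for k
    by (simp_all add: H_def)
  have H: "compact (H k)" for k
    by (induction k) (auto simp only: H0 HS intro!: compact_sums_group W(1) compact_sing)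
  define T where "T = (\<lambda>p. (\<lambda>(x, y). x + y) ` (K (fst (prod_decode p)) \<times> H (snd (prod_decode p))))"
  have T: "compact (T p)" for p unfolding T_def by (intro compact_sums_group K(1) H)
  have inT: "k + h \<in> (\<Union>p. T p)" if "k \<in> K n" "h \<in> H l" for k h n l
    by (rule UN_I[of "prod_encode (n, l)"]) (use that in \<open>auto simp: T_def\<close>)
  have KT: "K n \<subseteq> (\<Union>p. T p)" for n
    using inT[of _ n 0 0] by (auto simp: H0)
  have "open (- (\<Union>p. T p))"
    unfolding open_subopen[of "- (\<Union>p. T p)"]
  proof (intro ballI exI conjI)
    fix y assume y: "y \<in> - (\<Union>p. T p)"
    show "open ((+) y ` U)" by (rule open_left_translate[OF U(1)])
    show "y \<in> (+) y ` U" using U(3) by (intro image_eqI[of _ _ 0]) auto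
    \<comment> \<open>If \<open>y + u\<close> lies in \<open>K n + H l\<close>, then \<open>y\<close> lies in \<open>K n + H (Suc l)\<close>.\<close>
    show "(+) y ` U \<subseteq> - (\<Union>p. T p)"
    proof
      fix z assume "z \<in> (+) y ` U"
      then obtain u where u: "u \<in> U" "z = y + u" by blast
      then have "- u \<in> W" using U(4) by (auto simp: W_def)
      show "z \<in> - (\<Union>p. T p)"
      proof
        assume "z \<in> (\<Union>p. T p)"
        then obtain p k h where "k \<in> K (fst (prod_decode p))" "h \<in> H (snd (prod_decode p))" "z = k + h"
          by (auto simp: T_def)
        moreover have "y = k + (h + - u)" using u(2) \<open>z = k + h\<close> by (metis add.assoc minus_add_self(3))
        moreover have "h + - u \<in> H (Suc (snd (prod_decode p)))"
          unfolding HS using \<open>h \<in> _\<close> \<open>- u \<in> W\<close> by (intro image_eqI[of _ _ "(h, - u)"]) auto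
        ultimately have "y \<in> (\<Union>p. T p)" using inT by blast
        then show False using y by blast
      qed
    qed
  qed
  then have oST: "open (S - (\<Union>p. T p))" unfolding Diff_eq by (intro open_Int S(1))
  have "emeasure \<mu> (S - (\<Union>p. T p)) \<le> 0 + ennreal e" if e: "e > 0" for e
  proof -
    obtain n where n: "1 / Suc n < e" using e nat_approx_posE by blast
    have fin: "emeasure \<mu> (K n) < \<infinity>" using K(1) emeasure_compact_finite by blast
    have "emeasure \<mu> (S - (\<Union>p. T p)) \<le> emeasure \<mu> (S - K n)"
      using KT K(1) S(1) by (intro emeasure_mono) auto
    also have "\<dots> = emeasure \<mu> S - emeasure \<mu> (K n)"
      using fin K S(1) by (intro emeasure_Diff) auto
    also have "\<dots> \<le> ennreal (1 / Suc n)"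
      using K(3)[of n] fin unfolding em by (simp add: ennreal_minus_le_iff)
    also have "\<dots> \<le> ennreal e" using n by (intro ennreal_leI) simp
    finally show ?thesis by simp
  qed
  then have "emeasure \<mu> (S - (\<Union>p. T p)) \<le> 0" by (rule ennreal_le_epsilon)
  then have "S - (\<Union>p. T p) = {}" using emeasure_open_pos[OF oST] by (metis leD)
  then show ?thesis using T by (intro exI[of _ T]) blast
qed

lemma integrable_sigma_compact:
  fixes f :: "'a \<Rightarrow> real"
  assumes f: "integrable \<mu> f"
  shows "\<exists>K::nat \<Rightarrow> 'a set. (\<forall>n. compact (K n)) \<and> {x. f x \<noteq> 0} \<subseteq> (\<Union>n. K n)"
proof -
  have "\<exists>K::nat \<Rightarrow> 'a set. (\<forall>k. compact (K k)) \<and> {x. \<bar>f x\<bar> \<ge> 1 / Suc n} \<subseteq> (\<Union>k. K k)" for n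
  proof -
    have "emeasure \<mu> {x\<in>space \<mu>. \<bar>f x\<bar> \<ge> 1 / Suc n} \<le> ennreal ((1 / (1 / Suc n)) * (\<integral>x. \<bar>f x\<bar> \<partial>\<mu>))"
      by (rule integral_Markov_inequality) (use f in auto)
    then have fin: "emeasure \<mu> {x. \<bar>f x\<bar> \<ge> 1 / Suc n} < \<infinity>"
      by (simp add: order_le_less_trans[OF _ ennreal_less_top])
    have "{x\<in>space \<mu>. \<bar>f x\<bar> \<ge> 1 / Suc n} \<in> sets \<mu>"
      using borel_measurable_integrable[OF f] by measurable
    then have "{x. \<bar>f x\<bar> \<ge> 1 / Suc n} \<in> sets borel" by simp
    from outer_regular[OF this fin]
    obtain U where "open U" "{x. \<bar>f x\<bar> \<ge> 1 / Suc n} \<subseteq> U" "emeasure \<mu> U < \<infinity>"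
      by blast
    then show ?thesis using open_finite_sigma_compact[of U] by (meson order_trans)
  qed
  then have "\<exists>K. \<forall>n. (\<forall>k::nat. compact (K n k :: 'a set)) \<and> {x. \<bar>f x\<bar> \<ge> 1 / Suc n} \<subseteq> (\<Union>k. K n k)"
    by (intro choice allI)
  then obtain K where K: "\<And>n k::nat. compact (K n k :: 'a set)"
      "\<And>n. {x. \<bar>f x\<bar> \<ge> 1 / Suc n} \<subseteq> (\<Union>k. K n k)"
    by blast
  have "x \<in> (\<Union>p. K (fst (prod_decode p)) (snd (prod_decode p)))" if "f x \<noteq> 0" for x
  proof -
    obtain n where "1 / Suc n < \<bar>f x\<bar>" using \<open>f x \<noteq> 0\<close> nat_approx_posE[of "\<bar>f x\<bar>"] by auto
    then obtain k where "x \<in> K n k" using K(2)[of n] by force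
    then show ?thesis by (intro UN_I[of "prod_encode (n, k)"]) auto
  qed
  then show ?thesis using K(1) by (intro exI[of _ "\<lambda>p. K (fst (prod_decode p)) (snd (prod_decode p))"]) blast
qed

lemma reflected_compact: "compact K \<Longrightarrow> compact ((\<lambda>y. - y + x) ` K)" for x :: 'a
  by (rule compact_continuous_image) (intro continuous_intros)

text \<open>
  Local null sets are unaffected by \<open>y \<mapsto> - y + x\<close> as long as \<open>y\<close> stays in a \<open>\<sigma>\<close>-compact set. On a
  larger set this can fail, which is why the supports of integrable functions have to be
  \<open>\<sigma>\<close>-compact.
\<close>

lemma loc_null_reflect:
  assumes E: "loc_null \<mu> E" and K: "\<And>n::nat. compact (K n)"
  shows "AE y in \<mu>. y \<in> (\<Union>n. K n) \<longrightarrow> - y + x \<notin> E"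
proof (rule AE_I')
  let ?N = "\<lambda>n. (+) x ` uminus ` (E \<inter> (\<lambda>y. - y + x) ` K n)"
  have "?N n \<in> null_sets \<mu>" for n
  proof -
    have Z: "compact ((\<lambda>y. - y + x) ` K n)" by (rule reflected_compact[OF K])
    then have "E \<inter> (\<lambda>y. - y + x) ` K n \<in> null_sets \<mu>"
      using E emeasure_compact_finite unfolding loc_null_def by auto
    then have "uminus ` (E \<inter> (\<lambda>y. - y + x) ` K n) \<in> null_sets \<mu>"
      by (intro null_reflect[OF _ _ Z]) (auto simp: null_sets_def)
    then show ?thesis by (auto simp: null_sets_def emeasure_left_translate borel_left_translate)
  qed
  then show "(\<Union>n. ?N n) \<in> null_sets \<mu>" by (rule null_sets_UN)
  show "{y \<in> space \<mu>. \<not> (y \<in> (\<Union>n. K n) \<longrightarrow> - y + x \<notin> E)} \<subseteq> (\<Union>n. ?N n)"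
  proof
    fix y assume "y \<in> {y \<in> space \<mu>. \<not> (y \<in> (\<Union>n. K n) \<longrightarrow> - y + x \<notin> E)}"
    then obtain n where n: "y \<in> K n" "- y + x \<in> E" by auto
    have "y = x + - (- y + x)" by (simp add: minus_add minus_add_self)
    then have "y \<in> ?N n" using n by blast
    then show "y \<in> (\<Union>n. ?N n)" by blast
  qed
qed

text \<open>
  The function \<open>\<phi>\<close> is only locally measurable. The preimages that matter are taken inside compact
  sets \<open>K n\<close> covering the support of \<open>f\<close>, and their reflections are compact, hence of finite
  measure.
\<close>

lemma conv_integrand_measurable:
  assumes f: "integrable \<mu> f" and \<phi>: "loc_measurable \<mu> \<phi>"
  shows "(\<lambda>y. f y *\<^sub>R \<phi> (- y + x)) \<in> borel_measurable \<mu>"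
proof -
  obtain K :: "nat \<Rightarrow> 'a set" where K: "\<forall>n. compact (K n)" "{x. f x \<noteq> 0} \<subseteq> (\<Union>n. K n)"
    using integrable_sigma_compact[OF f] by blast
  define T where "T = (\<Union>n. K n)"
  have T: "T \<in> sets borel" unfolding T_def using K(1) by auto
  define g where "g = (\<lambda>y. if y \<in> T then \<phi> (- y + x) else 0)"
  have "g \<in> borel_measurable \<mu>"
  proof (rule measurableI)
    fix B :: "complex set" assume B: "B \<in> sets borel"
    have Kn: "{y \<in> K n. \<phi> (- y + x) \<in> B} \<in> sets borel" for n
    proof -
      let ?Z = "(\<lambda>y. - y + x) ` K n"
      have Z: "compact ?Z" using K(1) by (intro reflected_compact) blast
      then have "\<phi> -` B \<inter> ?Z \<in> sets borel"
        using \<phi> B emeasure_compact_finite[OF Z] unfolding loc_measurable_def by auto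
      then have "(\<lambda>y. - y + x) -` (\<phi> -` B \<inter> ?Z) \<in> sets borel"
        by (rule measurable_sets_borel[rotated])
          (intro borel_measurable_continuous_onI continuous_intros)
      moreover have "{y \<in> K n. \<phi> (- y + x) \<in> B} = (\<lambda>y. - y + x) -` (\<phi> -` B \<inter> ?Z) \<inter> K n" by auto
      ultimately show ?thesis using K(1) by auto
    qed
    have "g -` B \<inter> space \<mu> = (\<Union>n. {y \<in> K n. \<phi> (- y + x) \<in> B}) \<union> (if 0 \<in> B then - T else {})"
      by (auto simp: g_def T_def split: if_splits)
    then show "g -` B \<inter> space \<mu> \<in> sets \<mu>" using Kn T by auto
  qed auto
  moreover have "(\<lambda>y. f y *\<^sub>R \<phi> (- y + x)) = (\<lambda>y. f y *\<^sub>R g y)"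
    using K(2) by (auto simp: g_def T_def fun_eq_iff)
  ultimately show ?thesis using f by simp
qed

lemma conv_integrand:
  assumes f: "integrable \<mu> f" and \<phi>: "loc_measurable \<mu> \<phi>" "loc_null \<mu> {x. cmod (\<phi> x) > C}"
  shows "integrable \<mu> (\<lambda>y. f y *\<^sub>R \<phi> (- y + x))"
    "cmod (conv \<mu> f \<phi> x) \<le> C * (\<integral>y. \<bar>f y\<bar> \<partial>\<mu>)"
proof -
  obtain K :: "nat \<Rightarrow> 'a set" where K: "\<forall>n. compact (K n)" "{x. f x \<noteq> 0} \<subseteq> (\<Union>n. K n)"
    using integrable_sigma_compact[OF f] by blast
  have "AE y in \<mu>. y \<in> (\<Union>n. K n) \<longrightarrow> - y + x \<notin> {x. cmod (\<phi> x) > C}"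
    using K(1) by (intro loc_null_reflect[OF \<phi>(2)]) blast
  then have bnd: "AE y in \<mu>. norm (f y *\<^sub>R \<phi> (- y + x)) \<le> C * \<bar>f y\<bar>"
  proof eventually_elim
    case (elim y)
    show ?case
    proof (cases "f y = 0")
      case False
      then have "cmod (\<phi> (- y + x)) \<le> C" using elim K(2) by auto
      then show ?thesis by (simp add: mult.commute[of C] mult_left_mono)
    qed simp
  qed
  have intC: "integrable \<mu> (\<lambda>y. C * \<bar>f y\<bar>)" using f by simp
  show int: "integrable \<mu> (\<lambda>y. f y *\<^sub>R \<phi> (- y + x))"
  proof (rule Bochner_Integration.integrable_bound[OF intC conv_integrand_measurable[OF f \<phi>(1)]])
    show "AE y in \<mu>. norm (f y *\<^sub>R \<phi> (- y + x)) \<le> norm (C * \<bar>f y\<bar>)"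
      using bnd by eventually_elim simp
  qed
  have "cmod (conv \<mu> f \<phi> x) \<le> (\<integral>y. norm (f y *\<^sub>R \<phi> (- y + x)) \<partial>\<mu>)"
    unfolding conv_def by (rule integral_norm_bound)
  also have "\<dots> \<le> (\<integral>y. C * \<bar>f y\<bar> \<partial>\<mu>)"
    by (rule integral_mono_AE[OF integrable_norm[OF int] intC bnd])
  finally show "cmod (conv \<mu> f \<phi> x) \<le> C * (\<integral>y. \<bar>f y\<bar> \<partial>\<mu>)" by simp
qed

lemma conv_integrable:
  assumes f: "integrable \<mu> f" and \<phi>: "\<phi> \<in> Linf \<mu>"
  shows "integrable \<mu> (\<lambda>y. f y *\<^sub>R \<phi> (- y + x))"
proof -
  obtain C where "loc_measurable \<mu> \<phi>" "loc_null \<mu> {x. cmod (\<phi> x) > C}"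
    using \<phi> by (auto simp: Linf_def)
  then show ?thesis by (rule conv_integrand(1)[OF f])
qed

lemma conv_bound:
  assumes "\<phi> \<in> Linf \<mu>"
  obtains C where "C \<ge> 0" "\<And>f x. integrable \<mu> f \<Longrightarrow> cmod (conv \<mu> f \<phi> x) \<le> C * (\<integral>y. \<bar>f y\<bar> \<partial>\<mu>)"
proof -
  obtain C where C: "loc_measurable \<mu> \<phi>" "loc_null \<mu> {x. cmod (\<phi> x) > C}"
    using assms by (auto simp: Linf_def)
  show thesis
  proof (rule that[of "max C 0"])
    fix f :: "'a \<Rightarrow> real" and x assume f: "integrable \<mu> f"
    have "cmod (conv \<mu> f \<phi> x) \<le> C * (\<integral>y. \<bar>f y\<bar> \<partial>\<mu>)" by (rule conv_integrand(2)[OF f C])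
    also have "\<dots> \<le> max C 0 * (\<integral>y. \<bar>f y\<bar> \<partial>\<mu>)" by (intro mult_right_mono) auto
    finally show "cmod (conv \<mu> f \<phi> x) \<le> max C 0 * (\<integral>y. \<bar>f y\<bar> \<partial>\<mu>)" .
  qed simp
qed

lemma conv_cong:
  assumes f: "integrable \<mu> f" and \<phi>: "\<phi> \<in> Linf \<mu>" "\<psi> \<in> Linf \<mu>" "loc_null \<mu> {x. \<phi> x \<noteq> \<psi> x}"
  shows "conv \<mu> f \<phi> = conv \<mu> f \<psi>"
proof
  fix x
  obtain K :: "nat \<Rightarrow> 'a set" where K: "\<forall>n. compact (K n)" "{x. f x \<noteq> 0} \<subseteq> (\<Union>n. K n)"
    using integrable_sigma_compact[OF f] by blast
  have "AE y in \<mu>. y \<in> (\<Union>n. K n) \<longrightarrow> - y + x \<notin> {x. \<phi> x \<noteq> \<psi> x}"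
    using K(1) by (intro loc_null_reflect[OF \<phi>(3)]) blast
  then have "AE y in \<mu>. f y *\<^sub>R \<phi> (- y + x) = f y *\<^sub>R \<psi> (- y + x)"
    by eventually_elim (use K(2) in auto)
  then show "conv \<mu> f \<phi> x = conv \<mu> f \<psi> x"
    unfolding conv_def using conv_integrable[OF f \<phi>(1)] conv_integrable[OF f \<phi>(2)]
    by (intro integral_cong_AE) auto
qed

lemma conv_add_right:
  assumes "integrable \<mu> f" "\<phi> \<in> Linf \<mu>" "\<psi> \<in> Linf \<mu>"
  shows "conv \<mu> f (\<lambda>x. \<phi> x + \<psi> x) = (\<lambda>x. conv \<mu> f \<phi> x + conv \<mu> f \<psi> x)"
  unfolding conv_def scaleR_add_right
  by (rule ext, rule Bochner_Integration.integral_add)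
    (rule conv_integrable[OF assms(1,2)], rule conv_integrable[OF assms(1,3)])

lemma conv_scale_right: "conv \<mu> f (\<lambda>x. c * \<phi> x) = (\<lambda>x. c * conv \<mu> f \<phi> x)"
proof
  fix x
  have "(\<lambda>y. f y *\<^sub>R (c * \<phi> (- y + x))) = (\<lambda>y. c * (f y *\<^sub>R \<phi> (- y + x)))" by simp
  then show "conv \<mu> f (\<lambda>x. c * \<phi> x) x = c * conv \<mu> f \<phi> x"
    by (simp only: conv_def integral_mult_right_zero)
qed

lemma conv_diff_left:
  assumes "integrable \<mu> f" "integrable \<mu> g" "\<phi> \<in> Linf \<mu>"
  shows "conv \<mu> (\<lambda>x. f x - g x) \<phi> = (\<lambda>x. conv \<mu> f \<phi> x - conv \<mu> g \<phi> x)"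
  unfolding conv_def scaleR_diff_left
  by (rule ext, rule Bochner_Integration.integral_diff)
    (rule conv_integrable[OF assms(1,3)], rule conv_integrable[OF assms(2,3)])

lemma conv_scale_left: "conv \<mu> (\<lambda>x. r * f x) \<phi> = (\<lambda>x. of_real r * conv \<mu> f \<phi> x)"
proof
  fix x
  have "(\<lambda>y. (r * f y) *\<^sub>R \<phi> (- y + x)) = (\<lambda>y. of_real r * (f y *\<^sub>R \<phi> (- y + x)))"
    by (simp add: scaleR_conv_of_real mult_ac)
  then show "conv \<mu> (\<lambda>x. r * f x) \<phi> x = of_real r * conv \<mu> f \<phi> x"
    by (simp only: conv_def integral_mult_right_zero)
qed

text \<open>
  Left translation of a convolution only moves the \<open>L\<^sub>1\<close> factor; all regularity of \<open>conv \<mu> f \<phi>\<close>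
  comes from this.
\<close>

lemma ltrans_conv: "ltrans a (conv \<mu> f \<phi>) = conv \<mu> (\<lambda>y. f (a + y)) \<phi>"
proof
  fix x
  have "conv \<mu> f \<phi> (a + x) = (\<integral>y. f (a + y) *\<^sub>R \<phi> (- (a + y) + (a + x)) \<partial>\<mu>)"
    unfolding conv_def by (rule integral_left_total[symmetric])
  also have "\<dots> = conv \<mu> (\<lambda>y. f (a + y)) \<phi> x"
  proof -
    have "- (a + y) + (a + x) = - y + x" for y
      by (simp only: minus_add add.assoc minus_add_self)
    then show ?thesis by (simp only: conv_def)
  qed
  finally show "ltrans a (conv \<mu> f \<phi>) x = conv \<mu> (\<lambda>y. f (a + y)) \<phi> x"
    by (simp add: ltrans_def)
qed

end

section \<open>Left uniformly continuous functions\<close>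

text \<open>
  Continuity is a consequence of left uniform continuity: \<open>z = (z + - x) + x\<close> is a small left
  translate of \<open>x\<close> when \<open>z\<close> is near \<open>x\<close>.
\<close>

lemma LUC_I:
  fixes f :: "'a::topological_group_add \<Rightarrow> complex"
  assumes bdd: "\<And>x. cmod (f x) \<le> B"
    and unif: "\<And>e. e > 0 \<Longrightarrow> \<exists>V. open V \<and> 0 \<in> V \<and> (\<forall>v\<in>V. \<forall>y. cmod (f y - f (v + y)) \<le> e)"
  shows "f \<in> LUC"
proof -
  have "(f \<longlongrightarrow> f x) (nhds x)" for x
    unfolding tendsto_iff
  proof (intro allI impI)
    fix e :: real assume e: "e > 0"
    obtain V where V: "open V" "0 \<in> V" "\<forall>v\<in>V. \<forall>y. cmod (f y - f (v + y)) \<le> e / 2"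
      using unif[of "e / 2"] e by auto
    have "open {z. z + - x \<in> V}" by (intro open_vimage_UNIV V(1) continuous_intros)
    moreover have "x \<in> {z. z + - x \<in> V}" using V(2) by simp
    moreover have "dist (f z) (f x) < e" if "z \<in> {z. z + - x \<in> V}" for z
    proof -
      have "cmod (f x - f ((z + - x) + x)) \<le> e / 2" using V(3) that by blast
      then have "cmod (f x - f z) \<le> e / 2" by (simp only: minus_add_self)
      then show ?thesis using e by (simp add: dist_norm norm_minus_commute)
    qed
    ultimately show "\<forall>\<^sub>F z in nhds x. dist (f z) (f x) < e"
      unfolding eventually_nhds by blast
  qed
  then have "continuous_on UNIV f"
    unfolding continuous_on_def at_within_def by (blast intro: tendsto_mono[OF inf_le1])
  moreover have "bounded (range f)" using bdd by (auto simp: bounded_iff)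
  moreover have "((\<lambda>x. SUP y. cmod (f y - ltrans x f y)) \<longlongrightarrow> 0) (nhds 0)"
    unfolding tendsto_iff
  proof (intro allI impI)
    fix e :: real assume e: "e > 0"
    obtain V where V: "open V" "0 \<in> V" "\<forall>v\<in>V. \<forall>y. cmod (f y - f (v + y)) \<le> e / 2"
      using unif[of "e / 2"] e by auto
    have "dist (SUP y. cmod (f y - ltrans v f y)) 0 < e" if "v \<in> V" for v
    proof -
      have le: "cmod (f y - ltrans v f y) \<le> e / 2" for y using V(3) that by (simp add: ltrans_def)
      then have "(SUP y. cmod (f y - ltrans v f y)) \<le> e / 2" by (intro cSUP_least) auto
      moreover have "0 \<le> (SUP y. cmod (f y - ltrans v f y))"
        using le by (intro cSUP_upper2[of _ _ 0]) (auto intro!: bdd_aboveI[of _ "e / 2"])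
      ultimately show ?thesis using e by simp
    qed
    then show "\<forall>\<^sub>F v in nhds 0. dist (SUP y. cmod (f y - ltrans v f y)) 0 < e"
      unfolding eventually_nhds using V by blast
  qed
  ultimately show ?thesis by (simp add: LUC_def bcontfun_def)
qed

lemma LUC_continuous: "f \<in> LUC \<Longrightarrow> continuous_on UNIV f"
  by (simp add: LUC_def bcontfun_def)

lemma LUC_bounded:
  assumes "f \<in> LUC" obtains B where "\<And>x. cmod (f x) \<le> B"
proof -
  have "bounded (range f)" using assms by (simp add: LUC_def bcontfun_def)
  then show thesis using that unfolding bounded_iff by auto
qed

lemma LUC_D:
  fixes f :: "'a::topological_group_add \<Rightarrow> complex"
  assumes f: "f \<in> LUC" and e: "e > 0"
  shows "\<exists>V. open V \<and> 0 \<in> V \<and> (\<forall>v\<in>V. \<forall>y. cmod (f y - f (v + y)) \<le> e)"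
proof -
  obtain B where B: "\<And>x. cmod (f x) \<le> B" using LUC_bounded[OF f] by blast
  have "((\<lambda>x. SUP y. cmod (f y - ltrans x f y)) \<longlongrightarrow> 0) (nhds 0)"
    using f by (simp add: LUC_def)
  then have "\<forall>\<^sub>F v in nhds 0. dist (SUP y. cmod (f y - ltrans v f y)) 0 < e"
    using e by (rule tendstoD)
  then obtain V where V: "open V" "0 \<in> V" "\<forall>v\<in>V. dist (SUP y. cmod (f y - ltrans v f y)) 0 < e"
    unfolding eventually_nhds by blast
  have "cmod (f y - f (v + y)) \<le> e" if v: "v \<in> V" for v y
  proof -
    have "cmod (f y - ltrans v f y) \<le> 2 * B" for y
      using norm_triangle_ineq4[of "f y" "ltrans v f y"] B[of y] B[of "v + y"] by (simp add: ltrans_def)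
    then have "bdd_above (range (\<lambda>y. cmod (f y - ltrans v f y)))" by (intro bdd_aboveI) auto
    then have "cmod (f y - ltrans v f y) \<le> (SUP y. cmod (f y - ltrans v f y))"
      by (rule cSUP_upper[OF UNIV_I])
    moreover have "(SUP y. cmod (f y - ltrans v f y)) < e" using V(3) v by auto
    ultimately show ?thesis by (simp add: ltrans_def)
  qed
  then show ?thesis using V by blast
qed

lemma LUC_const: "(\<lambda>x. c) \<in> LUC"
  by (rule LUC_I[of _ "cmod c"]) (auto intro!: exI[of _ UNIV])

lemma LUC_scale:
  fixes f :: "'a::topological_group_add \<Rightarrow> complex"
  assumes f: "f \<in> LUC" shows "(\<lambda>x. c * f x) \<in> LUC"
proof -
  obtain B where B: "\<And>x. cmod (f x) \<le> B" using LUC_bounded[OF f] by blast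
  show ?thesis
  proof (rule LUC_I)
    show "cmod (c * f x) \<le> cmod c * B" for x
      using B by (simp add: norm_mult mult_left_mono)
    fix e :: real assume e: "e > 0"
    have pos: "cmod c + 1 > 0" by (smt (verit) norm_ge_zero)
    obtain V where V: "open V" "0 \<in> V" "\<forall>v\<in>V. \<forall>y. cmod (f y - f (v + y)) \<le> e / (cmod c + 1)"
      using LUC_D[OF f, of "e / (cmod c + 1)"] e pos by auto
    have "cmod (c * f y - c * f (v + y)) \<le> e" if "v \<in> V" for v y
    proof -
      have "cmod (c * f y - c * f (v + y)) = cmod c * cmod (f y - f (v + y))"
        by (simp only: right_diff_distrib[symmetric] norm_mult)
      also have "\<dots> \<le> (cmod c + 1) * (e / (cmod c + 1))"
        using V(3) that pos by (intro mult_mono) auto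
      finally show ?thesis using pos by simp
    qed
    then show "\<exists>V. open V \<and> 0 \<in> V \<and> (\<forall>v\<in>V. \<forall>y. cmod (c * f y - c * f (v + y)) \<le> e)"
      using V by blast
  qed
qed

lemma LUC_add:
  fixes f :: "'a::topological_group_add \<Rightarrow> complex"
  assumes f: "f \<in> LUC" and g: "g \<in> LUC" shows "(\<lambda>x. f x + g x) \<in> LUC"
proof -
  obtain B where B: "\<And>x. cmod (f x) \<le> B" using LUC_bounded[OF f] by blast
  obtain D where D: "\<And>x. cmod (g x) \<le> D" using LUC_bounded[OF g] by blast
  show ?thesis
  proof (rule LUC_I)
    show "cmod (f x + g x) \<le> B + D" for x
      using B D by (intro norm_triangle_mono)
    fix e :: real assume e: "e > 0"
    obtain V where V: "open V" "0 \<in> V" "\<forall>v\<in>V. \<forall>y. cmod (f y - f (v + y)) \<le> e / 2"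
      using LUC_D[OF f, of "e / 2"] e by auto
    obtain W where W: "open W" "0 \<in> W" "\<forall>v\<in>W. \<forall>y. cmod (g y - g (v + y)) \<le> e / 2"
      using LUC_D[OF g, of "e / 2"] e by auto
    have "cmod (f y + g y - (f (v + y) + g (v + y))) \<le> e" if "v \<in> V \<inter> W" for v y
    proof -
      have "cmod ((f y - f (v + y)) + (g y - g (v + y))) \<le> e / 2 + e / 2"
        using V(3) W(3) that by (intro norm_triangle_mono) auto
      then show ?thesis by (simp add: algebra_simps)
    qed
    then show "\<exists>V. open V \<and> 0 \<in> V \<and> (\<forall>v\<in>V. \<forall>y. cmod (f y + g y - (f (v + y) + g (v + y))) \<le> e)"
      using V W by (intro exI[of _ "V \<inter> W"]) auto
  qed
qed

lemma LUC_diff: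
  fixes f :: "'a::topological_group_add \<Rightarrow> complex"
  assumes f: "f \<in> LUC" and g: "g \<in> LUC" shows "(\<lambda>x. f x - g x) \<in> LUC"
  using LUC_add[OF f LUC_scale[OF g, of "-1"]] by simp

lemma LUC_ltrans:
  fixes f :: "'a::topological_group_add \<Rightarrow> complex"
  assumes f: "f \<in> LUC" shows "ltrans a f \<in> LUC"
proof -
  obtain B where B: "\<And>x. cmod (f x) \<le> B" using LUC_bounded[OF f] by blast
  show ?thesis
  proof (rule LUC_I)
    show "cmod (ltrans a f x) \<le> B" for x using B by (simp add: ltrans_def)
    fix e :: real assume e: "e > 0"
    obtain V where V: "open V" "0 \<in> V" "\<forall>v\<in>V. \<forall>y. cmod (f y - f (v + y)) \<le> e"
      using LUC_D[OF f e] by blast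
    have "open {v. a + v + - a \<in> V}" by (intro open_vimage_UNIV V(1) continuous_intros)
    moreover have "0 \<in> {v. a + v + - a \<in> V}" using V(2) by simp
    moreover have "cmod (ltrans a f y - ltrans a f (v + y)) \<le> e" if "v \<in> {v. a + v + - a \<in> V}" for v y
    proof -
      have "cmod (f (a + y) - f ((a + v + - a) + (a + y))) \<le> e" using V(3) that by blast
      moreover have "(a + v + - a) + (a + y) = a + (v + y)"
        by (simp only: add.assoc minus_add_self)
      ultimately show ?thesis by (simp add: ltrans_def)
    qed
    ultimately show "\<exists>V. open V \<and> 0 \<in> V \<and> (\<forall>v\<in>V. \<forall>y. cmod (ltrans a f y - ltrans a f (v + y)) \<le> e)"
      by blast
  qed
qed

lemma LUC_sum:
  fixes F :: "nat \<Rightarrow> 'a::topological_group_add \<Rightarrow> complex"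
  shows "(\<And>i. i < n \<Longrightarrow> F i \<in> LUC) \<Longrightarrow> (\<lambda>x. \<Sum>i<n. F i x) \<in> LUC"
  by (induction n) (auto intro: LUC_const LUC_add)

section \<open>Smoothing by convolution\<close>

context haar_group begin

lemma bounded_continuous_Linf:
  assumes "continuous_on UNIV \<phi>" "\<And>x. cmod (\<phi> x) \<le> B" shows "\<phi> \<in> Linf \<mu>"
proof -
  have "\<phi> -` X \<in> sets borel" if "X \<in> sets borel" for X
    using measurable_sets_borel[OF borel_measurable_continuous_onI[OF assms(1)] that] .
  then have "loc_measurable \<mu> \<phi>" by (auto simp: loc_measurable_def)
  moreover have "{x. cmod (\<phi> x) > B} = {}" using assms(2) by (auto simp: not_less)
  then have "loc_null \<mu> {x. cmod (\<phi> x) > B}" by (simp add: loc_null_def)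
  ultimately show ?thesis by (auto simp: Linf_def)
qed

lemma LUC_Linf: "\<phi> \<in> LUC \<Longrightarrow> \<phi> \<in> Linf \<mu>"
  by (metis LUC_bounded LUC_continuous bounded_continuous_Linf)

lemma loc_measurable_iff:
  "loc_measurable \<mu> \<phi> \<longleftrightarrow>
    (\<forall>F\<in>sets \<mu>. emeasure \<mu> F < \<infinity> \<longrightarrow> \<phi> \<in> borel_measurable (restrict_space \<mu> F))"
proof -
  have "\<phi> \<in> borel_measurable (restrict_space \<mu> F) \<longleftrightarrow> (\<forall>B\<in>sets borel. \<phi> -` B \<inter> F \<in> sets \<mu>)"
    if "F \<in> sets \<mu>" for F
    using that by (auto simp: measurable_def space_restrict_space sets_restrict_space_iff)
  then show ?thesis unfolding loc_measurable_def by blast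
qed

lemma Linf_I:
  assumes m: "loc_measurable \<mu> \<phi>" and E: "loc_null \<mu> E" "\<And>x. x \<notin> E \<Longrightarrow> cmod (\<phi> x) \<le> C"
  shows "\<phi> \<in> Linf \<mu>"
proof -
  have "{x. cmod (\<phi> x) > C} \<inter> F \<in> null_sets \<mu>" if F: "F \<in> sets \<mu>" "emeasure \<mu> F < \<infinity>" for F
  proof (rule null_sets_subset)
    show "E \<inter> F \<in> null_sets \<mu>" using E(1) F by (simp add: loc_null_def)
    have "open {z::complex. cmod z > C}" by (intro open_Collect_less continuous_intros)
    then have "\<phi> -` {z. cmod z > C} \<inter> F \<in> sets \<mu>"
      by (rule m[unfolded loc_measurable_def, rule_format, OF borel_open F])
    then show "{x. cmod (\<phi> x) > C} \<inter> F \<in> sets \<mu>" by (simp add: vimage_def)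
    show "{x. cmod (\<phi> x) > C} \<inter> F \<subseteq> E \<inter> F" using E(2) by force
  qed
  then have "loc_null \<mu> {x. cmod (\<phi> x) > C}" unfolding loc_null_def by blast
  with m show ?thesis unfolding Linf_def by (intro CollectI conjI exI[of _ C])
qed

lemma Linf_add:
  assumes "\<phi> \<in> Linf \<mu>" "\<psi> \<in> Linf \<mu>" shows "(\<lambda>x. \<phi> x + \<psi> x) \<in> Linf \<mu>"
proof -
  obtain C where C: "loc_measurable \<mu> \<phi>" "loc_null \<mu> {x. cmod (\<phi> x) > C}"
    using assms(1) by (auto simp: Linf_def)
  obtain D where D: "loc_measurable \<mu> \<psi>" "loc_null \<mu> {x. cmod (\<psi> x) > D}"
    using assms(2) by (auto simp: Linf_def)
  show ?thesis
  proof (rule Linf_I)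
    show "loc_measurable \<mu> (\<lambda>x. \<phi> x + \<psi> x)"
      using C(1) D(1) unfolding loc_measurable_iff by (auto intro: borel_measurable_add)
    show "loc_null \<mu> ({x. cmod (\<phi> x) > C} \<union> {x. cmod (\<psi> x) > D})"
      using C(2) D(2) unfolding loc_null_def Int_Un_distrib2 by auto
    show "cmod (\<phi> x + \<psi> x) \<le> C + D" if "x \<notin> {x. cmod (\<phi> x) > C} \<union> {x. cmod (\<psi> x) > D}" for x
      using that by (intro norm_triangle_mono) auto
  qed
qed

lemma Linf_scale:
  assumes "\<phi> \<in> Linf \<mu>" shows "(\<lambda>x. c * \<phi> x) \<in> Linf \<mu>"
proof -
  obtain C where C: "loc_measurable \<mu> \<phi>" "loc_null \<mu> {x. cmod (\<phi> x) > C}"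
    using assms by (auto simp: Linf_def)
  show ?thesis
  proof (rule Linf_I[OF _ C(2)])
    show "loc_measurable \<mu> (\<lambda>x. c * \<phi> x)"
      using C(1) unfolding loc_measurable_iff by (auto intro: borel_measurable_times)
    show "cmod (c * \<phi> x) \<le> cmod c * C" if "x \<notin> {x. cmod (\<phi> x) > C}" for x
      using that by (auto simp: norm_mult intro: mult_left_mono)
  qed
qed

text \<open>
  For the indicator of \<open>A\<close>, choose \<open>K \<subseteq> U \<supseteq> A\<close> by regularity and a Urysohn function between \<open>K\<close> and
  \<open>U\<close>; it differs from the indicator at most on \<open>U - A\<close> and \<open>U - K\<close>.
\<close>

lemma L1_dense:
  fixes f :: "'a \<Rightarrow> real"
  assumes "integrable \<mu> f"
  shows "\<forall>e>0. \<exists>h\<in>Cc. (\<integral>x. \<bar>f x - h x\<bar> \<partial>\<mu>) < e"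
  using assms
proof (induction rule: integrable_induct)
  case (base A c)
  show ?case
  proof (intro allI impI)
    fix e :: real assume e: "e > 0"
    define d where "d = e / (2 * (\<bar>c\<bar> + 1))"
    have pos: "2 * (\<bar>c\<bar> + 1) > 0" by simp
    have d: "d > 0" "2 * (\<bar>c\<bar> + 1) * d = e" using e pos by (simp_all add: d_def)
    have A: "A \<in> sets borel" using base by simp
    define m where "m = measure \<mu> A"
    have m: "emeasure \<mu> A = ennreal m" "m \<ge> 0"
      unfolding m_def using base by (auto simp: emeasure_eq_ennreal_measure)
    then have "emeasure \<mu> A < ennreal (m + d)" using d by (simp add: ennreal_less_iff)
    then obtain U where U: "open U" "A \<subseteq> U" "emeasure \<mu> U < ennreal (m + d)"
      by (rule outer_regular[OF A])
    have finU: "emeasure \<mu> U < \<infinity>" using U(3) by (metis ennreal_less_top infinity_ennreal_def less_trans)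
    define u where "u = measure \<mu> U"
    have u: "emeasure \<mu> U = ennreal u" "u \<ge> 0"
      unfolding u_def using finU by (auto simp: emeasure_eq_ennreal_measure)
    have um: "u < m + d" using U(3) u(2) unfolding u(1) by (simp only: ennreal_less_iff)
    obtain K where K: "compact K" "K \<subseteq> U" "u - d \<le> measure \<mu> K"
    proof (cases "u - d < 0")
      case True
      then show thesis using that[of "{}"] by auto
    next
      case False
      then have "ennreal (u - d) < emeasure \<mu> U" unfolding u(1) using d by (simp add: ennreal_less_iff)
      then obtain K where K: "compact K" "K \<subseteq> U" "ennreal (u - d) < emeasure \<mu> K"
        by (rule inner_regular[OF U(1)])
      have "emeasure \<mu> K = ennreal (measure \<mu> K)"
        using emeasure_compact_finite[OF K(1)] by (simp add: emeasure_eq_ennreal_measure)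
      then have "u - d \<le> measure \<mu> K" using K(3) False by (simp add: ennreal_less_iff)
      then show thesis using that K by blast
    qed
    from Cc_Urysohn[OF locally_compact K(1) U(1) K(2)]
    obtain f :: "'a \<Rightarrow> real" where f: "f \<in> Cc" "\<And>x. 0 \<le> f x" "\<And>x. f x \<le> 1"
        "\<And>x. x \<in> K \<Longrightarrow> f x = 1" "\<And>x. x \<notin> U \<Longrightarrow> f x = 0"
      by metis
    have finK: "emeasure \<mu> K < \<infinity>" by (rule emeasure_compact_finite[OF K(1)])
    have bound: "\<bar>indicator A x *\<^sub>R c - c * f x\<bar> \<le> \<bar>c\<bar> * (2 * indicator U x - indicator A x - indicator K x)" for x
    proof -
      have "\<bar>indicator A x - f x\<bar> \<le> 2 * indicator U x - indicator A x - indicator K x"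
        using U(2) K(2) f(2)[of x] f(3)[of x] f(4)[of x] f(5)[of x]
        by (auto simp: indicator_def split: if_splits)
      moreover have "\<bar>indicator A x *\<^sub>R c - c * f x\<bar> = \<bar>c\<bar> * \<bar>indicator A x - f x\<bar>"
        by (simp add: abs_mult[symmetric] algebra_simps)
      ultimately show ?thesis by (simp add: mult_left_mono)
    qed
    have ints: "integrable \<mu> (indicator U :: 'a \<Rightarrow> real)" "integrable \<mu> (indicator A :: 'a \<Rightarrow> real)"
        "integrable \<mu> (indicator K :: 'a \<Rightarrow> real)"
      using U(1) K(1) A finU finK base by (auto simp: integrable_indicator_iff)
    have "(\<integral>x. \<bar>indicator A x *\<^sub>R c - c * f x\<bar> \<partial>\<mu>)
        \<le> (\<integral>x. \<bar>c\<bar> * (2 * indicator U x - indicator A x - indicator K x) \<partial>\<mu>)"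
      using bound ints Cc_integrable[OF f(1)] by (intro integral_mono) auto
    also have "\<dots> = \<bar>c\<bar> * (2 * u - m - measure \<mu> K)"
      using ints U(1) K(1) A by (simp add: u_def m_def)
    also have "\<dots> \<le> \<bar>c\<bar> * (2 * d)" using um K(3) by (intro mult_left_mono) auto
    also have "\<dots> < e" using d by (simp add: algebra_simps)
    finally show "\<exists>h\<in>Cc. (\<integral>x. \<bar>indicator A x *\<^sub>R c - h x\<bar> \<partial>\<mu>) < e"
      by (intro bexI[of _ "\<lambda>x. c * f x"] Cc_scale f(1))
  qed
next
  case (add f g)
  show ?case
  proof (intro allI impI)
    fix e :: real assume e: "e > 0"
    obtain h where h: "h \<in> Cc" "(\<integral>x. \<bar>f x - h x\<bar> \<partial>\<mu>) < e / 2" using add e by (meson half_gt_zero)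
    obtain k where k: "k \<in> Cc" "(\<integral>x. \<bar>g x - k x\<bar> \<partial>\<mu>) < e / 2" using add e by (meson half_gt_zero)
    note i = add.hyps Cc_integrable[OF h(1)] Cc_integrable[OF k(1)]
    have "(\<integral>x. \<bar>f x + g x - (h x + k x)\<bar> \<partial>\<mu>) \<le> (\<integral>x. \<bar>f x - h x\<bar> + \<bar>g x - k x\<bar> \<partial>\<mu>)"
      using i by (intro integral_mono) auto
    also have "\<dots> = (\<integral>x. \<bar>f x - h x\<bar> \<partial>\<mu>) + (\<integral>x. \<bar>g x - k x\<bar> \<partial>\<mu>)"
      using i by (intro Bochner_Integration.integral_add) auto
    also have "\<dots> < e" using h k by linarith
    finally show "\<exists>h\<in>Cc. (\<integral>x. \<bar>f x + g x - h x\<bar> \<partial>\<mu>) < e"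
      by (intro bexI[of _ "\<lambda>x. h x + k x"] Cc_add h(1) k(1))
  qed
next
  case (lim f s)
  show ?case
  proof (intro allI impI)
    fix e :: real assume e: "e > 0"
    have "(\<lambda>i. \<integral>x. \<bar>f x - s i x\<bar> \<partial>\<mu>) \<longlonglongrightarrow> (\<integral>x. 0 \<partial>\<mu>)"
    proof (rule integral_dominated_convergence)
      show "integrable \<mu> (\<lambda>x. 3 * \<bar>f x\<bar>)" using lim.hyps by simp
      show "(\<lambda>x. \<bar>f x - s i x\<bar>) \<in> borel_measurable \<mu>" for i
        using borel_measurable_integrable[OF lim.hyps(4)] borel_measurable_integrable[OF lim.hyps(1)[of i]]
        by measurable
      show "AE x in \<mu>. (\<lambda>i. \<bar>f x - s i x\<bar>) \<longlonglongrightarrow> 0"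
      proof (rule AE_I2)
        fix x assume "x \<in> space \<mu>"
        then have "(\<lambda>i. \<bar>f x - s i x\<bar>) \<longlonglongrightarrow> \<bar>f x - f x\<bar>" by (intro tendsto_intros lim.hyps)
        then show "(\<lambda>i. \<bar>f x - s i x\<bar>) \<longlonglongrightarrow> 0" by simp
      qed
      show "AE x in \<mu>. norm \<bar>f x - s i x\<bar> \<le> 3 * \<bar>f x\<bar>" for i
      proof (rule AE_I2)
        fix x assume "x \<in> space \<mu>"
        then have "\<bar>s i x\<bar> \<le> 2 * \<bar>f x\<bar>" using lim.hyps(3)[of x i] by simp
        then show "norm \<bar>f x - s i x\<bar> \<le> 3 * \<bar>f x\<bar>" by simp
      qed
    qed simp
    then have "\<forall>\<^sub>F i in sequentially. (\<integral>x. \<bar>f x - s i x\<bar> \<partial>\<mu>) < e / 2"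
      using e by (intro order_tendstoD(2)[of _ "\<integral>x. 0 \<partial>\<mu>"]) auto
    then obtain i where i: "(\<integral>x. \<bar>f x - s i x\<bar> \<partial>\<mu>) < e / 2"
      unfolding eventually_sequentially by blast
    obtain h where h: "h \<in> Cc" "(\<integral>x. \<bar>s i x - h x\<bar> \<partial>\<mu>) < e / 2" using lim.IH[of i, rule_format, of "e / 2"] e by auto
    note int = lim.hyps(1)[of i] lim.hyps(4) Cc_integrable[OF h(1)]
    have "(\<integral>x. \<bar>f x - h x\<bar> \<partial>\<mu>) \<le> (\<integral>x. \<bar>f x - s i x\<bar> + \<bar>s i x - h x\<bar> \<partial>\<mu>)"
      using int by (intro integral_mono) auto
    also have "\<dots> = (\<integral>x. \<bar>f x - s i x\<bar> \<partial>\<mu>) + (\<integral>x. \<bar>s i x - h x\<bar> \<partial>\<mu>)"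
      using int by (intro Bochner_Integration.integral_add) auto
    also have "\<dots> < e" using h i by linarith
    finally show "\<exists>h\<in>Cc. (\<integral>x. \<bar>f x - h x\<bar> \<partial>\<mu>) < e" using h(1) by blast
  qed
qed

lemma conv_Cc_LUC:
  assumes f: "f \<in> Cc" and \<phi>: "\<phi> \<in> Linf \<mu>"
  shows "conv \<mu> f \<phi> \<in> LUC"
proof -
  obtain C where C: "C \<ge> 0" "\<And>f x. integrable \<mu> f \<Longrightarrow> cmod (conv \<mu> f \<phi> x) \<le> C * (\<integral>y. \<bar>f y\<bar> \<partial>\<mu>)"
    using conv_bound[OF \<phi>] by blast
  obtain K where K: "continuous_on UNIV f" "compact K" "\<And>x. x \<notin> K \<Longrightarrow> f x = 0"
    using CcE[OF f] by blast
  obtain U L where U: "open U" "compact L" "{0::'a} \<subseteq> U" "U \<subseteq> L"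
    using compact_subset_interior_compact[OF locally_compact, of "{0}"] by auto
  define P where "P = K \<union> (\<lambda>(x, y). x + y) ` (uminus ` L \<times> K)"
  have P: "compact P" unfolding P_def
    by (intro compact_Un K(2) compact_sums_group compact_uminus_image U(2))
  note fi = Cc_integrable[OF f] Cc_integrable[OF Cc_translate[OF f]]
  show ?thesis
  proof (rule LUC_I)
    show "cmod (conv \<mu> f \<phi> x) \<le> C * (\<integral>y. \<bar>f y\<bar> \<partial>\<mu>)" for x by (rule C(2)[OF fi(1)])
    fix e :: real assume e: "e > 0"
    define d where "d = e / (C * measure \<mu> P + 1)"
    have pos: "C * measure \<mu> P + 1 > 0" using C(1) by (smt (verit) measure_nonneg mult_nonneg_nonneg)
    have d: "d > 0" "C * (d * measure \<mu> P) \<le> e"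
      using e pos by (simp_all add: d_def pos_divide_le_eq mult.left_commute)
    obtain V where V: "open V" "0 \<in> V" "\<And>v x. v \<in> V \<Longrightarrow> \<bar>f (v + x) - f x\<bar> < d"
      using Cc_uniformly_continuous_left[OF f d(1)] by blast
    have "cmod (conv \<mu> f \<phi> x - conv \<mu> f \<phi> (v + x)) \<le> e" if v: "v \<in> V \<inter> U" for v x
    proof -
      let ?h = "\<lambda>y. f y - f (v + y)"
      have hC: "?h \<in> Cc" by (intro Cc_diff f Cc_translate)
      have h0: "?h y = 0" if y: "y \<notin> P" for y
      proof -
        have "y \<notin> K" using y by (simp add: P_def)
        moreover have "v + y \<notin> K"
        proof
          assume "v + y \<in> K"
          moreover have "y = - v + (v + y)" by (simp only: minus_add_self)
          ultimately have "y \<in> (\<lambda>(x, y). x + y) ` (uminus ` L \<times> K)"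
            using v U(4) by (intro image_eqI[of _ _ "(- v, v + y)"]) auto
          then show False using y by (simp add: P_def)
        qed
        ultimately show ?thesis using K(3) by simp
      qed
      have "conv \<mu> f \<phi> x - conv \<mu> f \<phi> (v + x) = conv \<mu> ?h \<phi> x"
        using ltrans_conv[of v f \<phi>] conv_diff_left[OF fi \<phi>, of v] by (simp add: ltrans_def fun_eq_iff)
      also have "cmod \<dots> \<le> C * (\<integral>y. \<bar>?h y\<bar> \<partial>\<mu>)" by (rule C(2)[OF Cc_integrable[OF hC]])
      also have "(\<integral>y. \<bar>?h y\<bar> \<partial>\<mu>) \<le> d * measure \<mu> P"
      proof -
        have "norm (?h y) \<le> d" for y using V(3)[of v y] v by (simp add: abs_minus_commute)
        from integrable_bounded_compact(2)[OF Cc_measurable[OF hC] P h0 this] show ?thesis by simp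
      qed
      finally show ?thesis using d(2) C(1) by (meson mult_left_mono order_trans)
    qed
    then show "\<exists>V. open V \<and> 0 \<in> V \<and> (\<forall>v\<in>V. \<forall>y. cmod (conv \<mu> f \<phi> y - conv \<mu> f \<phi> (v + y)) \<le> e)"
      using V U by (intro exI[of _ "V \<inter> U"]) auto
  qed
qed

lemma conv_LUC:
  assumes f: "integrable \<mu> f" and \<phi>: "\<phi> \<in> Linf \<mu>"
  shows "conv \<mu> f \<phi> \<in> LUC"
proof -
  obtain C where C: "C \<ge> 0" "\<And>f x. integrable \<mu> f \<Longrightarrow> cmod (conv \<mu> f \<phi> x) \<le> C * (\<integral>y. \<bar>f y\<bar> \<partial>\<mu>)"
    using conv_bound[OF \<phi>] by blast
  show ?thesis
  proof (rule LUC_I)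
    show "cmod (conv \<mu> f \<phi> x) \<le> C * (\<integral>y. \<bar>f y\<bar> \<partial>\<mu>)" for x by (rule C(2)[OF f])
    fix e :: real assume e: "e > 0"
    define d where "d = e / (3 * (C + 1))"
    have d: "d > 0" "C * d \<le> e / 3" using e C(1) by (simp_all add: d_def field_simps)
    obtain h where h: "h \<in> Cc" "(\<integral>x. \<bar>f x - h x\<bar> \<partial>\<mu>) < d" using L1_dense[OF f] d by blast
    have close: "cmod (conv \<mu> f \<phi> x - conv \<mu> h \<phi> x) \<le> e / 3" for x
    proof -
      have hi: "integrable \<mu> h" by (rule Cc_integrable[OF h(1)])
      have "conv \<mu> f \<phi> x - conv \<mu> h \<phi> x = conv \<mu> (\<lambda>x. f x - h x) \<phi> x"
        by (simp only: conv_diff_left[OF f hi \<phi>])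
      also have "cmod \<dots> \<le> C * (\<integral>x. \<bar>f x - h x\<bar> \<partial>\<mu>)"
        by (rule C(2)) (use f hi in auto)
      also have "\<dots> \<le> C * d" using h(2) C(1) by (intro mult_left_mono) auto
      finally show ?thesis using d(2) by linarith
    qed
    obtain V where V: "open V" "0 \<in> V"
        "\<forall>v\<in>V. \<forall>y. cmod (conv \<mu> h \<phi> y - conv \<mu> h \<phi> (v + y)) \<le> e / 3"
      using LUC_D[OF conv_Cc_LUC[OF h(1) \<phi>], of "e / 3"] e by auto
    have "cmod (conv \<mu> f \<phi> y - conv \<mu> f \<phi> (v + y)) \<le> e" if "v \<in> V" for v y
    proof -
      have "cmod (conv \<mu> h \<phi> y - conv \<mu> h \<phi> (v + y)) \<le> e / 3" using V(3) that by blast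
      moreover have "cmod (conv \<mu> h \<phi> (v + y) - conv \<mu> f \<phi> (v + y)) \<le> e / 3"
        using close[of "v + y"] by (simp add: norm_minus_commute)
      ultimately have "cmod ((conv \<mu> f \<phi> y - conv \<mu> h \<phi> y) + (conv \<mu> h \<phi> y - conv \<mu> h \<phi> (v + y))
          + (conv \<mu> h \<phi> (v + y) - conv \<mu> f \<phi> (v + y))) \<le> e / 3 + e / 3 + e / 3"
        using close[of y] by (intro norm_triangle_mono)
      then show ?thesis by simp
    qed
    then show "\<exists>V. open V \<and> 0 \<in> V \<and> (\<forall>v\<in>V. \<forall>y. cmod (conv \<mu> f \<phi> y - conv \<mu> f \<phi> (v + y)) \<le> e)"
      using V by blast
  qed
qed

text \<open>
  An approximate identity, discretised: for a symmetric bump \<open>g\<close> near \<open>0\<close>, the convolution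
  \<open>\<integral> f z * g (- z + x) dz\<close> is close to \<open>f x\<close>, and it is a uniform limit of Riemann sums, which are
  combinations of left translates of \<open>g\<close>. The neighbourhood \<open>V\<close> depends on \<open>f\<close> only, so that two
  functions can be approximated with the same \<open>g\<close>. Symmetry makes \<open>z \<mapsto> g (- z + x)\<close> a left
  translate of \<open>g\<close>, so that its integral is \<open>1\<close> also on a non-unimodular group.
\<close>

lemma Cc_convolution_approx:
  assumes f: "f \<in> Cc" and K: "compact K" "\<And>x. x \<notin> K \<Longrightarrow> f x = 0" and d: "d > 0"
  shows "\<exists>V. open V \<and> 0 \<in> V \<and> (\<forall>g\<in>Cc. (\<forall>x. g x \<ge> 0) \<longrightarrow> (\<forall>x. g (- x) = g x) \<longrightarrow>
      (\<forall>x. x \<notin> V \<longrightarrow> g x = 0) \<longrightarrow> (\<integral>x. g x \<partial>\<mu>) = 1 \<longrightarrow>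
      (\<exists>(n::nat) y c. (\<forall>i<n. y i \<in> K) \<and> (\<Sum>i<n. c i) = (\<integral>x. f x \<partial>\<mu>) \<and>
         (\<forall>x. \<bar>f x - (\<Sum>i<n. c i * g (- y i + x))\<bar> \<le> d)))"
proof -
  have d2: "d / 2 > 0" using d by simp
  obtain V where V: "open V" "0 \<in> V" "\<And>v x. v \<in> V \<Longrightarrow> \<bar>f (x + v) - f x\<bar> < d / 2"
    using Cc_uniformly_continuous_right[OF f d2] by blast
  have fc: "continuous_on UNIV f" using f by (simp add: Cc_def)
  have "\<exists>(n::nat) y c. (\<forall>i<n. y i \<in> K) \<and> (\<Sum>i<n. c i) = (\<integral>x. f x \<partial>\<mu>) \<and>
         (\<forall>x. \<bar>f x - (\<Sum>i<n. c i * g (- y i + x))\<bar> \<le> d)"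
    if g: "g \<in> Cc" "\<And>x. g x \<ge> 0" "\<And>x. g (- x) = g x" "\<And>x. x \<notin> V \<Longrightarrow> g x = 0" "(\<integral>x. g x \<partial>\<mu>) = 1"
    for g :: "'a \<Rightarrow> real"
  proof -
    have gc: "continuous_on UNIV g" using g(1) by (simp add: Cc_def)
    define I where "I = (\<integral>y. \<bar>f y\<bar> \<partial>\<mu>)"
    have I: "I \<ge> 0" by (simp add: I_def)
    define e where "e = d / (2 * (I + 1))"
    have e: "e > 0" "e * I \<le> d / 2" using d I by (simp_all add: e_def field_simps)
    obtain X where X: "open X" "0 \<in> X" "\<And>v x. v \<in> X \<Longrightarrow> \<bar>g (v + x) - g x\<bar> < e"
      using Cc_uniformly_continuous_left[OF g(1) e(1)] by blast
    \<comment> \<open>Since \<open>- z + x = (- z + y) + (- y + x)\<close>, these cells work for all \<open>x\<close>.\<close>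
    let ?W = "\<lambda>y. {z. - z + y \<in> X}"
    have W: "\<forall>y\<in>K. open (?W y) \<and> y \<in> ?W y"
      using X(2) by (auto intro!: open_vimage_UNIV X(1) continuous_intros)
    have f0: "\<forall>x. x \<notin> K \<longrightarrow> f x = 0" using K(2) by blast
    from riemann_sum[where 'b=real, OF Cc_integrable[OF f] K(1) f0 W]
    obtain n :: nat and y c where ync: "\<forall>i<n. y i \<in> K" "(\<Sum>i<n. c i) = (\<integral>x. f x \<partial>\<mu>)"
      and est: "\<forall>(G :: 'a \<Rightarrow> real) e. G \<in> borel_measurable \<mu> \<longrightarrow>
       (\<forall>y\<in>K. \<forall>z\<in>?W y. norm (G z - G y) \<le> e) \<longrightarrow>
       norm ((\<integral>z. f z *\<^sub>R G z \<partial>\<mu>) - (\<Sum>i<n. c i *\<^sub>R G (y i))) \<le> e * (\<integral>z. \<bar>f z\<bar> \<partial>\<mu>)"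
      by blast
    have "\<bar>f x - (\<Sum>i<n. c i * g (- y i + x))\<bar> \<le> d" for x
    proof -
      let ?J = "\<integral>z. f z * g (- z + x) \<partial>\<mu>"
      have "norm ((\<integral>z. f z *\<^sub>R g (- z + x) \<partial>\<mu>) - (\<Sum>i<n. c i *\<^sub>R g (- y i + x))) \<le> e * (\<integral>z. \<bar>f z\<bar> \<partial>\<mu>)"
      proof (rule est[rule_format, of "\<lambda>z. g (- z + x)" e])
        show "(\<lambda>z. g (- z + x)) \<in> borel_measurable \<mu>"
          by (intro continuous_measurable continuous_on_UNIV_compose[OF gc] continuous_intros)
        fix y z assume "z \<in> ?W y"
        moreover have "- z + x = (- z + y) + (- y + x)" by (simp only: add.assoc minus_add_self)
        ultimately show "norm (g (- z + x) - g (- y + x)) \<le> e"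
          using X(3)[of "- z + y" "- y + x"] by simp
      qed
      then have 1: "\<bar>?J - (\<Sum>i<n. c i * g (- y i + x))\<bar> \<le> d / 2"
        using e(2) by (simp add: I_def)
      have sym: "g (- z + x) = g (- x + z)" for z
        using g(3)[of "- z + x"] by (simp add: minus_add)
      have int1: "integrable \<mu> (\<lambda>z. g (- x + z))" by (intro Cc_integrable Cc_translate g(1))
      have "(\<lambda>z. f z * g (- x + z)) \<in> Cc"
        by (rule CcI[OF _ K(1)])
          (use K(2) in \<open>auto intro!: continuous_intros fc continuous_on_UNIV_compose[OF gc]\<close>)
      then have int2: "integrable \<mu> (\<lambda>z. f z * g (- x + z))" by (rule Cc_integrable)
      have g1: "(\<integral>z. g (- x + z) \<partial>\<mu>) = 1" using integral_left_total[of g "- x"] g(5) by simp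
      have "f x - ?J = (\<integral>z. f x * g (- x + z) - f z * g (- x + z) \<partial>\<mu>)"
        using int1 int2 g1 by (simp add: sym)
      also have "\<bar>\<dots>\<bar> \<le> (\<integral>z. \<bar>f x * g (- x + z) - f z * g (- x + z)\<bar> \<partial>\<mu>)"
        using integral_norm_bound[of \<mu> "\<lambda>z. f x * g (- x + z) - f z * g (- x + z)"] by simp
      also have "\<dots> \<le> (\<integral>z. (d / 2) * g (- x + z) \<partial>\<mu>)"
      proof (rule integral_mono)
        show "integrable \<mu> (\<lambda>z. \<bar>f x * g (- x + z) - f z * g (- x + z)\<bar>)" using int1 int2 by simp
        show "integrable \<mu> (\<lambda>z. (d / 2) * g (- x + z))" using int1 by simp
        fix z
        show "\<bar>f x * g (- x + z) - f z * g (- x + z)\<bar> \<le> (d / 2) * g (- x + z)"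
        proof (cases "- x + z \<in> V")
          case True
          have "\<bar>f (x + (- x + z)) - f x\<bar> < d / 2" by (rule V(3)[OF True])
          then have "\<bar>f x - f z\<bar> \<le> d / 2" by (simp only: minus_add_self)
          then have "\<bar>f x - f z\<bar> * g (- x + z) \<le> (d / 2) * g (- x + z)"
            by (intro mult_right_mono g(2))
          moreover have "\<bar>f x * g (- x + z) - f z * g (- x + z)\<bar> = \<bar>f x - f z\<bar> * g (- x + z)"
            by (simp only: left_diff_distrib[symmetric] abs_mult abs_of_nonneg[OF g(2)])
          ultimately show ?thesis by simp
        next
          case False
          then have "g (- x + z) = 0" by (rule g(4))
          then show ?thesis by simp
        qed
      qed
      also have "\<dots> = d / 2" using g1 by simp
      finally show ?thesis using 1 by linarith
    qed
    then show ?thesis using ync by blast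
  qed
  then show ?thesis using V(1,2) by (intro exI[of _ V] conjI ballI impI) blast+
qed

end

section \<open>From left-invariant to topological left-invariant means\<close>

text \<open>
  A left-invariant mean on \<open>LUC\<close>. The bound with constant \<open>2\<close> is a crude form of
  \<open>\<bar>N f\<bar> \<le> sup \<bar>f\<bar>\<close>, read off from real and imaginary parts; only continuity matters.
\<close>

locale luc_mean = haar_group \<mu>
  for \<mu> :: "'a::{topological_group_add, t2_space} measure" +
  fixes N :: "('a \<Rightarrow> complex) \<Rightarrow> complex"
  assumes N_add: "f \<in> LUC \<Longrightarrow> g \<in> LUC \<Longrightarrow> N (\<lambda>x. f x + g x) = N f + N g"
    and N_scale: "f \<in> LUC \<Longrightarrow> N (\<lambda>x. (a :: complex) * f x) = a * N f"
    and N_pos: "f \<in> LUC \<Longrightarrow> (\<And>x. f x \<in> \<real>\<^sub>\<ge>\<^sub>0) \<Longrightarrow> N f \<in> \<real>\<^sub>\<ge>\<^sub>0"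
    and N_one: "N (\<lambda>x. 1) = 1"
    and N_bound: "f \<in> LUC \<Longrightarrow> (\<And>x. cmod (f x) \<le> b) \<Longrightarrow> cmod (N f) \<le> 2 * b"
    and N_inv: "f \<in> LUC \<Longrightarrow> N (ltrans y f) = N f"
begin

lemma N_diff: "f \<in> LUC \<Longrightarrow> g \<in> LUC \<Longrightarrow> N (\<lambda>x. f x - g x) = N f - N g"
  using N_add[of f "\<lambda>x. (-1) * g x"] N_scale[of g "-1"] LUC_scale[of g "-1"] by simp

lemma N_sum:
  "(\<And>i. i < n \<Longrightarrow> F i \<in> LUC) \<Longrightarrow> N (\<lambda>x. \<Sum>i<n. F i x) = (\<Sum>i<n. N (F i))" for n :: nat
proof (induction n)
  case 0
  show ?case using N_scale[OF LUC_const, of 0 1] by simp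
next
  case (Suc n)
  then show ?case by (simp add: N_add LUC_sum)
qed

text \<open>
  For \<open>\<psi>\<close> in \<open>LUC\<close> the convolution is a uniform limit of Riemann sums \<open>\<Sum>i<n. c i * ltrans (- y i) \<psi>\<close>
  with \<open>\<Sum>i<n. c i = \<integral> e\<close>, and \<open>N\<close> does not notice the translations.
\<close>

lemma N_conv_Cc:
  assumes e: "e \<in> Cc" and \<psi>: "\<psi> \<in> LUC"
  shows "N (conv \<mu> e \<psi>) = of_real (\<integral>x. e x \<partial>\<mu>) * N \<psi>"
proof -
  obtain K where K: "continuous_on UNIV e" "compact K" "\<And>x. x \<notin> K \<Longrightarrow> e x = 0"
    using CcE[OF e] by blast
  define I where "I = (\<integral>y. \<bar>e y\<bar> \<partial>\<mu>)"
  have I: "I \<ge> 0" by (simp add: I_def)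
  have convL: "conv \<mu> e \<psi> \<in> LUC" by (intro conv_LUC Cc_integrable e LUC_Linf \<psi>)
  have close: "cmod (N (conv \<mu> e \<psi>) - of_real (\<integral>x. e x \<partial>\<mu>) * N \<psi>) \<le> 2 * (d * I)" if d: "d > 0" for d
  proof -
    obtain X where X: "open X" "0 \<in> X" "\<forall>v\<in>X. \<forall>y. cmod (\<psi> y - \<psi> (v + y)) \<le> d"
      using LUC_D[OF \<psi> d] by blast
    let ?W = "\<lambda>y. {z. - z + y \<in> X}"
    have W: "\<forall>y\<in>K. open (?W y) \<and> y \<in> ?W y"
      using X(2) by (auto intro!: open_vimage_UNIV X(1) continuous_intros)
    have f0: "\<forall>x. x \<notin> K \<longrightarrow> e x = 0" using K(3) by blast
    from riemann_sum[where 'b=complex, OF Cc_integrable[OF e] K(2) f0 W]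
    obtain n :: nat and y c where ync: "\<forall>i<n. y i \<in> K" "(\<Sum>i<n. c i) = (\<integral>x. e x \<partial>\<mu>)"
      and est: "\<forall>(G :: 'a \<Rightarrow> complex) d. G \<in> borel_measurable \<mu> \<longrightarrow>
       (\<forall>y\<in>K. \<forall>z\<in>?W y. norm (G z - G y) \<le> d) \<longrightarrow>
       norm ((\<integral>z. e z *\<^sub>R G z \<partial>\<mu>) - (\<Sum>i<n. c i *\<^sub>R G (y i))) \<le> d * (\<integral>z. \<bar>e z\<bar> \<partial>\<mu>)"
      by blast
    let ?S = "\<lambda>x. \<Sum>i<n. of_real (c i) * ltrans (- y i) \<psi> x"
    have "cmod (conv \<mu> e \<psi> x - ?S x) \<le> d * I" for x
    proof -
      have "norm ((\<integral>z. e z *\<^sub>R \<psi> (- z + x) \<partial>\<mu>) - (\<Sum>i<n. c i *\<^sub>R \<psi> (- y i + x))) \<le> d * (\<integral>z. \<bar>e z\<bar> \<partial>\<mu>)"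
      proof (rule est[rule_format, of "\<lambda>z. \<psi> (- z + x)" d])
        show "(\<lambda>z. \<psi> (- z + x)) \<in> borel_measurable \<mu>"
          by (intro continuous_measurable continuous_on_UNIV_compose[OF LUC_continuous[OF \<psi>]] continuous_intros)
        fix y z assume "z \<in> ?W y"
        then have "cmod (\<psi> (- y + x) - \<psi> ((- z + y) + (- y + x))) \<le> d" using X(3) by blast
        moreover have "- z + x = (- z + y) + (- y + x)" by (simp only: add.assoc minus_add_self)
        ultimately show "norm (\<psi> (- z + x) - \<psi> (- y + x)) \<le> d"
          by (simp only: norm_minus_commute)
      qed
      then show ?thesis by (simp add: conv_def I_def ltrans_def scaleR_conv_of_real)
    qed
    moreover have SL: "(\<lambda>x. of_real (c i) * ltrans (- y i) \<psi> x) \<in> LUC" for i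
      by (intro LUC_scale LUC_ltrans \<psi>)
    ultimately have "cmod (N (\<lambda>x. conv \<mu> e \<psi> x - ?S x)) \<le> 2 * (d * I)"
      by (intro N_bound LUC_diff convL LUC_sum)
    also have "N (\<lambda>x. conv \<mu> e \<psi> x - ?S x) = N (conv \<mu> e \<psi>) - N ?S"
      by (intro N_diff convL LUC_sum SL)
    also have "N ?S = (\<Sum>i<n. N (\<lambda>x. of_real (c i) * ltrans (- y i) \<psi> x))"
      by (intro N_sum SL)
    also have "\<dots> = (\<Sum>i<n. of_real (c i) * N \<psi>)"
      by (simp only: N_scale[OF LUC_ltrans[OF \<psi>]] N_inv[OF \<psi>])
    also have "\<dots> = of_real (\<integral>x. e x \<partial>\<mu>) * N \<psi>"
      by (simp only: sum_distrib_right[symmetric] of_real_sum[symmetric] ync(2))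
    finally show ?thesis .
  qed
  have "cmod (N (conv \<mu> e \<psi>) - of_real (\<integral>x. e x \<partial>\<mu>) * N \<psi>) \<le> 0 + r" if "r > 0" for r
  proof -
    have "r / (2 * (I + 1)) > 0" "2 * (r / (2 * (I + 1)) * I) \<le> r" using that I by (simp_all add: field_simps)
    then show ?thesis using close[of "r / (2 * (I + 1))"] by linarith
  qed
  then have "cmod (N (conv \<mu> e \<psi>) - of_real (\<integral>x. e x \<partial>\<mu>) * N \<psi>) \<le> 0" by (rule field_le_epsilon)
  then show ?thesis by simp
qed

lemma N_conv_translates:
  fixes n :: nat
  assumes g: "integrable \<mu> g" and \<phi>: "\<phi> \<in> Linf \<mu>"
  shows "integrable \<mu> (\<lambda>x. \<Sum>i<n. c i * g (- y i + x)) \<and>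
    N (conv \<mu> (\<lambda>x. \<Sum>i<n. c i * g (- y i + x)) \<phi>) = of_real (\<Sum>i<n. c i) * N (conv \<mu> g \<phi>)"
proof (induction n)
  case 0
  have "conv \<mu> (\<lambda>x. 0) \<phi> = (\<lambda>x. 0 * 1)" by (simp add: conv_def)
  then show ?case using N_scale[OF LUC_const, of 0 1] by simp
next
  case (Suc n)
  let ?s = "\<lambda>x. \<Sum>i<n. c i * g (- y i + x)" and ?t = "\<lambda>x. - c n * g (- y n + x)"
  have t: "integrable \<mu> ?t" by (intro integrable_mult_right integrable_left g)
  have eq: "(\<lambda>x. \<Sum>i<Suc n. c i * g (- y i + x)) = (\<lambda>x. ?s x - ?t x)" by simp
  have gL: "conv \<mu> g \<phi> \<in> LUC" by (rule conv_LUC[OF g \<phi>])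
  have ct: "conv \<mu> ?t \<phi> = (\<lambda>x. of_real (- c n) * ltrans (- y n) (conv \<mu> g \<phi>) x)"
    by (simp only: conv_scale_left ltrans_conv)
  have Nt: "N (conv \<mu> ?t \<phi>) = - of_real (c n) * N (conv \<mu> g \<phi>)"
    unfolding ct by (subst N_scale[OF LUC_ltrans[OF gL]]) (simp add: N_inv[OF gL])
  have "N (conv \<mu> (\<lambda>x. ?s x - ?t x) \<phi>) = N (conv \<mu> ?s \<phi>) - N (conv \<mu> ?t \<phi>)"
    unfolding conv_diff_left[OF conjunct1[OF Suc] t \<phi>]
    by (rule N_diff) (intro conv_LUC conjunct1[OF Suc] t \<phi>)+
  also have "\<dots> = of_real (\<Sum>i<Suc n. c i) * N (conv \<mu> g \<phi>)"
    unfolding Nt conjunct2[OF Suc] by (simp add: algebra_simps)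
  finally show ?case
    unfolding eq using Bochner_Integration.integrable_diff[OF conjunct1[OF Suc] t] by blast
qed

lemma N_conv_diff_bound:
  assumes \<phi>: "\<phi> \<in> Linf \<mu>"
  obtains C where "C \<ge> 0" "\<And>f h. integrable \<mu> f \<Longrightarrow> integrable \<mu> h \<Longrightarrow>
     cmod (N (conv \<mu> f \<phi>) - N (conv \<mu> h \<phi>)) \<le> C * (\<integral>x. \<bar>f x - h x\<bar> \<partial>\<mu>)"
proof -
  obtain C where C: "C \<ge> 0" "\<And>f x. integrable \<mu> f \<Longrightarrow> cmod (conv \<mu> f \<phi> x) \<le> C * (\<integral>y. \<bar>f y\<bar> \<partial>\<mu>)"
    using conv_bound[OF \<phi>] by blast
  show thesis
  proof (rule that[of "2 * C"])
    fix f h :: "'a \<Rightarrow> real" assume f: "integrable \<mu> f" and h: "integrable \<mu> h"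
    have fh: "integrable \<mu> (\<lambda>x. f x - h x)" using f h by simp
    have "N (conv \<mu> f \<phi>) - N (conv \<mu> h \<phi>) = N (conv \<mu> (\<lambda>x. f x - h x) \<phi>)"
      unfolding conv_diff_left[OF f h \<phi>] by (rule N_diff[symmetric]) (intro conv_LUC f h \<phi>)+
    also have "cmod \<dots> \<le> 2 * (C * (\<integral>x. \<bar>f x - h x\<bar> \<partial>\<mu>))"
      by (intro N_bound conv_LUC fh \<phi> C(2))
    finally show "cmod (N (conv \<mu> f \<phi>) - N (conv \<mu> h \<phi>)) \<le> 2 * C * (\<integral>x. \<bar>f x - h x\<bar> \<partial>\<mu>)"
      by (simp only: mult.assoc)
  qed (use C in simp)
qed

text \<open>
  The functional \<open>f \<mapsto> N (conv \<mu> f \<phi>)\<close> on \<open>L\<^sub>1\<close> is bounded and left-invariant. Its value at a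
  combination of translates of \<open>g\<close> is the sum of the coefficients times its value at \<open>g\<close>.
\<close>

lemma N_conv_bump:
  assumes f: "f \<in> Cc" and \<phi>: "\<phi> \<in> Linf \<mu>" and e: "e > 0"
  shows "\<exists>V. open V \<and> 0 \<in> V \<and> (\<forall>g\<in>Cc. (\<forall>x. g x \<ge> 0) \<longrightarrow> (\<forall>x. g (- x) = g x) \<longrightarrow>
      (\<forall>x. x \<notin> V \<longrightarrow> g x = 0) \<longrightarrow> (\<integral>x. g x \<partial>\<mu>) = 1 \<longrightarrow>
      cmod (N (conv \<mu> f \<phi>) - of_real (\<integral>x. f x \<partial>\<mu>) * N (conv \<mu> g \<phi>)) \<le> e)"
proof -
  obtain C where C: "C \<ge> 0" "\<And>f h. integrable \<mu> f \<Longrightarrow> integrable \<mu> h \<Longrightarrow>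
     cmod (N (conv \<mu> f \<phi>) - N (conv \<mu> h \<phi>)) \<le> C * (\<integral>x. \<bar>f x - h x\<bar> \<partial>\<mu>)"
    using N_conv_diff_bound[OF \<phi>] by blast
  obtain K where K: "continuous_on UNIV f" "compact K" "\<And>x. x \<notin> K \<Longrightarrow> f x = 0"
    using CcE[OF f] by blast
  obtain U L where U: "open U" "compact L" "{0::'a} \<subseteq> U" "U \<subseteq> L"
    using compact_subset_interior_compact[OF locally_compact, of "{0}"] by auto
  define P where "P = (\<lambda>(x, y). x + y) ` (K \<times> L)"
  have P: "compact P" unfolding P_def by (intro compact_sums_group K(2) U(2))
  define d where "d = e / (C * measure \<mu> P + 1)"
  have pos: "C * measure \<mu> P + 1 > 0" using C(1) by (smt (verit) measure_nonneg mult_nonneg_nonneg)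
  have d: "d > 0" "C * (d * measure \<mu> P) \<le> e"
    using e pos by (simp_all add: d_def pos_divide_le_eq mult.left_commute)
  obtain V where V: "open V" "0 \<in> V" and Vg: "\<forall>g\<in>Cc. (\<forall>x. g x \<ge> 0) \<longrightarrow> (\<forall>x. g (- x) = g x) \<longrightarrow>
      (\<forall>x. x \<notin> V \<longrightarrow> g x = 0) \<longrightarrow> (\<integral>x. g x \<partial>\<mu>) = 1 \<longrightarrow>
      (\<exists>(n::nat) y c. (\<forall>i<n. y i \<in> K) \<and> (\<Sum>i<n. c i) = (\<integral>x. f x \<partial>\<mu>) \<and>
         (\<forall>x. \<bar>f x - (\<Sum>i<n. c i * g (- y i + x))\<bar> \<le> d))"
    using Cc_convolution_approx[OF f K(2,3) d(1)] by blast
  have "cmod (N (conv \<mu> f \<phi>) - of_real (\<integral>x. f x \<partial>\<mu>) * N (conv \<mu> g \<phi>)) \<le> e"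
    if g: "g \<in> Cc" "\<forall>x. g x \<ge> 0" "\<forall>x. g (- x) = g x" "\<forall>x. x \<notin> V \<inter> U \<longrightarrow> g x = 0" "(\<integral>x. g x \<partial>\<mu>) = 1"
    for g
  proof -
    have "\<forall>x. x \<notin> V \<longrightarrow> g x = 0" using g(4) by blast
    then obtain n :: nat and y c where ync: "\<forall>i<n. y i \<in> K" "(\<Sum>i<n. c i) = (\<integral>x. f x \<partial>\<mu>)"
        "\<forall>x. \<bar>f x - (\<Sum>i<n. c i * g (- y i + x))\<bar> \<le> d"
      using Vg g(1,2,3,5) by blast
    let ?s = "\<lambda>x. \<Sum>i<n. c i * g (- y i + x)"
    note s = N_conv_translates[OF Cc_integrable[OF g(1)] \<phi>, where n = n and c = c and y = y]
    have "?s \<in> Cc" by (intro Cc_sum Cc_scale Cc_translate g(1)) auto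
    then have meas: "(\<lambda>x. f x - ?s x) \<in> borel_measurable \<mu>" by (intro Cc_measurable Cc_diff f)
    have "f x - ?s x = 0" if x: "x \<notin> P" for x
    proof -
      have "x \<notin> K"
      proof
        assume "x \<in> K"
        then have "x \<in> P" unfolding P_def using U(3,4) by (intro image_eqI[of _ _ "(x, 0)"]) auto
        then show False using x by blast
      qed
      moreover have "g (- y i + x) = 0" if "i < n" for i
      proof (rule ccontr)
        assume "g (- y i + x) \<noteq> 0"
        then have "- y i + x \<in> L" using g(4) U(4) by blast
        moreover have "x = y i + (- y i + x)" by (simp only: minus_add_self)
        ultimately have "x \<in> P" unfolding P_def using ync(1) that
          by (intro image_eqI[of _ _ "(y i, - y i + x)"]) auto
        then show False using x by blast
      qed
      ultimately show ?thesis using K(3) by simp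
    qed
    from integrable_bounded_compact(2)[OF meas P this, of d]
    have "(\<integral>x. \<bar>f x - ?s x\<bar> \<partial>\<mu>) \<le> d * measure \<mu> P" using ync(3) by simp
    then have "C * (\<integral>x. \<bar>f x - ?s x\<bar> \<partial>\<mu>) \<le> e" using d(2) C(1) by (meson mult_left_mono order_trans)
    moreover have "cmod (N (conv \<mu> f \<phi>) - N (conv \<mu> ?s \<phi>)) \<le> C * (\<integral>x. \<bar>f x - ?s x\<bar> \<partial>\<mu>)"
      by (rule C(2)[OF Cc_integrable[OF f] conjunct1[OF s]])
    ultimately show ?thesis unfolding conjunct2[OF s] ync(2) by linarith
  qed
  then show ?thesis using V U by (intro exI[of _ "V \<inter> U"] conjI ballI impI) (blast | simp)+
qed

lemma N_conv_eq_Cc: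
  assumes f: "f \<in> Cc" "h \<in> Cc" and I: "(\<integral>x. f x \<partial>\<mu>) = (\<integral>x. h x \<partial>\<mu>)" and \<phi>: "\<phi> \<in> Linf \<mu>"
  shows "N (conv \<mu> f \<phi>) = N (conv \<mu> h \<phi>)"
proof -
  have "cmod (N (conv \<mu> f \<phi>) - N (conv \<mu> h \<phi>)) \<le> 0 + e" if e: "e > 0" for e
  proof -
    let ?good = "\<lambda>V g. g \<in> Cc \<and> (\<forall>x. g x \<ge> 0) \<and> (\<forall>x. g (- x) = g x) \<and>
      (\<forall>x. x \<notin> V \<longrightarrow> g x = 0) \<and> (\<integral>x. g x \<partial>\<mu>) = 1"
    have e2: "e / 2 > 0" using e by simp
    obtain V where V: "open V" "0 \<in> V" "\<forall>g. ?good V g \<longrightarrow>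
        cmod (N (conv \<mu> f \<phi>) - of_real (\<integral>x. f x \<partial>\<mu>) * N (conv \<mu> g \<phi>)) \<le> e / 2"
      using N_conv_bump[OF f(1) \<phi> e2] by blast
    obtain W where W: "open W" "0 \<in> W" "\<forall>g. ?good W g \<longrightarrow>
        cmod (N (conv \<mu> h \<phi>) - of_real (\<integral>x. h x \<partial>\<mu>) * N (conv \<mu> g \<phi>)) \<le> e / 2"
      using N_conv_bump[OF f(2) \<phi> e2] by blast
    obtain g :: "'a \<Rightarrow> real" where g: "g \<in> Cc" "\<And>x. g x \<ge> 0" "\<And>x. g (- x) = g x"
        "\<And>x. x \<notin> V \<inter> W \<Longrightarrow> g x = 0" "(\<integral>x. g x \<partial>\<mu>) = 1"
      using symmetric_bump[of "V \<inter> W"] V(1,2) W(1,2) by blast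
    have "?good V g" "?good W g" using g by auto
    then have "cmod (N (conv \<mu> f \<phi>) - of_real (\<integral>x. f x \<partial>\<mu>) * N (conv \<mu> g \<phi>)) \<le> e / 2"
       "cmod (of_real (\<integral>x. f x \<partial>\<mu>) * N (conv \<mu> g \<phi>) - N (conv \<mu> h \<phi>)) \<le> e / 2"
      using V(3) W(3) I by (simp_all add: norm_minus_commute)
    from norm_triangle_mono[OF this] show ?thesis by simp
  qed
  then have "cmod (N (conv \<mu> f \<phi>) - N (conv \<mu> h \<phi>)) \<le> 0" by (rule field_le_epsilon)
  then show ?thesis by simp
qed

text \<open>
  A bounded left-invariant functional on \<open>L\<^sub>1\<close> is a multiple of the integral. This is uniqueness of
  Haar measure in the form that is needed here.
\<close>

lemma N_conv_eq:
  assumes e: "e \<in> Cc" "(\<integral>x. e x \<partial>\<mu>) = 1" and f: "integrable \<mu> f" and \<phi>: "\<phi> \<in> Linf \<mu>"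
  shows "N (conv \<mu> f \<phi>) = of_real (\<integral>x. f x \<partial>\<mu>) * N (conv \<mu> e \<phi>)"
proof -
  obtain C where C: "C \<ge> 0" "\<And>f h. integrable \<mu> f \<Longrightarrow> integrable \<mu> h \<Longrightarrow>
     cmod (N (conv \<mu> f \<phi>) - N (conv \<mu> h \<phi>)) \<le> C * (\<integral>x. \<bar>f x - h x\<bar> \<partial>\<mu>)"
    using N_conv_diff_bound[OF \<phi>] by blast
  let ?M = "N (conv \<mu> e \<phi>)"
  have hM: "N (conv \<mu> h \<phi>) = of_real (\<integral>x. h x \<partial>\<mu>) * ?M" if h: "h \<in> Cc" for h
  proof -
    have "N (conv \<mu> h \<phi>) = N (conv \<mu> (\<lambda>x. (\<integral>x. h x \<partial>\<mu>) * e x) \<phi>)"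
      by (rule N_conv_eq_Cc[OF h Cc_scale[OF e(1)] _ \<phi>]) (simp add: e(2))
    also have "\<dots> = of_real (\<integral>x. h x \<partial>\<mu>) * ?M"
      unfolding conv_scale_left by (intro N_scale conv_LUC Cc_integrable e(1) \<phi>)
    finally show ?thesis .
  qed
  define D where "D = C + cmod ?M + 1"
  have D: "D > 0" using C(1) by (simp add: D_def add_nonneg_pos)
  have "cmod (N (conv \<mu> f \<phi>) - of_real (\<integral>x. f x \<partial>\<mu>) * ?M) \<le> 0 + r" if r: "r > 0" for r
  proof -
    have "r / D > 0" using r D by simp
    then obtain h where h: "h \<in> Cc" "(\<integral>x. \<bar>f x - h x\<bar> \<partial>\<mu>) < r / D" using L1_dense[OF f] by blast
    let ?d = "\<integral>x. \<bar>f x - h x\<bar> \<partial>\<mu>"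
    note hi = Cc_integrable[OF h(1)]
    have 1: "cmod (N (conv \<mu> f \<phi>) - of_real (\<integral>x. h x \<partial>\<mu>) * ?M) \<le> C * ?d"
      using C(2)[OF f hi] unfolding hM[OF h(1)] .
    have "\<bar>(\<integral>x. h x \<partial>\<mu>) - (\<integral>x. f x \<partial>\<mu>)\<bar> \<le> ?d"
      using integral_norm_bound[of \<mu> "\<lambda>x. f x - h x"] f hi by (simp add: abs_minus_commute)
    then have 2: "cmod (of_real (\<integral>x. h x \<partial>\<mu>) * ?M - of_real (\<integral>x. f x \<partial>\<mu>) * ?M) \<le> ?d * cmod ?M"
      by (simp only: left_diff_distrib[symmetric] of_real_diff[symmetric] norm_mult norm_of_real mult_right_mono norm_ge_zero)
    have "cmod (N (conv \<mu> f \<phi>) - of_real (\<integral>x. f x \<partial>\<mu>) * ?M) \<le> C * ?d + ?d * cmod ?M"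
      using norm_triangle_mono[OF 1 2] by simp
    also have "\<dots> \<le> D * ?d" unfolding D_def by (simp add: algebra_simps)
    also have "\<dots> \<le> D * (r / D)" using h(2) D by (intro mult_left_mono) auto
    finally show ?thesis using D by simp
  qed
  then have "cmod (N (conv \<mu> f \<phi>) - of_real (\<integral>x. f x \<partial>\<mu>) * ?M) \<le> 0" by (rule field_le_epsilon)
  then show ?thesis by simp
qed

lemma conv_nonneg:
  assumes e: "\<And>x. e x \<ge> 0" and \<phi>: "\<And>x. \<phi> x \<in> \<real>\<^sub>\<ge>\<^sub>0"
  shows "conv \<mu> e \<phi> x \<in> \<real>\<^sub>\<ge>\<^sub>0"
proof -
  have "e y *\<^sub>R \<phi> (- y + x) = of_real (e y * Re (\<phi> (- y + x)))" for y
    using \<phi>[of "- y + x"] by (auto simp: nonneg_Reals_def scaleR_conv_of_real)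
  then have "conv \<mu> e \<phi> x = of_real (\<integral>y. e y * Re (\<phi> (- y + x)) \<partial>\<mu>)"
    unfolding conv_def by (simp only: integral_complex_of_real)
  moreover have "(\<integral>y. e y * Re (\<phi> (- y + x)) \<partial>\<mu>) \<ge> 0"
  proof (rule Bochner_Integration.integral_nonneg)
    fix y
    have "Re (\<phi> (- y + x)) \<ge> 0" using \<phi>[of "- y + x"] by (auto simp: nonneg_Reals_def)
    then show "e y * Re (\<phi> (- y + x)) \<ge> 0" using e by simp
  qed
  ultimately show ?thesis by simp
qed

text \<open>
  Topological invariance combines the two previous computations: for a density \<open>f\<close>,
  \<open>N (e * (f * \<phi>)) = N (f * \<phi>)\<close> since \<open>f * \<phi>\<close> is in \<open>LUC\<close>, and \<open>N (f * \<phi>) = N (e * \<phi>)\<close> since both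
  densities have integral \<open>1\<close>. Associativity of convolution is thereby avoided.
\<close>

lemma top_left_inv_extension:
  assumes e: "e \<in> Cc" "\<And>x. e x \<ge> 0" "(\<integral>x. e x \<partial>\<mu>) = 1"
  shows "(\<lambda>\<phi>\<in>Linf \<mu>. N (conv \<mu> e \<phi>)) \<in> top_left_inv_means \<mu>" (is "?M \<in> _")
proof -
  note ei = Cc_integrable[OF e(1)]
  have one: "(\<lambda>x. 1) \<in> Linf \<mu>" by (intro LUC_Linf LUC_const)
  have "?M \<in> means UNIV (Linf \<mu>)"
    unfolding means_def
  proof (intro CollectI conjI ballI allI impI)
    show "?M \<in> extensional (Linf \<mu>)" by simp
    fix \<phi> assume \<phi>: "\<phi> \<in> Linf \<mu>"
    show "?M (\<lambda>x\<in>UNIV. c * \<phi> x) = c * ?M \<phi>" for c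
      using Linf_scale[OF \<phi>, of c] \<phi> N_scale[OF conv_LUC[OF ei \<phi>], of c] by (simp add: conv_scale_right restrict_UNIV)
    show "?M (\<lambda>x\<in>UNIV. \<phi> x + \<psi> x) = ?M \<phi> + ?M \<psi>" if \<psi>: "\<psi> \<in> Linf \<mu>" for \<psi>
      using Linf_add[OF \<phi> \<psi>] \<phi> \<psi> N_add[OF conv_LUC[OF ei \<phi>] conv_LUC[OF ei \<psi>]]
      by (simp add: conv_add_right[OF ei \<phi> \<psi>] restrict_UNIV)
    show "?M \<phi> \<in> \<real>\<^sub>\<ge>\<^sub>0" if "\<forall>x\<in>UNIV. \<phi> x \<in> \<real>\<^sub>\<ge>\<^sub>0"
      using N_pos[OF conv_LUC[OF ei \<phi>]] conv_nonneg[OF e(2)] that \<phi> by simp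
  next
    have "conv \<mu> e (\<lambda>x. 1) = (\<lambda>x. 1)"
      using e(3) by (simp add: conv_def scaleR_conv_of_real integral_complex_of_real)
    then show "?M (\<lambda>x\<in>UNIV. 1) = 1" using one N_one by (simp add: restrict_UNIV)
  qed
  moreover have "?M \<phi> = ?M \<psi>" if "\<phi> \<in> Linf \<mu>" "\<psi> \<in> Linf \<mu>" "loc_null \<mu> {x. \<phi> x \<noteq> \<psi> x}" for \<phi> \<psi>
    using conv_cong[OF ei that] that by simp
  moreover have "?M (conv \<mu> f \<phi>) = ?M \<phi>"
    if f: "integrable \<mu> f" "(\<integral>x. f x \<partial>\<mu>) = 1" and \<phi>: "\<phi> \<in> Linf \<mu>" for f \<phi>
  proof -
    have L: "conv \<mu> f \<phi> \<in> LUC" by (rule conv_LUC[OF f(1) \<phi>])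
    have "?M (conv \<mu> f \<phi>) = N (conv \<mu> e (conv \<mu> f \<phi>))" using LUC_Linf[OF L] by simp
    also have "\<dots> = N (conv \<mu> f \<phi>)" using N_conv_Cc[OF e(1) L] e(3) by simp
    also have "\<dots> = N (conv \<mu> e \<phi>)" using N_conv_eq[OF e(1,3) f(1) \<phi>] f(2) by simp
    finally show ?thesis using \<phi> by simp
  qed
  ultimately show ?thesis unfolding top_left_inv_means_def Linf_means_def by blast
qed

end

section \<open>Means concentrated at infinity\<close>

text \<open>
  Zorn's lemma for proper filters below \<open>F\<close>, each encoded as the set of its eventual properties so
  that finer filters become larger sets.
\<close>

lemma ultrafilter_exists:
  fixes F :: "'x filter"
  assumes "F \<noteq> bot"
  obtains U where "U \<le> F" "U \<noteq> bot" "\<And>P. eventually P U \<or> eventually (\<lambda>x. \<not> P x) U"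
proof -
  define ev where "ev = (\<lambda>G :: 'x filter. {P. eventually P G})"
  define A where "A = ev ` {G. G \<noteq> bot \<and> G \<le> F}"
  have ev_le: "ev G \<subseteq> ev G' \<longleftrightarrow> G' \<le> G" for G G' by (auto simp: ev_def le_filter_def)
  have "\<exists>M\<in>A. \<forall>X\<in>A. M \<subseteq> X \<longrightarrow> X = M"
  proof (rule subset_Zorn_nonempty)
    show "A \<noteq> {}" using assms by (auto simp: A_def)
    fix \<C> assume C: "\<C> \<noteq> {}" "subset.chain A \<C>"
    define B where "B = {G. ev G \<in> \<C>}"
    have CA: "\<C> \<subseteq> A" using C(2) by (simp add: subset.chain_def)
    have CB: "\<C> = ev ` B" using CA by (auto simp: B_def A_def)
    have Bne: "B \<noteq> {}" using C(1) CB by blast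
    have GB: "G \<noteq> bot \<and> G \<le> F" if G: "G \<in> B" for G
    proof -
      obtain G' where "G' \<noteq> bot" "G' \<le> F" "ev G = ev G'" using G CA by (auto simp: B_def A_def)
      moreover from this(3) have "G = G'" by (intro antisym) (simp_all flip: ev_le)
      ultimately show ?thesis by simp
    qed
    have dir: "\<exists>x\<in>B. x \<le> inf G G'" if "G \<in> B" "G' \<in> B" for G G'
    proof -
      have "ev G \<subseteq> ev G' \<or> ev G' \<subseteq> ev G" using C(2) that by (auto simp: subset.chain_def B_def)
      then show ?thesis using that by (auto simp: ev_le)
    qed
    have Inf: "eventually P (Inf B) \<longleftrightarrow> (\<exists>b\<in>B. eventually P b)" for P
      using eventually_Inf_base[OF Bne dir] .
    have "ev (Inf B) = \<Union>\<C>" by (auto simp: ev_def Inf CB)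
    moreover have "Inf B \<noteq> bot" using Inf[of "\<lambda>_. False"] GB by (auto simp: trivial_limit_def)
    moreover have "Inf B \<le> F" using Bne GB by (meson Inf_lower2 ex_in_conv)
    ultimately show "\<Union>\<C> \<in> A" unfolding A_def by (metis (mono_tags, lifting) image_eqI mem_Collect_eq)
  qed
  then obtain U where U: "U \<noteq> bot" "U \<le> F" "\<forall>X\<in>A. ev U \<subseteq> X \<longrightarrow> X = ev U" by (auto simp: A_def)
  have "eventually P U \<or> eventually (\<lambda>x. \<not> P x) U" for P
  proof (cases "eventually (\<lambda>x. \<not> P x) U")
    case False
    define G where "G = inf U (principal {x. P x})"
    have "G \<noteq> bot" using False by (simp add: G_def trivial_limit_def eventually_inf_principal)
    moreover have "G \<le> U" by (simp add: G_def)
    ultimately have "ev G \<in> A" "ev U \<subseteq> ev G" using U(2) ev_le by (auto simp: A_def)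
    then have "ev G = ev U" using U(3) by blast
    moreover have "P \<in> ev G" by (simp add: ev_def G_def eventually_inf_principal)
    ultimately show ?thesis by (simp add: ev_def)
  qed simp
  then show thesis using that U by blast
qed

lemma ultrafilter_converges:
  fixes f :: "'x \<Rightarrow> complex"
  assumes U: "U \<noteq> bot" "\<And>P. eventually P U \<or> eventually (\<lambda>x. \<not> P x) U"
    and B: "\<And>x. cmod (f x) \<le> B"
  shows "(f \<longlongrightarrow> Lim U f) U"
proof -
  have "compact (cball (0::complex) B)" by simp
  moreover have "filtermap f U \<noteq> bot" using U(1) by (simp add: filtermap_bot_iff)
  moreover have "eventually (\<lambda>z. z \<in> cball 0 B) (filtermap f U)" using B by (simp add: eventually_filtermap)
  ultimately obtain l where l: "inf (nhds l) (filtermap f U) \<noteq> bot"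
    unfolding compact_filter by blast
  have "(f \<longlongrightarrow> l) U"
  proof (rule topological_tendstoI)
    fix S assume S: "open S" "l \<in> S"
    show "eventually (\<lambda>x. f x \<in> S) U"
    proof (rule ccontr)
      assume "\<not> ?thesis"
      then have "eventually (\<lambda>x. f x \<notin> S) U" using U(2)[of "\<lambda>x. f x \<in> S"] by blast
      then have "eventually (\<lambda>z. z \<notin> S) (filtermap f U)" by (simp add: eventually_filtermap)
      moreover have "eventually (\<lambda>z. z \<in> S) (nhds l)" using S by (rule eventually_nhds_in_open)
      ultimately have "eventually (\<lambda>z. False) (inf (nhds l) (filtermap f U))"
        unfolding eventually_inf by blast
      then show False using l by (simp add: trivial_limit_def)
    qed
  qed
  then show ?thesis using tendsto_Lim[OF U(1)] by metis
qed

context haar_group begin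

lemma mean_bound:
  assumes m: "m \<in> means UNIV (Linf \<mu>)" and f: "f \<in> LUC" "\<And>x. cmod (f x) \<le> b"
  shows "cmod (m f) \<le> 2 * b"
proof -
  have add: "m (\<lambda>x. f x + g x) = m f + m g" if "f \<in> Linf \<mu>" "g \<in> Linf \<mu>" for f g
    using m that by (simp add: means_def restrict_UNIV)
  have scale: "m (\<lambda>x. c * f x) = c * m f" if "f \<in> Linf \<mu>" for c f
    using m that by (simp add: means_def restrict_UNIV)
  have pos: "m f \<in> \<real>\<^sub>\<ge>\<^sub>0" if "f \<in> Linf \<mu>" "\<And>x. f x \<in> \<real>\<^sub>\<ge>\<^sub>0" for f
    using m that by (simp add: means_def)
  have one: "m (\<lambda>x. 1) = 1" using m by (simp add: means_def restrict_UNIV)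
  have oneL: "(\<lambda>x. 1) \<in> Linf \<mu>" by (intro LUC_Linf LUC_const)
  have const: "m (\<lambda>x. c) = c" for c using scale[OF oneL, of c] one by simp
  have constL: "(\<lambda>x. c) \<in> Linf \<mu>" for c by (intro LUC_Linf LUC_const)
  have real: "cmod (m (\<lambda>x. of_real (r x))) \<le> b"
    if r: "continuous_on UNIV r" "\<And>x. \<bar>r x\<bar> \<le> b" for r :: "'a \<Rightarrow> real"
  proof -
    let ?r = "\<lambda>x. complex_of_real (r x)"
    have rL: "?r \<in> Linf \<mu>"
      by (rule bounded_continuous_Linf[of _ b]) (use r in \<open>auto intro: continuous_intros\<close>)
    have "m (\<lambda>x. of_real b + ?r x) \<in> \<real>\<^sub>\<ge>\<^sub>0"
    proof (rule pos[OF Linf_add[OF constL rL]])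
      have "of_real b + ?r x = of_real (b + r x)" for x by simp
      then show "of_real b + ?r x \<in> \<real>\<^sub>\<ge>\<^sub>0" for x using r(2)[of x] by (simp only: nonneg_Reals_of_real_iff)
    qed
    then have 1: "of_real b + m ?r \<in> \<real>\<^sub>\<ge>\<^sub>0" by (simp add: add[OF constL rL] const)
    have "m (\<lambda>x. of_real b + (-1) * ?r x) \<in> \<real>\<^sub>\<ge>\<^sub>0"
    proof (rule pos[OF Linf_add[OF constL Linf_scale[OF rL]]])
      have "of_real b + (-1) * ?r x = of_real (b - r x)" for x by simp
      then show "of_real b + (-1) * ?r x \<in> \<real>\<^sub>\<ge>\<^sub>0" for x using r(2)[of x] by (simp only: nonneg_Reals_of_real_iff)
    qed
    then have 2: "of_real b - m ?r \<in> \<real>\<^sub>\<ge>\<^sub>0"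
      using add[OF constL Linf_scale[OF rL], of "of_real b" "-1"] scale[OF rL, of "-1"] const by simp
    have "Im (m ?r) = 0" "\<bar>Re (m ?r)\<bar> \<le> b" using 1 2 by (auto simp: complex_nonneg_Reals_iff)
    then show ?thesis by (simp add: cmod_eq_Re)
  qed
  let ?R = "\<lambda>x. complex_of_real (Re (f x))" and ?I = "\<lambda>x. complex_of_real (Im (f x))"
  have c: "continuous_on UNIV (\<lambda>x. Re (f x))" "continuous_on UNIV (\<lambda>x. Im (f x))"
    using LUC_continuous[OF f(1)] by (auto intro: continuous_intros)
  have bd: "\<bar>Re (f x)\<bar> \<le> b" "\<bar>Im (f x)\<bar> \<le> b" for x
    using abs_Re_le_cmod[of "f x"] abs_Im_le_cmod[of "f x"] f(2)[of x] by linarith+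
  have L: "?R \<in> Linf \<mu>" "?I \<in> Linf \<mu>"
    by (rule bounded_continuous_Linf[of _ b]; use c bd in \<open>auto intro: continuous_intros\<close>)+
  have "m f = m (\<lambda>x. ?R x + \<i> * ?I x)" by (simp flip: complex_eq)
  also have "\<dots> = m ?R + \<i> * m ?I" by (simp only: add[OF L(1) Linf_scale[OF L(2)]] scale[OF L(2)])
  finally have "cmod (m f) \<le> cmod (m ?R) + cmod (\<i> * m ?I)" by (simp only: norm_triangle_ineq)
  then show ?thesis using real[OF c(1) bd(1)] real[OF c(2) bd(2)] by (simp add: norm_mult)
qed

text \<open>
  Taking the limit of right translates along \<open>U\<close> preserves \<open>LUC\<close> and commutes with left
  translations, so it can be composed with a left-invariant mean. The result only depends on
  the behaviour of \<open>\<psi>\<close> far out along \<open>U\<close>.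
\<close>

lemma ultrafilter_mean:
  assumes m: "m \<in> Linf_means \<mu>" "\<forall>x. \<forall>\<phi>\<in>Linf \<mu>. m (ltrans x \<phi>) = m \<phi>"
    and U: "U \<noteq> bot" "\<And>P. eventually P U \<or> eventually (\<lambda>x. \<not> P x) U"
  shows "luc_mean \<mu> (\<lambda>\<psi>. m (\<lambda>y. Lim U (\<lambda>x. \<psi> (y + x))))"
proof -
  define T where "T = (\<lambda>\<psi> y. Lim U (\<lambda>x. \<psi> (y + x) :: complex))"
  have mm: "m \<in> means UNIV (Linf \<mu>)" using m(1) by (simp add: Linf_means_def)
  have lim: "((\<lambda>x. \<psi> (y + x)) \<longlongrightarrow> T \<psi> y) U" if \<psi>: "\<psi> \<in> LUC" for \<psi> y
  proof -
    obtain B where "\<And>x. cmod (\<psi> x) \<le> B" using LUC_bounded[OF \<psi>] by blast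
    then show ?thesis unfolding T_def by (intro ultrafilter_converges[OF U]) blast
  qed
  have T_eq: "T \<psi> y = l" if "((\<lambda>x. \<psi> (y + x)) \<longlongrightarrow> l) U" for \<psi> y l
    using tendsto_Lim[OF U(1) that] by (simp add: T_def)
  have T_bound: "cmod (T \<psi> y) \<le> b" if "\<psi> \<in> LUC" "\<And>x. cmod (\<psi> x) \<le> b" for \<psi> y b
    using that(2) by (intro Lim_norm_ubound[OF U(1) lim[OF that(1)]]) auto
  have T_LUC: "T \<psi> \<in> LUC" if \<psi>: "\<psi> \<in> LUC" for \<psi>
  proof -
    obtain B where B: "\<And>x. cmod (\<psi> x) \<le> B" using LUC_bounded[OF \<psi>] by blast
    show ?thesis
    proof (rule LUC_I)
      show "cmod (T \<psi> x) \<le> B" for x using T_bound[OF \<psi> B] .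
      fix e :: real assume "e > 0"
      then obtain V where V: "open V" "0 \<in> V" "\<forall>v\<in>V. \<forall>y. cmod (\<psi> y - \<psi> (v + y)) \<le> e"
        using LUC_D[OF \<psi>] by blast
      have "cmod (T \<psi> y - T \<psi> (v + y)) \<le> e" if v: "v \<in> V" for v y
      proof (rule Lim_norm_ubound[OF U(1) tendsto_diff[OF lim[OF \<psi>] lim[OF \<psi>]]])
        show "\<forall>\<^sub>F x in U. cmod (\<psi> (y + x) - \<psi> (v + y + x)) \<le> e"
          using V(3) v by (simp add: add.assoc)
      qed
      then show "\<exists>V. open V \<and> 0 \<in> V \<and> (\<forall>v\<in>V. \<forall>y. cmod (T \<psi> y - T \<psi> (v + y)) \<le> e)"
        using V by blast
    qed
  qed
  have "luc_mean \<mu> (\<lambda>\<psi>. m (T \<psi>))"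
  proof (unfold_locales)
    fix f g :: "'a \<Rightarrow> complex" assume f: "f \<in> LUC" and g: "g \<in> LUC"
    have "T (\<lambda>x. f x + g x) = (\<lambda>y. T f y + T g y)"
      by (rule ext, rule T_eq, intro tendsto_add lim f g)
    then show "m (T (\<lambda>x. f x + g x)) = m (T f) + m (T g)"
      using mm LUC_Linf[OF T_LUC[OF f]] LUC_Linf[OF T_LUC[OF g]] by (simp add: means_def restrict_UNIV)
  next
    fix f :: "'a \<Rightarrow> complex" and a assume f: "f \<in> LUC"
    have "T (\<lambda>x. a * f x) = (\<lambda>y. a * T f y)"
      by (rule ext, rule T_eq, intro tendsto_mult tendsto_const lim f)
    then show "m (T (\<lambda>x. a * f x)) = a * m (T f)"
      using mm LUC_Linf[OF T_LUC[OF f]] by (simp add: means_def restrict_UNIV)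
  next
    fix f :: "'a \<Rightarrow> complex" assume f: "f \<in> LUC" "\<And>x. f x \<in> \<real>\<^sub>\<ge>\<^sub>0"
    have "T f y \<in> \<real>\<^sub>\<ge>\<^sub>0" for y
      by (rule Lim_in_closed_set[OF closed_nonneg_Reals_complex _ U(1) lim[OF f(1)]]) (simp add: f(2))
    then show "m (T f) \<in> \<real>\<^sub>\<ge>\<^sub>0"
      using mm LUC_Linf[OF T_LUC[OF f(1)]] by (simp add: means_def)
  next
    have "T (\<lambda>x. 1) = (\<lambda>y. 1)" by (rule ext, rule T_eq, rule tendsto_const)
    then show "m (T (\<lambda>x. 1)) = 1" using mm by (simp add: means_def restrict_UNIV)
  next
    fix f :: "'a \<Rightarrow> complex" and b assume "f \<in> LUC" "\<And>x. cmod (f x) \<le> b"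
    then show "cmod (m (T f)) \<le> 2 * b" by (intro mean_bound[OF mm] T_LUC T_bound)
  next
    fix f :: "'a \<Rightarrow> complex" and y assume f: "f \<in> LUC"
    have "T (ltrans y f) = ltrans y (T f)" by (simp add: T_def ltrans_def add.assoc fun_eq_iff)
    then show "m (T (ltrans y f)) = m (T f)" using m(2) LUC_Linf[OF T_LUC[OF f]] by simp
  qed
  then show ?thesis by (simp add: T_def)
qed

end

section \<open>Invariant functions on the coset space\<close>

definition saturation :: "'a::plus set \<Rightarrow> ('a \<Rightarrow> real) \<Rightarrow> 'a \<Rightarrow> real" where
  "saturation \<Gamma> k x = (SUP \<gamma>\<in>\<Gamma>. k (x + \<gamma>))"

lemma saturation_props:
  fixes \<Gamma> :: "'a::group_add set"
  assumes \<Gamma>: "add_subgroup \<Gamma>" and k: "\<And>x. 0 \<le> k x" "\<And>x. k x \<le> 1"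
  shows saturation_upper: "\<gamma> \<in> \<Gamma> \<Longrightarrow> k (x + \<gamma>) \<le> saturation \<Gamma> k x"
    and saturation_le: "(\<And>\<gamma>. \<gamma> \<in> \<Gamma> \<Longrightarrow> k (x + \<gamma>) \<le> b) \<Longrightarrow> saturation \<Gamma> k x \<le> b"
    and saturation_range: "0 \<le> saturation \<Gamma> k x" "saturation \<Gamma> k x \<le> 1"
    and saturation_invariant: "\<gamma> \<in> \<Gamma> \<Longrightarrow> saturation \<Gamma> k (x + \<gamma>) = saturation \<Gamma> k x"
proof -
  have bdd: "bdd_above ((\<lambda>\<gamma>. k (x + \<gamma>)) ` \<Gamma>)" for x using k(2) by (intro bdd_aboveI) auto
  show upper: "k (x + \<gamma>) \<le> saturation \<Gamma> k x" if "\<gamma> \<in> \<Gamma>" for \<gamma> x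
    unfolding saturation_def by (rule cSUP_upper[OF that bdd])
  have z: "0 \<in> \<Gamma>" using \<Gamma> by (simp add: add_subgroup_def)
  show le: "saturation \<Gamma> k x \<le> b" if "\<And>\<gamma>. \<gamma> \<in> \<Gamma> \<Longrightarrow> k (x + \<gamma>) \<le> b" for b x
    unfolding saturation_def using z that by (intro cSUP_least) auto
  show "0 \<le> saturation \<Gamma> k x" using upper[OF z, of x] k(1)[of x] by simp
  show "saturation \<Gamma> k x \<le> 1" by (rule le) (rule k(2))
  have one: "saturation \<Gamma> k (x + \<gamma>) \<le> saturation \<Gamma> k x" if g: "\<gamma> \<in> \<Gamma>" for \<gamma> x
  proof (rule le)
    fix \<delta> assume "\<delta> \<in> \<Gamma>"
    then have "\<gamma> + \<delta> \<in> \<Gamma>" using \<Gamma> g by (auto simp: add_subgroup_def)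
    then show "k (x + \<gamma> + \<delta>) \<le> saturation \<Gamma> k x" unfolding add.assoc by (rule upper)
  qed
  show "saturation \<Gamma> k (x + \<gamma>) = saturation \<Gamma> k x" if g: "\<gamma> \<in> \<Gamma>" for \<gamma>
  proof (rule antisym[OF one[OF g]])
    have "- \<gamma> \<in> \<Gamma>" using \<Gamma> g by (auto simp: add_subgroup_def)
    from one[OF this, of "x + \<gamma>"] show "saturation \<Gamma> k x \<le> saturation \<Gamma> k (x + \<gamma>)"
      by (simp only: minus_add_self)
  qed
qed

text \<open>
  The supremum over \<open>\<Gamma>\<close> acts on the right and uniform continuity is with respect to left
  translation, so the modulus of continuity of \<open>k\<close> is inherited.
\<close>

lemma saturation_LUC:
  fixes \<Gamma> :: "'a::topological_group_add set"
  assumes \<Gamma>: "add_subgroup \<Gamma>" and k: "k \<in> Cc" "\<And>x. 0 \<le> k x" "\<And>x. k x \<le> 1"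
  shows "(\<lambda>x. complex_of_real (saturation \<Gamma> k x)) \<in> LUC"
proof (rule LUC_I)
  note s = saturation_upper[where k = k, OF \<Gamma> k(2,3)] saturation_le[where k = k, OF \<Gamma> k(2,3)] saturation_range[where k = k, OF \<Gamma> k(2,3)]
  show "cmod (complex_of_real (saturation \<Gamma> k x)) \<le> 1" for x using s(3,4)[of x] by simp
  fix e :: real assume e: "e > 0"
  obtain V where V: "open V" "0 \<in> V" "\<And>v x. v \<in> V \<Longrightarrow> \<bar>k (v + x) - k x\<bar> < e"
    using Cc_uniformly_continuous_left[OF k(1) e] by blast
  have "cmod (complex_of_real (saturation \<Gamma> k y) - complex_of_real (saturation \<Gamma> k (v + y))) \<le> e"
    if v: "v \<in> V" for v y
  proof -
    have "saturation \<Gamma> k y \<le> saturation \<Gamma> k (v + y) + e"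
    proof (rule s(2))
      fix \<gamma> assume "\<gamma> \<in> \<Gamma>"
      then show "k (y + \<gamma>) \<le> saturation \<Gamma> k (v + y) + e"
        using s(1)[where \<gamma> = \<gamma> and x = "v + y"] V(3)[OF v, of "y + \<gamma>"] unfolding add.assoc by linarith
    qed
    moreover have "saturation \<Gamma> k (v + y) \<le> saturation \<Gamma> k y + e"
    proof (rule s(2))
      fix \<gamma> assume "\<gamma> \<in> \<Gamma>"
      then show "k (v + y + \<gamma>) \<le> saturation \<Gamma> k y + e"
        using s(1)[where \<gamma> = \<gamma> and x = y] V(3)[OF v, of "y + \<gamma>"] unfolding add.assoc by linarith
    qed
    ultimately have "\<bar>saturation \<Gamma> k y - saturation \<Gamma> k (v + y)\<bar> \<le> e" by linarith
    then show ?thesis by (simp only: of_real_diff[symmetric] norm_of_real)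
  qed
  then show "\<exists>V. open V \<and> 0 \<in> V \<and> (\<forall>v\<in>V. \<forall>y.
      cmod (complex_of_real (saturation \<Gamma> k y) - complex_of_real (saturation \<Gamma> k (v + y))) \<le> e)"
    using V(1,2) by blast
qed

lemma lcoset_add:
  assumes "add_subgroup \<Gamma>" "\<gamma> \<in> \<Gamma>" shows "lcoset \<Gamma> (x + \<gamma>) = lcoset \<Gamma> x"
proof -
  have "x + \<gamma> + \<delta> \<in> (+) x ` \<Gamma>" if "\<delta> \<in> \<Gamma>" for \<delta>
    using assms that unfolding add.assoc add_subgroup_def by blast
  moreover have "x + \<delta> \<in> (+) (x + \<gamma>) ` \<Gamma>" if "\<delta> \<in> \<Gamma>" for \<delta>
  proof (rule image_eqI)
    show "x + \<delta> = (x + \<gamma>) + (- \<gamma> + \<delta>)" by (simp only: add.assoc minus_add_self)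
    show "- \<gamma> + \<delta> \<in> \<Gamma>" using assms that unfolding add_subgroup_def by blast
  qed
  ultimately show ?thesis unfolding lcoset_def by blast
qed

text \<open>
  The filter of neighbourhoods of infinity of \<open>G/\<Gamma>\<close>, pulled back to \<open>G\<close>. It is proper because a
  compact \<open>K\<close> meeting every coset would map onto \<open>G/\<Gamma>\<close>.
\<close>

lemma escaping_filter:
  fixes \<Gamma> :: "'a::topological_group_add set"
  assumes \<Gamma>: "add_subgroup \<Gamma>" and nc: "\<not> compact_space (coset_topology \<Gamma>)"
  obtains F :: "'a filter" where "F \<noteq> bot"
    "\<And>K. compact K \<Longrightarrow> eventually (\<lambda>x. \<forall>\<gamma>\<in>\<Gamma>. x + \<gamma> \<notin> K) F"
proof -
  define S where "S = (\<lambda>K. {x. \<forall>\<gamma>\<in>\<Gamma>. x + \<gamma> \<notin> K})"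
  define F where "F = (INF K\<in>{K::'a set. compact K}. principal (S K))"
  have ev: "eventually P F \<longleftrightarrow> (\<exists>K\<in>{K::'a set. compact K}. eventually P (principal (S K)))" for P
    unfolding F_def
  proof (rule eventually_INF_base)
    show "{K::'a set. compact K} \<noteq> {}" using compact_empty by blast
    fix a b :: "'a set" assume "a \<in> {K. compact K}" "b \<in> {K. compact K}"
    then show "\<exists>x\<in>{K. compact K}. principal (S x) \<le> inf (principal (S a)) (principal (S b))"
      by (intro bexI[of _ "a \<union> b"]) (auto simp: S_def)
  qed
  have "S K \<noteq> {}" if K: "compact K" for K
  proof
    assume "S K = {}"
    then have "\<exists>\<gamma>\<in>\<Gamma>. x + \<gamma> \<in> K" for x by (auto simp: S_def)
    then have "lcoset \<Gamma> x \<in> lcoset \<Gamma> ` K" for x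
      using lcoset_add[OF \<Gamma>] by (metis image_eqI)
    then have "lcoset \<Gamma> ` K = topspace (coset_topology \<Gamma>)"
      unfolding topspace_coset_topology by blast
    moreover have "compactin (coset_topology \<Gamma>) (lcoset \<Gamma> ` K)"
      using K quotient_imp_continuous_map[OF quotient_map_lcoset] by (intro image_compactin) auto
    ultimately show False using nc by (simp add: compact_space_def)
  qed
  then have "F \<noteq> bot" by (auto simp: trivial_limit_def ev eventually_principal)
  moreover have "eventually (\<lambda>x. \<forall>\<gamma>\<in>\<Gamma>. x + \<gamma> \<notin> K) F" if "compact K" for K
    unfolding ev using that by (intro bexI[of _ K]) (auto simp: S_def eventually_principal)
  ultimately show thesis by (rule that)
qed

lemma invariant_prob_open_pos:
  fixes \<Gamma> :: "'a::topological_group_add set"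
  assumes \<nu>: "invariant_radon_prob \<Gamma> \<nu>" and O: "openin (coset_topology \<Gamma>) O'" "lcoset \<Gamma> 0 \<in> O'"
  shows "emeasure \<nu> O' \<noteq> 0"
proof
  assume z: "emeasure \<nu> O' = 0"
  have R: "radon_measure (coset_topology \<Gamma>) \<nu>" and sp: "space \<nu> = topspace (coset_topology \<Gamma>)"
    and sets: "sets \<nu> = sigma_sets (topspace (coset_topology \<Gamma>)) {U. openin (coset_topology \<Gamma>) U}"
    using \<nu> by (auto simp: invariant_radon_prob_def radon_measure_def)
  have inv: "\<forall>x. \<forall>B\<in>sets \<nu>. emeasure \<nu> ((\<lambda>C. (+) x ` C) ` B) = emeasure \<nu> B"
    using \<nu> by (simp add: invariant_radon_prob_def)
  have osets: "U \<in> sets \<nu>" if "openin (coset_topology \<Gamma>) U" for U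
    unfolding sets using that by (intro sigma_sets.Basic) simp
  let ?t = "\<lambda>x. (\<lambda>C. (+) x ` C) ` O'"
  have tr: "(+) x ` lcoset \<Gamma> y = lcoset \<Gamma> (x + y)" for x y
    by (auto simp: lcoset_def image_image add.assoc)
  have ot: "openin (coset_topology \<Gamma>) (?t x)" for x
  proof -
    have sub: "O' \<subseteq> range (lcoset \<Gamma>)" and op: "open (lcoset \<Gamma> -` O')"
      using O(1) by (auto simp: openin_coset_topology)
    have "?t x \<subseteq> range (lcoset \<Gamma>)" using sub tr by blast
    moreover have "lcoset \<Gamma> -` ?t x = {y. - x + y \<in> lcoset \<Gamma> -` O'}"
    proof (intro equalityI subsetI)
      fix y assume "y \<in> lcoset \<Gamma> -` ?t x"
      then obtain w where w: "lcoset \<Gamma> w \<in> O'" "lcoset \<Gamma> y = lcoset \<Gamma> (x + w)" using sub tr by auto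
      have "lcoset \<Gamma> (- x + y) = (+) (- x) ` lcoset \<Gamma> (x + w)" using w(2) tr[of "- x" y] by simp
      also have "\<dots> = lcoset \<Gamma> w" by (simp only: tr minus_add_self)
      finally show "y \<in> {y. - x + y \<in> lcoset \<Gamma> -` O'}" using w(1) by simp
    next
      fix y assume "y \<in> {y. - x + y \<in> lcoset \<Gamma> -` O'}"
      then have "lcoset \<Gamma> (- x + y) \<in> O'" by simp
      moreover have "lcoset \<Gamma> y = (+) x ` lcoset \<Gamma> (- x + y)" by (simp only: tr minus_add_self)
      ultimately show "y \<in> lcoset \<Gamma> -` ?t x" by blast
    qed
    moreover have "open {y. - x + y \<in> lcoset \<Gamma> -` O'}"
      by (intro open_vimage_UNIV op continuous_intros)
    ultimately show ?thesis by (simp add: openin_coset_topology)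
  qed
  have null: "?t x \<in> null_sets \<nu>" for x
  proof -
    have "emeasure \<nu> (?t x) = 0" using inv[rule_format, OF osets[OF O(1)], of x] z by simp
    then show ?thesis using osets[OF ot[of x]] by (simp only: null_sets_def mem_Collect_eq)
  qed
  have cov: "lcoset \<Gamma> y \<in> ?t y" for y
    using O(2) tr[of y 0] by (intro image_eqI[of _ _ "lcoset \<Gamma> 0"]) auto
  have null_K: "emeasure \<nu> K = 0" if K: "compactin (coset_topology \<Gamma>) K" for K
  proof -
    have sub: "K \<subseteq> \<Union> (range ?t)"
    proof
      fix C assume "C \<in> K"
      then obtain y where "C = lcoset \<Gamma> y"
        using compactin_subset_topspace[OF K] unfolding topspace_coset_topology by auto
      then show "C \<in> \<Union> (range ?t)" using cov[of y] by (intro UnionI[OF rangeI]) simp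
    qed
    have "openin (coset_topology \<Gamma>) T" if "T \<in> range ?t" for T using that ot by blast
    from compactinD[OF K this sub]
    obtain D where D: "finite D" "D \<subseteq> range ?t" "K \<subseteq> \<Union> D" by auto
    have "(\<Union>T\<in>D. T) \<in> null_sets \<nu>"
      by (rule null_sets_UN'[OF countable_finite[OF D(1)]]) (use D(2) null in blast)
    then have "\<Union> D \<in> null_sets \<nu>" by simp
    then show ?thesis using emeasure_mono[OF D(3), of \<nu>] by (auto simp: null_sets_def)
  qed
  have "openin (coset_topology \<Gamma>) (space \<nu>)" unfolding sp by simp
  then have "emeasure \<nu> (space \<nu>) = (SUP K\<in>{K. compactin (coset_topology \<Gamma>) K \<and> K \<subseteq> space \<nu>}. emeasure \<nu> K)"
    using R unfolding radon_measure_def by blast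
  also have "\<dots> \<le> 0" by (rule SUP_least) (simp add: null_K)
  finally have "emeasure \<nu> (space \<nu>) \<le> 0" .
  then show False using \<nu> by (simp add: invariant_radon_prob_def)
qed

text \<open>
  On an invariant function, \<open>Pmap \<Gamma> m\<close> averages constants, so it gives the induced function on
  \<open>G/\<Gamma>\<close> for every \<open>m\<close>. That function is nonnegative, continuous and positive at the base point.
\<close>

lemma iota_invariant_function_nonzero:
  fixes \<Gamma> :: "'a::topological_group_add set"
  assumes \<Gamma>: "add_subgroup \<Gamma>" and \<nu>: "invariant_radon_prob \<Gamma> \<nu>" and m: "m \<in> left_inv_means \<Gamma>"
    and h: "(\<lambda>x. complex_of_real (h x)) \<in> LUC" "\<And>x. 0 \<le> h x" "\<And>x. h x \<le> 1"
      "\<And>x \<gamma>. \<gamma> \<in> \<Gamma> \<Longrightarrow> h (x + \<gamma>) = h x" "h 0 > 0"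
  shows "iota \<Gamma> \<nu> m (\<lambda>x. complex_of_real (h x)) \<noteq> 0"
proof
  let ?H = "\<lambda>x. complex_of_real (h x)"
  let ?G = "Pmap \<Gamma> m ?H"
  assume zero: "iota \<Gamma> \<nu> m ?H = 0"
  have sp: "space \<nu> = range (lcoset \<Gamma>)"
    and sets: "sets \<nu> = sigma_sets (topspace (coset_topology \<Gamma>)) {U. openin (coset_topology \<Gamma>) U}"
    and tot: "emeasure \<nu> (space \<nu>) = 1"
    using \<nu> by (auto simp: invariant_radon_prob_def radon_measure_def topspace_coset_topology)
  have osets: "U \<in> sets \<nu>" if "openin (coset_topology \<Gamma>) U" for U
    unfolding sets using that by (intro sigma_sets.Basic) simp
  have G: "?G (lcoset \<Gamma> x) = ?H x" for x
  proof -
    have "bounded (range ?H)" using h(1) by (simp add: LUC_def bcontfun_def)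
    then have "?G (lcoset \<Gamma> x) = m (restrict (ltrans x ?H) \<Gamma>)" by (rule Pmap_lcoset[OF \<Gamma> m])
    also have "restrict (ltrans x ?H) \<Gamma> = (\<lambda>\<gamma>\<in>\<Gamma>. ?H x * (\<lambda>\<gamma>\<in>\<Gamma>. 1) \<gamma>)"
      using h(4) by (auto simp: ltrans_def restrict_def)
    also have "m \<dots> = ?H x * m (\<lambda>\<gamma>\<in>\<Gamma>. 1)"
    proof -
      have "(\<lambda>\<gamma>\<in>\<Gamma>. 1 :: complex) \<in> linfty \<Gamma>"
        by (auto simp: linfty_def intro: bounded_subset[of "{1}"])
      moreover have "\<forall>c. \<forall>f\<in>linfty \<Gamma>. m (\<lambda>x\<in>\<Gamma>. c * f x) = c * m f"
        using m by (simp add: left_inv_means_def means_def)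
      ultimately show ?thesis by (elim allE[of _ "?H x"] ballE[of _ _ "\<lambda>\<gamma>\<in>\<Gamma>. 1"]) auto
    qed
    also have "m (\<lambda>\<gamma>\<in>\<Gamma>. 1) = 1" using m by (simp add: left_inv_means_def means_def)
    finally show ?thesis by simp
  qed
  have opn: "openin (coset_topology \<Gamma>) {C \<in> space \<nu>. Re (?G C) \<in> B}" if B: "open B" for B
  proof -
    have "lcoset \<Gamma> -` {C \<in> space \<nu>. Re (?G C) \<in> B} = {x. Re (?H x) \<in> B}" by (auto simp: sp G)
    moreover have "open {x. Re (?H x) \<in> B}"
      by (intro open_vimage_UNIV B continuous_on_Re LUC_continuous h(1))
    ultimately show ?thesis unfolding openin_coset_topology using sp by auto
  qed
  have meas: "(\<lambda>C. Re (?G C)) \<in> borel_measurable \<nu>"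
  proof (rule borel_measurableI)
    fix B :: "real set" assume "open B"
    from osets[OF opn[OF this]] show "(\<lambda>C. Re (?G C)) -` B \<inter> space \<nu> \<in> sets \<nu>"
      by (simp add: vimage_def Int_def conj_commute)
  qed
  interpret finite_measure \<nu> by (rule finite_measureI) (simp add: tot)
  have int: "integrable \<nu> (\<lambda>C. Re (?G C))"
    by (rule integrable_const_bound[of _ 1]) (use meas h(2,3) in \<open>auto simp: sp G intro!: AE_I2\<close>)
  have "(\<integral>C. ?G C \<partial>\<nu>) = (\<integral>C. complex_of_real (Re (?G C)) \<partial>\<nu>)"
    by (rule Bochner_Integration.integral_cong) (auto simp: sp G)
  also have "\<dots> = complex_of_real (\<integral>C. Re (?G C) \<partial>\<nu>)" by (rule integral_complex_of_real)
  finally have "(\<integral>C. Re (?G C) \<partial>\<nu>) = 0" using zero h(1) by (simp add: iota_def)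
  moreover have "AE C in \<nu>. 0 \<le> Re (?G C)" by (rule AE_I2) (use h(2) in \<open>auto simp: sp G\<close>)
  ultimately have "AE C in \<nu>. Re (?G C) = 0" using integral_nonneg_eq_0_iff_AE[OF int] by simp
  then have "AE C in \<nu>. \<not> Re (?G C) \<in> {0<..}" by eventually_elim simp
  then have "{C \<in> space \<nu>. Re (?G C) \<in> {0<..}} \<in> null_sets \<nu>"
    using osets[OF opn[of "{0<..}"]] by (subst (asm) AE_iff_null) auto
  moreover have "emeasure \<nu> {C \<in> space \<nu>. Re (?G C) \<in> {0<..}} \<noteq> 0"
    by (rule invariant_prob_open_pos[OF \<nu> opn]) (use h(5) in \<open>auto simp: sp G\<close>)
  ultimately show False by (simp add: null_sets_def)
qed

theorem theoremV9:
  fixes \<mu> :: "'a::{topological_group_add, t2_space} measure"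
    and \<Gamma> :: "'a set"
    and \<nu> :: "'a set measure"
  assumes "locally_compact_space (euclidean :: 'a topology)"
    and "left_haar_measure \<mu>"
    and "amenable \<mu>"
    and "lattice_subgroup \<Gamma>"
    and "invariant_radon_prob \<Gamma> \<nu>"
    and "\<not> uniform_lattice \<Gamma>"
  shows "\<not> (\<lambda>m. restrict m LUC) ` top_left_inv_means \<mu> \<subseteq> iota \<Gamma> \<nu> ` left_inv_means \<Gamma>"
proof
  assume sub: "(\<lambda>m. restrict m LUC) ` top_left_inv_means \<mu> \<subseteq> iota \<Gamma> \<nu> ` left_inv_means \<Gamma>"
  interpret haar_group \<mu> using assms(1,2) by unfold_locales
  have \<Gamma>: "add_subgroup \<Gamma>" and nc: "\<not> compact_space (coset_topology \<Gamma>)"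
    using assms(4,6) by (auto simp: lattice_subgroup_def uniform_lattice_def)
  have "compact {0::'a}" "open (UNIV::'a set)" "{0::'a} \<subseteq> UNIV" by auto
  from Cc_Urysohn[OF locally_compact this]
  obtain k :: "'a \<Rightarrow> real" where k: "k \<in> Cc" "\<And>x. 0 \<le> k x" "\<And>x. k x \<le> 1" "k 0 = 1"
    by (metis singletonI)
  obtain K where K: "continuous_on UNIV k" "compact K" "\<And>x. x \<notin> K \<Longrightarrow> k x = 0"
    using CcE[OF k(1)] by blast
  define h where "h = saturation \<Gamma> k"
  define H where "H = (\<lambda>x. complex_of_real (h x))"
  note sat = saturation_props[where k = k, OF \<Gamma> k(2,3), folded h_def]
  have HL: "H \<in> LUC" unfolding H_def h_def by (rule saturation_LUC[OF \<Gamma> k(1-3)])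
  have "0 \<in> \<Gamma>" using \<Gamma> by (simp add: add_subgroup_def)
  then have h0: "h 0 > 0" using sat(1)[where \<gamma> = 0 and x = 0] k(4) by simp
  obtain F :: "'a filter" where F: "F \<noteq> bot"
      "\<And>K. compact K \<Longrightarrow> eventually (\<lambda>x. \<forall>\<gamma>\<in>\<Gamma>. x + \<gamma> \<notin> K) F"
    using escaping_filter[OF \<Gamma> nc] by blast
  obtain U where U: "U \<le> F" "U \<noteq> bot" "\<And>P. eventually P U \<or> eventually (\<lambda>x. \<not> P x) U"
    using ultrafilter_exists[OF F(1)] by blast
  obtain m0 where m0: "m0 \<in> Linf_means \<mu>" "\<forall>x. \<forall>\<phi>\<in>Linf \<mu>. m0 (ltrans x \<phi>) = m0 \<phi>"
    using assms(3) by (auto simp: amenable_def)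
  define N where "N = (\<lambda>\<psi>. m0 (\<lambda>y. Lim U (\<lambda>x. \<psi> (y + x))))"
  interpret luc_mean \<mu> N unfolding N_def by (rule ultrafilter_mean[OF m0 U(2,3)])
  \<comment> \<open>For fixed \<open>y\<close>, the coset of \<open>y + x\<close> leaves the image of \<open>K\<close> as \<open>x\<close> escapes along \<open>U\<close>.\<close>
  have "Lim U (\<lambda>x. H (y + x)) = 0" for y
  proof (rule tendsto_Lim[OF U(2)], rule tendsto_eventually)
    have "compact ((+) (- y) ` K)" by (rule compact_translation_group[OF K(2)])
    from filter_leD[OF U(1) F(2)[OF this]]
    show "eventually (\<lambda>x. H (y + x) = 0) U"
    proof eventually_elim
      case (elim x)
      have "h (y + x) \<le> 0"
      proof (rule sat(2))
        fix \<gamma> assume \<gamma>: "\<gamma> \<in> \<Gamma>"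
        have "y + x + \<gamma> \<notin> K"
        proof
          assume "y + x + \<gamma> \<in> K"
          moreover have "x + \<gamma> = - y + (y + x + \<gamma>)" by (simp only: add.assoc minus_add_self)
          ultimately show False using elim \<gamma> by blast
        qed
        then show "k (y + x + \<gamma>) \<le> 0" using K(3) by simp
      qed
      then show ?case using sat(3)[of "y + x"] by (simp add: H_def)
    qed
  qed
  moreover have "Lim U (\<lambda>x. 0 :: complex) = 0" by (rule tendsto_Lim[OF U(2) tendsto_const])
  ultimately have "N H = N (\<lambda>x. 0 * 1)" by (simp add: N_def)
  then have NH: "N H = 0" using N_scale[OF LUC_const, of 0 1] by simp
  obtain e :: "'a \<Rightarrow> real" where e: "e \<in> Cc" "\<And>x. e x \<ge> 0" "(\<integral>x. e x \<partial>\<mu>) = 1"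
    by (rule symmetric_bump[of UNIV]) auto
  define M where "M = (\<lambda>\<phi>\<in>Linf \<mu>. N (conv \<mu> e \<phi>))"
  have "M \<in> top_left_inv_means \<mu>" unfolding M_def by (rule top_left_inv_extension[OF e])
  then obtain m where m: "m \<in> left_inv_means \<Gamma>" "restrict M LUC = iota \<Gamma> \<nu> m" using sub by blast
  have "M H = 0" using N_conv_Cc[OF e(1) HL] NH LUC_Linf[OF HL] by (simp add: M_def)
  then have "iota \<Gamma> \<nu> m H = 0" using m(2)[symmetric] HL by simp
  moreover have "iota \<Gamma> \<nu> m H \<noteq> 0"
    unfolding H_def
    by (rule iota_invariant_function_nonzero[OF \<Gamma> assms(5) m(1)])
      (use HL sat(3-5) h0 in \<open>auto simp: H_def\<close>)
  ultimately show False by blast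
qed

end
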